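(* Let $\Omega$ be a finite set, $\ell \ge 2$, and $\mathcal{P}$ a distribution on $\Omega^\ell$ with $\rho(\mathcal{P}) \le \rho < 1$ (the marginals need not be equal). For $n \in \mathbb{N}$ let $\overline{X}_i = (X_i^{(1)},\ldots,X_i^{(\ell)})$, $i \in [n]$, be i.i.d. according to $\mathcal{P}$, and $\underline{X}^{(j)} = (X_1^{(j)}, \ldots, X_n^{(j)})$. Let $\mu^{(1)}, \ldots, \mu^{(\ell)} \in (0,1]$. Then there exist $k \in \mathbb{N}$ and $\gamma > 0$, depending only on $\mathcal{P}$ and $\mu^{(1)}, \ldots, \mu^{(\ell)}$, and a constant $c(\mathcal{P}, \mu^{(1)}, \ldots, \mu^{(\ell)}) > 0$, such that for all $n$ and all functions $f^{(1)}, \ldots, f^{(\ell)}: \Omega^n \to [0,1]$: if $\mathbb{E}[f^{(j)}(\underline{X}^{(j)})] = \mu^{(j)}$ and $\max_{\sigma: 0 < |\sigma| \le k} |\hat{f}^{(j)}(\sigma)| \le \gamma$ for every $j \in [\ell]$, then \[ \mathbb{E}\Big[ \prod_{j=1}^\ell f^{(j)}(\underline{X}^{(j)}) \Big] \ge c(\mathcal{P}, \mu^{(1)}, \ldots, \mu^{(\ell)}) > 0. \]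
   Context: Correlation: for $\overline{X} \sim \mathcal{P}$ and $S,T \subseteq [\ell]$, $\rho(\mathcal{P},S,T) := \sup\{\mathrm{Cov}[f(X^{(S)}), g(X^{(T)})] : \mathrm{Var}[f(X^{(S)})] = \mathrm{Var}[g(X^{(T)})] = 1\}$ over real functions $f,g$, and $\rho(\mathcal{P}) := \max_{j} \rho(\mathcal{P},\{j\},[\ell]\setminus\{j\})$. Fourier coefficients: for step $j$ let $\pi^{(j)}$ be the $j$-th marginal of $\mathcal{P}$ and fix an orthonormal basis $\phi_0 \equiv 1, \phi_1, \ldots, \phi_{m-1}$ of $L^2(\mathrm{supp}(\pi^{(j)}), \pi^{(j)})$; for $\sigma = (\sigma_1,\ldots,\sigma_n) \in \{0,\ldots,m-1\}^n$ put $\phi_\sigma(x) = \prod_i \phi_{\sigma_i}(x_i)$, so that $f^{(j)} = \sum_\sigma \hat{f}^{(j)}(\sigma) \phi_\sigma$ on the support of the law of $\underline{X}^{(j)}$, and $|\sigma| := |\{i : \sigma_i \neq 0\}|$. *)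

theory Defs
  imports "HOL-Probability.Probability"
begin

text \<open>
  The finite set \<open>\<Omega>\<close> and the set of steps \<open>[\<ell>]\<close> are rendered as types \<open>'w\<close> and \<open>'l\<close> of class
  \<open>finite\<close>, so that a distribution on \<open>\<Omega>\<^sup>\<ell>\<close> is a \<open>('l \<Rightarrow> 'w) pmf\<close>.
  The length \<open>n\<close> is a natural number: the coordinates are \<open>{..<n}\<close>, and \<open>\<Omega>\<^sup>n\<close> is
  \<open>{..<n} \<rightarrow>\<^sub>E UNIV\<close>.
\<close>

definition pmf_cov :: "'a pmf \<Rightarrow> ('a \<Rightarrow> real) \<Rightarrow> ('a \<Rightarrow> real) \<Rightarrow> real" where
  "pmf_cov P F G =
     measure_pmf.expectation P
       (\<lambda>x. (F x - measure_pmf.expectation P F) * (G x - measure_pmf.expectation P G))"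

definition corr_values :: "('l::finite \<Rightarrow> 'w::finite) pmf \<Rightarrow> 'l set \<Rightarrow> 'l set \<Rightarrow> real set" where
  "corr_values P S T =
     {pmf_cov P (\<lambda>x. f (restrict x S)) (\<lambda>x. g (restrict x T)) | f g.
        measure_pmf.variance P (\<lambda>x. f (restrict x S)) = 1 \<and>
        measure_pmf.variance P (\<lambda>x. g (restrict x T)) = 1}"

text \<open>
  If \<open>X\<^sup>S\<close> or \<open>X\<^sup>T\<close> is almost surely constant, no function has variance 1; the supremum of the
  empty set is then taken to be 0. Otherwise the set is nonempty and bounded above by 1
  (lemma \<open>corr_values_le_1\<close>).
\<close>

definition corr :: "('l::finite \<Rightarrow> 'w::finite) pmf \<Rightarrow> 'l set \<Rightarrow> 'l set \<Rightarrow> real" where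
  "corr P S T = (if corr_values P S T = {} then 0 else Sup (corr_values P S T))"

definition max_corr :: "('l::finite \<Rightarrow> 'w::finite) pmf \<Rightarrow> real" where
  "max_corr P = (MAX j. corr P {j} (UNIV - {j}))"

definition iid_law :: "('l::finite \<Rightarrow> 'w::finite) pmf \<Rightarrow> nat \<Rightarrow> (nat \<Rightarrow> 'l \<Rightarrow> 'w) pmf" where
  "iid_law P n = Pi_pmf {..<n} undefined (\<lambda>_. P)"

definition step_vec :: "nat \<Rightarrow> 'l \<Rightarrow> (nat \<Rightarrow> 'l \<Rightarrow> 'w) \<Rightarrow> nat \<Rightarrow> 'w" where
  "step_vec n j X = (\<lambda>i\<in>{..<n}. X i j)"

definition marginal :: "('l::finite \<Rightarrow> 'w::finite) pmf \<Rightarrow> 'l \<Rightarrow> 'w pmf" where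
  "marginal P j = map_pmf (\<lambda>x. x j) P"

text \<open>
  \<open>\<phi> 0, \<dots>, \<phi> (m - 1)\<close> is an orthonormal basis of \<open>L\<^sup>2(supp p, p)\<close> with \<open>\<phi> 0 = 1\<close>; elements of this
  space are functions considered on the support of \<open>p\<close> only.
\<close>

definition fourier_basis :: "'w::finite pmf \<Rightarrow> nat \<Rightarrow> (nat \<Rightarrow> 'w \<Rightarrow> real) \<Rightarrow> bool" where
  "fourier_basis p m \<phi> \<longleftrightarrow>
     0 < m \<and>
     (\<forall>x\<in>set_pmf p. \<phi> 0 x = 1) \<and>
     (\<forall>a<m. \<forall>b<m. measure_pmf.expectation p (\<lambda>x. \<phi> a x * \<phi> b x) = (if a = b then 1 else 0)) \<and>
     (\<forall>h. \<exists>c. \<forall>x\<in>set_pmf p. h x = (\<Sum>a<m. c a * \<phi> a x))"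

definition basis_prod :: "nat \<Rightarrow> (nat \<Rightarrow> 'w \<Rightarrow> real) \<Rightarrow> (nat \<Rightarrow> nat) \<Rightarrow> (nat \<Rightarrow> 'w) \<Rightarrow> real" where
  "basis_prod n \<phi> \<sigma> x = (\<Prod>i<n. \<phi> (\<sigma> i) (x i))"

definition multi_indices :: "nat \<Rightarrow> nat \<Rightarrow> (nat \<Rightarrow> nat) set" where
  "multi_indices n m = ({..<n} \<rightarrow>\<^sub>E {..<m})"

definition index_weight :: "nat \<Rightarrow> (nat \<Rightarrow> nat) \<Rightarrow> nat" where
  "index_weight n \<sigma> = card {i\<in>{..<n}. \<sigma> i \<noteq> 0}"

text \<open>
  The coefficient of \<open>f\<close> at \<open>\<sigma>\<close>, as an inner product. Lemmas \<open>fourier_expansion\<close> and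
  \<open>fourier_coeff_unique\<close> show that these are exactly the coefficients of the expansion of \<open>f\<close> in the
  functions \<open>\<phi>\<^sub>\<sigma>\<close> on the support of the law of the \<open>j\<close>-th step.
\<close>

definition fourier_coeff ::
  "('l::finite \<Rightarrow> 'w::finite) pmf \<Rightarrow> nat \<Rightarrow> 'l \<Rightarrow> (nat \<Rightarrow> 'w \<Rightarrow> real) \<Rightarrow>
     ((nat \<Rightarrow> 'w) \<Rightarrow> real) \<Rightarrow> (nat \<Rightarrow> nat) \<Rightarrow> real" where
  "fourier_coeff P n j \<phi> f \<sigma> =
     measure_pmf.expectation (iid_law P n)
       (\<lambda>X. f (step_vec n j X) * basis_prod n \<phi> \<sigma> (step_vec n j X))"

lemma corr_values_le_1:
  assumes "v \<in> corr_values P S T"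
  shows "v \<le> 1"
proof -
  obtain f g where v: "v = pmf_cov P (\<lambda>x. f (restrict x S)) (\<lambda>x. g (restrict x T))"
    and f: "measure_pmf.variance P (\<lambda>x. f (restrict x S)) = 1"
    and g: "measure_pmf.variance P (\<lambda>x. g (restrict x T)) = 1"
    using assms by (auto simp: corr_values_def)
  define F where "F x = f (restrict x S) - measure_pmf.expectation P (\<lambda>x. f (restrict x S))" for x
  define G where "G x = g (restrict x T) - measure_pmf.expectation P (\<lambda>x. g (restrict x T))" for x
  have int: "integrable (measure_pmf P) h" for h :: "('a \<Rightarrow> 'b) \<Rightarrow> real"
    by (rule integrable_measure_pmf_finite) simp
  have "0 \<le> measure_pmf.expectation P (\<lambda>x. (F x - G x)\<^sup>2)"
    by simp
  also have "\<dots> = measure_pmf.expectation P (\<lambda>x. (F x)\<^sup>2 + (G x)\<^sup>2 - 2 * (F x * G x))"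
    by (simp add: power2_diff algebra_simps)
  also have "\<dots> = measure_pmf.expectation P (\<lambda>x. (F x)\<^sup>2) + measure_pmf.expectation P (\<lambda>x. (G x)\<^sup>2)
      - 2 * measure_pmf.expectation P (\<lambda>x. F x * G x)"
    by (simp add: int del: power2_eq_square)
  finally show ?thesis
    using f g by (simp add: v pmf_cov_def F_def G_def)
qed

lemma finite_set_iid_law: "finite (set_pmf (iid_law P n))"
  by (simp add: iid_law_def set_Pi_pmf finite_PiE_dflt)

lemma expectation_prod_iid_law:
  fixes h :: "nat \<Rightarrow> ('l::finite \<Rightarrow> 'w::finite) \<Rightarrow> real"
  shows "measure_pmf.expectation (iid_law P n) (\<lambda>X. \<Prod>i<n. h i (X i)) =
    (\<Prod>i<n. measure_pmf.expectation P (h i))"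
proof -
  have "prob_space.indep_vars (measure_pmf (iid_law P n)) (\<lambda>_. count_space UNIV) (\<lambda>i X. X i) {..<n}"
    unfolding iid_law_def by (rule indep_vars_Pi_pmf) simp
  then have "prob_space.indep_vars (measure_pmf (iid_law P n)) (\<lambda>_. borel) (\<lambda>i X. h i (X i)) {..<n}"
    by (rule prob_space.indep_vars_compose2[OF measure_pmf.prob_space_axioms]) simp
  then have "measure_pmf.expectation (iid_law P n) (\<lambda>X. \<Prod>i<n. h i (X i)) =
      (\<Prod>i<n. measure_pmf.expectation (iid_law P n) (\<lambda>X. h i (X i)))"
    by (intro prob_space.indep_vars_lebesgue_integral[OF measure_pmf.prob_space_axioms])
      (auto intro: integrable_measure_pmf_finite finite_set_iid_law)
  also have "\<dots> = (\<Prod>i<n. measure_pmf.expectation (map_pmf (\<lambda>X. X i) (iid_law P n)) (h i))"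
    by simp
  also have "\<dots> = (\<Prod>i<n. measure_pmf.expectation P (h i))"
    by (intro prod.cong refl) (simp add: iid_law_def Pi_pmf_component del: integral_map_pmf)
  finally show ?thesis .
qed

lemma basis_prod_orthonormal:
  assumes b: "fourier_basis (marginal P j) m \<phi>"
    and "\<sigma> \<in> multi_indices n m" "\<tau> \<in> multi_indices n m"
  shows "measure_pmf.expectation (iid_law P n)
      (\<lambda>X. basis_prod n \<phi> \<sigma> (step_vec n j X) * basis_prod n \<phi> \<tau> (step_vec n j X)) =
    (if \<sigma> = \<tau> then 1 else 0)"
proof -
  have *: "measure_pmf.expectation P (\<lambda>x. \<phi> (\<sigma> i) (x j) * \<phi> (\<tau> i) (x j)) =
      (if \<sigma> i = \<tau> i then 1 else 0)" if "i < n" for i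
  proof -
    have "\<sigma> i < m" "\<tau> i < m"
      using assms(2,3) that by (auto simp: multi_indices_def)
    then show ?thesis
      using b by (simp add: fourier_basis_def marginal_def)
  qed
  have "measure_pmf.expectation (iid_law P n)
      (\<lambda>X. basis_prod n \<phi> \<sigma> (step_vec n j X) * basis_prod n \<phi> \<tau> (step_vec n j X)) =
    measure_pmf.expectation (iid_law P n) (\<lambda>X. \<Prod>i<n. \<phi> (\<sigma> i) (X i j) * \<phi> (\<tau> i) (X i j))"
    by (simp add: basis_prod_def step_vec_def prod.distrib)
  also have "\<dots> = (\<Prod>i<n. measure_pmf.expectation P (\<lambda>x. \<phi> (\<sigma> i) (x j) * \<phi> (\<tau> i) (x j)))"
    by (rule expectation_prod_iid_law)
  also have "\<dots> = (\<Prod>i<n. if \<sigma> i = \<tau> i then 1 else 0)"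
    by (intro prod.cong) (auto simp: *)
  also have "\<dots> = (if \<forall>i<n. \<sigma> i = \<tau> i then 1 else 0)"
    by auto
  also have "(\<forall>i<n. \<sigma> i = \<tau> i) \<longleftrightarrow> \<sigma> = \<tau>"
    using assms(2,3) unfolding multi_indices_def by (metis PiE_ext lessThan_iff)
  finally show ?thesis .
qed

lemma step_vec_support:
  assumes "X \<in> set_pmf (iid_law P n)"
  shows "step_vec n j X \<in> {..<n} \<rightarrow>\<^sub>E set_pmf (marginal P j)"
  using assms by (auto simp: iid_law_def set_Pi_pmf PiE_dflt_def step_vec_def marginal_def)

lemma finite_multi_indices: "finite (multi_indices n m)"
  by (simp add: multi_indices_def finite_PiE)

lemma fourier_coeff_unique:
  assumes b: "fourier_basis (marginal P j) m \<phi>"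
    and f: "\<And>x. x \<in> {..<n} \<rightarrow>\<^sub>E set_pmf (marginal P j) \<Longrightarrow>
      f x = (\<Sum>\<sigma>\<in>multi_indices n m. c \<sigma> * basis_prod n \<phi> \<sigma> x)"
    and "\<tau> \<in> multi_indices n m"
  shows "c \<tau> = fourier_coeff P n j \<phi> f \<tau>"
proof -
  let ?B = "\<lambda>\<sigma> X. basis_prod n \<phi> \<sigma> (step_vec n j X)"
  have "fourier_coeff P n j \<phi> f \<tau> =
      measure_pmf.expectation (iid_law P n) (\<lambda>X. \<Sum>\<sigma>\<in>multi_indices n m. c \<sigma> * (?B \<sigma> X * ?B \<tau> X))"
    unfolding fourier_coeff_def
    by (intro integral_cong_AE)
      (auto simp: AE_measure_pmf_iff f[OF step_vec_support] sum_distrib_right mult.assoc)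
  also have "\<dots> = (\<Sum>\<sigma>\<in>multi_indices n m.
      c \<sigma> * measure_pmf.expectation (iid_law P n) (\<lambda>X. ?B \<sigma> X * ?B \<tau> X))"
    by (subst Bochner_Integration.integral_sum)
      (auto intro!: integrable_measure_pmf_finite finite_set_iid_law)
  also have "\<dots> = (\<Sum>\<sigma>\<in>multi_indices n m. if \<sigma> = \<tau> then c \<sigma> else 0)"
    by (intro sum.cong) (auto simp: basis_prod_orthonormal[OF b] assms(3))
  also have "\<dots> = c \<tau>"
    using assms(3) by (simp add: finite_multi_indices)
  finally show ?thesis by simp
qed

lemma fourier_expansion:
  assumes b: "fourier_basis (marginal P j) m \<phi>"
    and x: "x \<in> {..<n} \<rightarrow>\<^sub>E set_pmf (marginal P j)"
  shows "f x = (\<Sum>\<sigma>\<in>multi_indices n m. fourier_coeff P n j \<phi> f \<sigma> * basis_prod n \<phi> \<sigma> x)"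
proof -
  define S where "S = set_pmf (marginal P j)"
  have "\<forall>h. \<exists>c. \<forall>z\<in>S. h z = (\<Sum>a<m. c a * \<phi> a z)"
    using b unfolding fourier_basis_def S_def by blast
  then have "\<forall>y. \<exists>c. \<forall>z\<in>S. (if z = y then 1 else 0 :: real) = (\<Sum>a<m. c a * \<phi> a z)"
    by (intro allI) (erule allE)
  then obtain c where c: "\<And>y z. z \<in> S \<Longrightarrow> (if z = y then 1 else 0 :: real) = (\<Sum>a<m. c y a * \<phi> a z)"
    by metis
  define d where "d \<sigma> = (\<Sum>y\<in>{..<n} \<rightarrow>\<^sub>E S. f y * (\<Prod>i<n. c (y i) (\<sigma> i)))" for \<sigma>
  have d: "f x = (\<Sum>\<sigma>\<in>multi_indices n m. d \<sigma> * basis_prod n \<phi> \<sigma> x)"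
    if x: "x \<in> {..<n} \<rightarrow>\<^sub>E S" for x
  proof -
    have ind: "(if y = x then 1 else 0 :: real) =
        (\<Sum>\<sigma>\<in>multi_indices n m. (\<Prod>i<n. c (y i) (\<sigma> i)) * basis_prod n \<phi> \<sigma> x)"
      if y: "y \<in> {..<n} \<rightarrow>\<^sub>E S" for y
    proof -
      have "y = x \<longleftrightarrow> (\<forall>i<n. x i = y i)"
        using x y by (metis PiE_ext lessThan_iff)
      then have "(if y = x then 1 else 0 :: real) = (\<Prod>i<n. if x i = y i then 1 else 0)"
        by auto
      also have "\<dots> = (\<Prod>i<n. \<Sum>a<m. c (y i) a * \<phi> a (x i))"
        using x by (intro prod.cong refl c) auto
      also have "\<dots> = (\<Sum>\<sigma>\<in>multi_indices n m. \<Prod>i<n. c (y i) (\<sigma> i) * \<phi> (\<sigma> i) (x i))"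
        unfolding multi_indices_def by (rule prod_sum_PiE) auto
      finally show ?thesis
        by (simp add: prod.distrib basis_prod_def)
    qed
    have fin: "finite ({..<n} \<rightarrow>\<^sub>E S)"
      by (auto intro: finite_PiE)
    have "f x = (\<Sum>y\<in>{..<n} \<rightarrow>\<^sub>E S. if y = x then f y else 0)"
      using x fin by simp
    also have "\<dots> = (\<Sum>y\<in>{..<n} \<rightarrow>\<^sub>E S. f y * (if y = x then 1 else 0))"
      by (intro sum.cong) auto
    also have "\<dots> = (\<Sum>y\<in>{..<n} \<rightarrow>\<^sub>E S. \<Sum>\<sigma>\<in>multi_indices n m.
        f y * (\<Prod>i<n. c (y i) (\<sigma> i)) * basis_prod n \<phi> \<sigma> x)"
      by (intro sum.cong refl) (simp add: ind sum_distrib_left mult.assoc)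
    also have "\<dots> = (\<Sum>\<sigma>\<in>multi_indices n m. d \<sigma> * basis_prod n \<phi> \<sigma> x)"
      by (subst sum.swap) (simp add: d_def sum_distrib_right)
    finally show ?thesis .
  qed
  have "d \<sigma> = fourier_coeff P n j \<phi> f \<sigma>" if "\<sigma> \<in> multi_indices n m" for \<sigma>
    using b d that unfolding S_def by (intro fourier_coeff_unique) auto
  then show ?thesis
    using d[of x] x by (simp add: S_def)
qed

end

theory Submission
  imports Defs
begin

text \<open>
  Gaussian space is avoided: the random indicator vectors \<open>1{X\<^sup>j = x}\<close> are replaced by random vectors
  \<open>w\<^sub>j(x)\<close> with the same first and second moments. Since \<open>Var (\<Sum>\<^sub>j F\<^sub>j(X\<^sup>j)) \<ge> 2 \<epsilon> \<Sum>\<^sub>j Var (F\<^sub>j(X\<^sup>j))\<close>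
  with \<open>\<epsilon> > 0\<close> depending on \<open>\<rho>\<close> and \<open>\<ell>\<close>, the covariance can be realised by functions \<open>w\<^sub>j(r\<^sub>j)\<close> of random
  seeds which, with probability \<open>\<epsilon>\<close>, are independent across the steps, and are equal otherwise. For such
  seeds a reverse Hoelder inequality \<open>E \<Prod>\<^sub>j u\<^sub>j\<^sup>b \<ge> \<Prod>\<^sub>j (E u\<^sub>j)\<^sup>b\<close> holds and tensorizes, which gives a lower
  bound independent of \<open>n\<close>.

  To pass to these seeds, the functions are first smoothed by the noise operator, at a small cost since
  \<open>\<rho> < 1\<close>, and truncated to low degree. A Lindeberg replacement is carried out in all coordinates except
  the boundedly many of large influence. As test function we take \<open>\<Prod>\<^sub>j sin\<^sup>2 x\<^sub>j\<close>, which lies below \<open>\<Prod>\<^sub>j x\<^sub>j\<close> on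
  the unit cube and is a convex combination of characters up to signs, so only characteristic functions
  have to be compared. The hypothesis on the Fourier coefficients ensures that fixing the coordinates of
  large influence hardly changes the mean of the functions.
\<close>

text \<open>The replaced polynomials may leave the interval [0,1], which usually calls for a
  separate rounding step. Here sin^2 does this itself: it lies in [0,1] on the whole line, so the
  reverse Hoelder inequality applies directly to the squared sines of the replaced polynomials; it
  is 1-Lipschitz, which absorbs the truncation; and on [0,1] it is at least x^2/4, which keeps its
  mean of order \<mu>^2.

  The replacement is controlled by third moments, hence by hypercontractivity, hence in bounded
  degree. Truncation alone would have no small error; after noise the discarded part is small in
  L^2.

  Coordinates of large influence cannot be replaced, so the replacement is carried out conditionally
  on them, with the absolute value of the error inside the average. Only coefficients of weight at
  most their number enter the conditional means; the bound on this number, not the truncation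
  degree, is the \<open>k\<close> of the theorem. The constants form a chain starting from P and
  \<mu>, so neither n nor the Fourier basis enters.\<close>

section \<open>Finite expectations\<close>

text \<open>
  Only meaningful for finite support, where it is the expectation; linearity then needs no
  integrability conditions.
\<close>

definition expec :: "'a pmf \<Rightarrow> ('a \<Rightarrow> 'b::real_vector) \<Rightarrow> 'b" where
  "expec p f = (\<Sum>x\<in>set_pmf p. pmf p x *\<^sub>R f x)"

lemma expec_eq_expectation:
  fixes f :: "'a \<Rightarrow> 'b::{banach, second_countable_topology}"
  assumes "finite (set_pmf p)"
  shows "measure_pmf.expectation p f = expec p f"
  using assms unfolding expec_def by (intro integral_measure_pmf) auto

lemma expec_cong: "(\<And>x. x \<in> set_pmf p \<Longrightarrow> f x = g x) \<Longrightarrow> expec p f = expec p g"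
  by (simp add: expec_def)

lemma expec_add: "expec p (\<lambda>x. f x + g x) = expec p f + expec p g"
  by (simp add: expec_def scaleR_add_right sum.distrib)

lemma expec_diff: "expec p (\<lambda>x. f x - g x) = expec p f - expec p g"
  by (simp add: expec_def scaleR_diff_right sum_subtractf)

lemma expec_sum: "expec p (\<lambda>x. \<Sum>i\<in>I. f i x) = (\<Sum>i\<in>I. expec p (f i))"
  unfolding expec_def scaleR_sum_right by (rule sum.swap)

lemma expec_cmult: "expec p (\<lambda>x. c * f x) = c * expec p f"
  for f :: "'a \<Rightarrow> 'b::real_algebra"
  by (simp add: expec_def sum_distrib_left)

lemma expec_multc: "expec p (\<lambda>x. f x * c) = expec p f * c"
  for f :: "'a \<Rightarrow> 'b::real_algebra"
  by (simp add: expec_def sum_distrib_right)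

lemma expec_divide: "expec p (\<lambda>x. f x / c) = expec p f / c"
  for f :: "'a \<Rightarrow> real"
  by (simp add: expec_def sum_divide_distrib)

lemma expec_const [simp]:
  assumes "finite (set_pmf p)"
  shows "expec p (\<lambda>x. c) = c"
  using sum_pmf_eq_1[OF assms order.refl] by (simp add: expec_def flip: scaleR_sum_left)

lemma expec_mono:
  fixes f g :: "'a \<Rightarrow> real"
  assumes "\<And>x. x \<in> set_pmf p \<Longrightarrow> f x \<le> g x"
  shows "expec p f \<le> expec p g"
  using assms by (auto simp: expec_def intro!: sum_mono mult_left_mono)

lemma expec_nonneg:
  fixes f :: "'a \<Rightarrow> real"
  assumes "\<And>x. x \<in> set_pmf p \<Longrightarrow> 0 \<le> f x"
  shows "0 \<le> expec p f"
  using assms by (auto simp: expec_def intro!: sum_nonneg)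

lemma norm_expec:
  fixes f :: "'a \<Rightarrow> 'b::real_normed_vector"
  shows "norm (expec p f) \<le> expec p (\<lambda>x. norm (f x))"
  unfolding expec_def by (rule order_trans[OF norm_sum]) simp

lemma expec_square_nonneg: "0 \<le> expec p (\<lambda>x. (f x)\<^sup>2)" for f :: "'a \<Rightarrow> real"
  by (rule expec_nonneg) simp

lemma expec_prod_sums:
  fixes f g :: "'i \<Rightarrow> 'a \<Rightarrow> real"
  shows "expec p (\<lambda>x. (\<Sum>i\<in>I. f i x) * (\<Sum>j\<in>J. g j x)) = (\<Sum>i\<in>I. \<Sum>j\<in>J. expec p (\<lambda>x. f i x * g j x))"
  by (simp add: sum_product expec_sum)

lemma expec_bilinear:
  fixes f g :: "'i \<Rightarrow> 'a \<Rightarrow> real"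
  shows "expec p (\<lambda>x. (\<Sum>i\<in>I. c i * f i x) * (\<Sum>j\<in>J. d j * g j x)) =
    (\<Sum>i\<in>I. \<Sum>j\<in>J. c i * d j * expec p (\<lambda>x. f i x * g j x))"
proof -
  have "expec p (\<lambda>x. (c i * f i x) * (d j * g j x)) = c i * d j * expec p (\<lambda>x. f i x * g j x)" for i j
    by (subst expec_cmult[symmetric]) (simp add: mult_ac)
  then show ?thesis by (simp add: expec_prod_sums)
qed

lemma expec_cauchy_schwarz:
  fixes f g :: "'a \<Rightarrow> real"
  shows "(expec p (\<lambda>x. f x * g x))\<^sup>2 \<le> expec p (\<lambda>x. (f x)\<^sup>2) * expec p (\<lambda>x. (g x)\<^sup>2)"
proof -
  define a where "a x = sqrt (pmf p x) * f x" for x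
  define b where "b x = sqrt (pmf p x) * g x" for x
  have "(\<Sum>x\<in>set_pmf p. a x * b x)\<^sup>2 \<le> (\<Sum>x\<in>set_pmf p. (a x)\<^sup>2) * (\<Sum>x\<in>set_pmf p. (b x)\<^sup>2)"
    by (rule Cauchy_Schwarz_ineq_sum)
  moreover have "a x * b x = pmf p x * (f x * g x)" for x
  proof -
    have "a x * b x = (sqrt (pmf p x) * sqrt (pmf p x)) * (f x * g x)"
      unfolding a_def b_def by (simp only: mult_ac)
    then show ?thesis by (simp add: real_sqrt_mult_self)
  qed
  moreover have "(a x)\<^sup>2 = pmf p x * (f x)\<^sup>2" "(b x)\<^sup>2 = pmf p x * (g x)\<^sup>2" for x
    by (simp_all add: a_def b_def power_mult_distrib)
  ultimately show ?thesis
    by (simp add: expec_def)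
qed

lemma expec_map_pmf:
  assumes "finite (set_pmf p)"
  shows "expec (map_pmf h p) f = expec p (\<lambda>x. f (h x))"
proof -
  have "expec (map_pmf h p) f = (\<Sum>y\<in>h ` set_pmf p. \<Sum>x\<in>{x\<in>set_pmf p. h x = y}. pmf p x *\<^sub>R f (h x))"
    unfolding expec_def set_map_pmf
  proof (intro sum.cong refl)
    fix y assume "y \<in> h ` set_pmf p"
    have "pmf (map_pmf h p) y = measure_pmf.prob p {x \<in> set_pmf p. h x = y}"
      unfolding pmf_map
      by (rule measure_pmf.finite_measure_eq_AE) (auto simp: AE_measure_pmf_iff)
    also have "\<dots> = (\<Sum>x\<in>{x\<in>set_pmf p. h x = y}. pmf p x)"
      using assms by (intro measure_measure_pmf_finite) auto
    finally show "pmf (map_pmf h p) y *\<^sub>R f y = (\<Sum>x\<in>{x\<in>set_pmf p. h x = y}. pmf p x *\<^sub>R f (h x))"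
      by (simp add: scaleR_sum_left)
  qed
  also have "\<dots> = expec p (\<lambda>x. f (h x))"
    using sum.image_gen[OF assms, of "\<lambda>x. pmf p x *\<^sub>R f (h x)" h] by (simp add: expec_def)
  finally show ?thesis .
qed

lemma expec_pair_pmf:
  assumes "finite (set_pmf p)" "finite (set_pmf q)"
  shows "expec (pair_pmf p q) f = expec p (\<lambda>x. expec q (\<lambda>y. f (x, y)))"
  unfolding expec_def
  by (auto simp: sum.cartesian_product scaleR_sum_right pmf_pair intro!: sum.cong)

lemma expec_swap:
  "expec p (\<lambda>x. expec q (f x)) = expec q (\<lambda>y. expec p (\<lambda>x. f x y))"
  unfolding expec_def scaleR_sum_right by (subst sum.swap) (simp add: mult.commute)

lemma expec_eq_0D:
  fixes f :: "'a \<Rightarrow> real"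
  assumes "expec p f = 0" "finite (set_pmf p)" "\<And>x. x \<in> set_pmf p \<Longrightarrow> 0 \<le> f x" "x \<in> set_pmf p"
  shows "f x = 0"
proof -
  have "pmf p x *\<^sub>R f x = 0"
    using assms(1,3,4) unfolding expec_def by (subst (asm) sum_nonneg_eq_0_iff) (auto simp: assms(2))
  then show ?thesis using assms(4) by (simp add: set_pmf_iff)
qed

subsection \<open>Product distributions\<close>

text \<open>The default \<open>d\<close> is a parameter because points will also be pairs of an
  original outcome and seeds; \<open>fst\<close> then maps the default pair to
  \<open>undefined\<close>, the default in \<open>iid_law\<close>.\<close>

definition iid :: "'i set \<Rightarrow> 'a \<Rightarrow> 'a pmf \<Rightarrow> ('i \<Rightarrow> 'a) pmf" where
  "iid A d p = Pi_pmf A d (\<lambda>_. p)"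

lemma finite_iid [simp]:
  "finite A \<Longrightarrow> finite (set_pmf p) \<Longrightarrow> finite (set_pmf (iid A d p))"
  by (simp add: iid_def set_Pi_pmf finite_PiE_dflt)

lemma set_iidD: "z \<in> set_pmf (iid A d p) \<Longrightarrow> finite A \<Longrightarrow> i \<in> A \<Longrightarrow> z i \<in> set_pmf p"
  by (auto simp: iid_def set_Pi_pmf PiE_dflt_def)

lemma expec_iid_empty [simp]: "expec (iid {} d p) F = F (\<lambda>_. d)"
  by (simp add: iid_def expec_def)

lemma expec_iid_insert:
  assumes "finite A" "i \<notin> A" "finite (set_pmf p)"
  shows "expec (iid (insert i A) d p) F = expec (iid A d p) (\<lambda>Y. expec p (\<lambda>z. F (Y(i := z))))"
proof -
  have fin: "finite (set_pmf (Pi_pmf A d (\<lambda>_. p)))"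
    using finite_iid[OF assms(1,3)] by (simp add: iid_def)
  show ?thesis
    unfolding iid_def Pi_pmf_insert[OF assms(1,2)]
    by (subst expec_map_pmf, simp add: fin assms, subst expec_pair_pmf, simp_all add: fin assms)
       (rule expec_swap)
qed

text \<open>Redrawing one coordinate does not change the product law. This exposes the coordinate
  swapped in a Lindeberg step while the others stay fixed.\<close>

lemma expec_iid_resample:
  assumes "finite A" "i \<in> A" "finite (set_pmf p)"
  shows "expec (iid A d p) F = expec (iid A d p) (\<lambda>Y. expec p (\<lambda>z. F (Y(i := z))))"
proof -
  have A: "A = insert i (A - {i})" using assms by auto
  show ?thesis
    by (subst (1 2) A, subst (1 2) expec_iid_insert) (use assms in auto)
qed

lemma expec_iid_prod:
  fixes h :: "'i \<Rightarrow> 'a \<Rightarrow> real"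
  assumes "finite A" "finite (set_pmf p)"
  shows "expec (iid A d p) (\<lambda>z. \<Prod>i\<in>A. h i (z i)) = (\<Prod>i\<in>A. expec p (h i))"
  using assms(1)
proof induction
  case (insert i A)
  have "(\<Prod>k\<in>A. h k ((Y(i := z)) k)) = (\<Prod>k\<in>A. h k (Y k))" for Y z
    using insert by (intro prod.cong) auto
  with insert show ?case
    by (simp add: expec_iid_insert assms expec_multc expec_cmult)
qed simp

text \<open>Conditioning on the coordinates in \<open>J\<close> is expressed by fixing
  \<open>X\<close> and averaging over \<open>Y\<close>.\<close>

definition glue :: "nat set \<Rightarrow> (nat \<Rightarrow> 'a) \<Rightarrow> (nat \<Rightarrow> 'a) \<Rightarrow> nat \<Rightarrow> 'a" where
  "glue J X Y = (\<lambda>i. if i \<in> J then X i else Y i)"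

lemma glue_upd: "i \<notin> J \<Longrightarrow> glue J X (Y(i := z)) = (glue J X Y)(i := z)"
  by (auto simp: glue_def)

lemma expec_iid_glue:
  assumes "finite J" "finite B" "J \<inter> B = {}" "finite (set_pmf p)"
  shows "expec (iid (J \<union> B) d p) F = expec (iid J d p) (\<lambda>X. expec (iid B d p) (\<lambda>Y. F (glue J X Y)))"
proof -
  have fin: "finite (set_pmf (Pi_pmf J d (\<lambda>_. p)))" "finite (set_pmf (Pi_pmf B d (\<lambda>_. p)))"
    using finite_iid[of _ p d] assms by (simp_all add: iid_def)
  show ?thesis
    unfolding iid_def Pi_pmf_union[OF assms(1-3)] glue_def
    by (subst expec_map_pmf, simp add: fin, subst expec_pair_pmf) (simp_all add: fin)
qed

lemma expec_iid_map:
  assumes "finite A" "finite (set_pmf p)"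
  shows "expec (iid A (h d) (map_pmf h p)) F = expec (iid A d p) (\<lambda>z. F (\<lambda>i. h (z i)))"
proof -
  have "iid A (h d) (map_pmf h p) = map_pmf (\<lambda>z. h \<circ> z) (iid A d p)"
    unfolding iid_def using assms by (intro Pi_pmf_map) auto
  then show ?thesis
    using assms by (simp add: expec_map_pmf comp_def)
qed

section \<open>Multilinear polynomials in orthonormal systems\<close>

text \<open>The last clause bounds the diagonal of the reproducing kernel. It plays the part of the
  smallest atom probability in hypercontractive estimates, and the same \<open>K\<close> can be had
  for the Fourier bases and for the functions of the seeds that replace them.\<close>

definition ortho_system :: "'z pmf \<Rightarrow> nat \<Rightarrow> real \<Rightarrow> (nat \<Rightarrow> 'z \<Rightarrow> real) \<Rightarrow> bool" where
  "ortho_system p m K \<xi> \<longleftrightarrow> 0 < m \<and> (\<forall>z\<in>set_pmf p. \<xi> 0 z = 1) \<and>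
     (\<forall>a<m. \<forall>b<m. expec p (\<lambda>z. \<xi> a z * \<xi> b z) = (if a = b then 1 else 0)) \<and>
     (\<forall>z\<in>set_pmf p. (\<Sum>a<m. (\<xi> a z)\<^sup>2) \<le> K)"

lemma ortho_system_mean:
  assumes "ortho_system p m K \<xi>" "a < m"
  shows "expec p (\<xi> a) = (if a = 0 then 1 else 0)"
proof -
  have "expec p (\<xi> a) = expec p (\<lambda>z. \<xi> a z * \<xi> 0 z)"
    using assms by (intro expec_cong) (auto simp: ortho_system_def)
  then show ?thesis using assms by (auto simp: ortho_system_def)
qed

lemma ortho_system_square:
  assumes "ortho_system p m K \<xi>"
  shows "expec p (\<lambda>z. (\<Sum>a<m. \<xi> a z * q a)\<^sup>2) = (\<Sum>a<m. (q a)\<^sup>2)"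
proof -
  have "expec p (\<lambda>z. (\<Sum>a<m. \<xi> a z * q a)\<^sup>2) =
    expec p (\<lambda>z. (\<Sum>a<m. q a * \<xi> a z) * (\<Sum>a<m. q a * \<xi> a z))"
    by (simp add: power2_eq_square mult.commute)
  also have "\<dots> = (\<Sum>a<m. \<Sum>b<m. q a * q b * (if a = b then 1 else 0))"
    unfolding expec_bilinear using assms by (intro sum.cong refl) (auto simp: ortho_system_def)
  also have "\<dots> = (\<Sum>a<m. (q a)\<^sup>2)"
    by (simp add: power2_eq_square if_distrib cong: if_cong)
  finally show ?thesis .
qed

text \<open>One-coordinate hypercontractivity. With the constant part \<open>q 0\<close> split off,
  the centred rest \<open>Y\<close> satisfies Y^2 \<le> K G pointwise by Cauchy-Schwarz, so its
  fourth moment is at most K G^2. The two conditions on \<open>C\<close> are those under which q0^4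
  + 8 q0^2 G + 3 K G^2 stays below the square of q0^2 + C G.\<close>

lemma ortho_system_fourth:
  assumes p: "finite (set_pmf p)" and o: "ortho_system p m K \<xi>"
    and C: "4 \<le> C" "3 * K \<le> C\<^sup>2"
  shows "expec p (\<lambda>z. (\<Sum>a<m. \<xi> a z * q a) ^ 4) \<le> (\<Sum>a<m. (if a = 0 then 1 else C) * (q a)\<^sup>2)\<^sup>2"
proof -
  have m: "0 < m" and x0: "\<And>z. z \<in> set_pmf p \<Longrightarrow> \<xi> 0 z = 1"
    and K: "\<And>z. z \<in> set_pmf p \<Longrightarrow> (\<Sum>a<m. (\<xi> a z)\<^sup>2) \<le> K"
    using o by (auto simp: ortho_system_def)
  have split: "{..<m} = insert 0 {1..<m}" using m by auto
  define Y where "Y z = (\<Sum>a=1..<m. \<xi> a z * q a)" for z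
  define G where "G = (\<Sum>a=1..<m. (q a)\<^sup>2)"
  have G0: "0 \<le> G" by (auto simp: G_def intro: sum_nonneg)
  have EY: "expec p Y = 0"
    unfolding Y_def expec_sum expec_multc using ortho_system_mean[OF o] by (intro sum.neutral) auto
  have EY2: "expec p (\<lambda>z. (Y z)\<^sup>2) = G"
    using ortho_system_square[OF o, of "\<lambda>a. if a = 0 then 0 else q a"]
    by (simp add: split Y_def G_def if_distrib sum.delta_remove cong: if_cong)
  have Y2: "(Y z)\<^sup>2 \<le> K * G" if "z \<in> set_pmf p" for z
  proof -
    have "(Y z)\<^sup>2 \<le> (\<Sum>a=1..<m. (\<xi> a z)\<^sup>2) * G"
      unfolding Y_def G_def by (rule Cauchy_Schwarz_ineq_sum)
    also have "(\<Sum>a=1..<m. (\<xi> a z)\<^sup>2) \<le> (\<Sum>a<m. (\<xi> a z)\<^sup>2)"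
      by (intro sum_mono2) auto
    also have "\<dots> \<le> K" using K that .
    finally show ?thesis using G0 by (simp add: mult_right_mono)
  qed
  have "expec p (\<lambda>z. (\<Sum>a<m. \<xi> a z * q a) ^ 4) = expec p (\<lambda>z. (q 0 + Y z) ^ 4)"
    by (intro expec_cong) (simp add: split Y_def x0)
  also have "\<dots> \<le> expec p (\<lambda>z. q 0 ^ 4 + 4 * q 0 ^ 3 * Y z + (8 * (q 0)\<^sup>2 + 3 * K * G) * (Y z)\<^sup>2)"
  proof (rule expec_mono)
    fix z assume z: "z \<in> set_pmf p"
    \<comment> \<open>Expanding this square bounds the odd term 4 q0 Y^3 by 2 q0^2 Y^2 + 2 Y^4,
      which raises the binomial coefficients 6 and 1 to 8 and 3.\<close>
    have "0 \<le> 2 * ((Y z)\<^sup>2 * (q 0 - Y z)\<^sup>2)" by simp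
    then have "(q 0 + Y z) ^ 4 \<le> q 0 ^ 4 + 4 * q 0 ^ 3 * Y z + 8 * (q 0)\<^sup>2 * (Y z)\<^sup>2 + 3 * (Y z)\<^sup>2 * (Y z)\<^sup>2"
      by (simp add: power2_eq_square power4_eq_xxxx power3_eq_cube algebra_simps)
    also have "3 * (Y z)\<^sup>2 * (Y z)\<^sup>2 \<le> 3 * (K * G) * (Y z)\<^sup>2"
      using Y2[OF z] by (intro mult_right_mono) auto
    finally show "(q 0 + Y z) ^ 4 \<le> q 0 ^ 4 + 4 * q 0 ^ 3 * Y z + (8 * (q 0)\<^sup>2 + 3 * K * G) * (Y z)\<^sup>2"
      by (simp add: algebra_simps)
  qed
  also have "\<dots> = q 0 ^ 4 + (8 * (q 0)\<^sup>2 + 3 * K * G) * G"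
    by (simp add: expec_add expec_cmult EY EY2 p)
  also have "\<dots> = ((q 0)\<^sup>2)\<^sup>2 + 8 * ((q 0)\<^sup>2 * G) + 3 * K * G\<^sup>2"
    by (simp add: power2_eq_square power4_eq_xxxx algebra_simps)
  also have "\<dots> \<le> ((q 0)\<^sup>2)\<^sup>2 + (2 * C) * ((q 0)\<^sup>2 * G) + C\<^sup>2 * G\<^sup>2"
    using C G0 by (intro add_mono mult_right_mono) auto
  also have "\<dots> = ((q 0)\<^sup>2 + C * G)\<^sup>2"
    by (simp add: power2_eq_square algebra_simps)
  also have "(q 0)\<^sup>2 + C * G = (\<Sum>a<m. (if a = 0 then 1 else C) * (q a)\<^sup>2)"
    by (simp add: split G_def sum_distrib_left)
  finally show ?thesis .
qed

section \<open>Multilinear polynomials: Parseval, hypercontractivity and conditioning\<close>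

lemma power2_power2: "((x::real)\<^sup>2)\<^sup>2 = x ^ 4"
  by (simp add: power4_eq_xxxx power2_eq_square)

text \<open>The system may vary with the coordinate \<open>i\<close>, so that a polynomial with some
  coordinates already replaced is again of this form.\<close>

definition mpoly :: "nat set \<Rightarrow> nat \<Rightarrow> ((nat \<Rightarrow> nat) \<Rightarrow> real) \<Rightarrow> (nat \<Rightarrow> nat \<Rightarrow> 'z \<Rightarrow> real) \<Rightarrow> (nat \<Rightarrow> 'z) \<Rightarrow> real" where
  "mpoly A m c \<xi> z = (\<Sum>\<sigma>\<in>A \<rightarrow>\<^sub>E {..<m}. c \<sigma> * (\<Prod>i\<in>A. \<xi> i (\<sigma> i) (z i)))"

definition wt :: "nat set \<Rightarrow> (nat \<Rightarrow> nat) \<Rightarrow> nat" where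
  "wt A \<sigma> = card {i\<in>A. \<sigma> i \<noteq> 0}"

lemma sum_PiE_insert:
  assumes "i \<notin> A"
  shows "(\<Sum>\<sigma>\<in>insert i A \<rightarrow>\<^sub>E S. F \<sigma>) = (\<Sum>a\<in>S. \<Sum>\<sigma>\<in>A \<rightarrow>\<^sub>E S. F (\<sigma>(i := a)))"
proof -
  have "(\<Sum>\<sigma>\<in>insert i A \<rightarrow>\<^sub>E S. F \<sigma>) = (\<Sum>x\<in>S \<times> (A \<rightarrow>\<^sub>E S). F ((\<lambda>(y, g). g(i := y)) x))"
    unfolding PiE_insert_eq
    by (subst sum.reindex) (use inj_combinator[OF assms, of "\<lambda>_. S"] in \<open>auto simp: comp_def\<close>)
  also have "\<dots> = (\<Sum>a\<in>S. \<Sum>\<sigma>\<in>A \<rightarrow>\<^sub>E S. F (\<sigma>(i := a)))"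
    by (simp add: sum.cartesian_product split_beta)
  finally show ?thesis .
qed

lemma wt_insert:
  assumes "finite A" "i \<notin> A"
  shows "wt (insert i A) (\<sigma>(i := a)) = wt A \<sigma> + (if a = 0 then 0 else 1)"
proof -
  have "{k\<in>insert i A. (\<sigma>(i := a)) k \<noteq> 0} = (if a = 0 then {} else {i}) \<union> {k\<in>A. \<sigma> k \<noteq> 0}"
    using assms by auto
  then show ?thesis using assms by (auto simp: wt_def)
qed

lemma mpoly_empty [simp]: "mpoly {} m c \<xi> z = c (\<lambda>_. undefined)"
  by (simp add: mpoly_def)

lemma mpoly_insert:
  assumes "finite A" "i \<notin> A"
  shows "mpoly (insert i A) m c \<xi> z = (\<Sum>a<m. \<xi> i a (z i) * mpoly A m (\<lambda>\<sigma>. c (\<sigma>(i := a))) \<xi> z)"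
proof -
  have "(\<Prod>k\<in>A. \<xi> k ((\<sigma>(i := a)) k) (z k)) = (\<Prod>k\<in>A. \<xi> k (\<sigma> k) (z k))" for \<sigma> a
    using assms by (intro prod.cong) auto
  then show ?thesis
    using assms by (simp add: mpoly_def sum_PiE_insert sum_distrib_left mult_ac)
qed

lemma mpoly_cong:
  assumes "\<And>i. i \<in> A \<Longrightarrow> z i = z' i"
    and "\<And>i a. i \<in> A \<Longrightarrow> a < m \<Longrightarrow> \<xi> i a (z i) = \<xi>' i a (z' i)"
    and "\<And>\<sigma>. \<sigma> \<in> A \<rightarrow>\<^sub>E {..<m} \<Longrightarrow> c \<sigma> = c' \<sigma>"
  shows "mpoly A m c \<xi> z = mpoly A m c' \<xi>' z'"
  unfolding mpoly_def using assms(2,3)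
  by (intro sum.cong prod.cong arg_cong2[of _ _ _ _ "(*)"] refl) (auto simp: PiE_iff)

lemma mpoly_upd: "i \<notin> A \<Longrightarrow> mpoly A m c \<xi> (z(i := y)) = mpoly A m c \<xi> z"
  unfolding mpoly_def by (intro sum.cong prod.cong arg_cong2[of _ _ _ _ "(*)"] refl) auto

lemma mpoly_diff: "mpoly A m c \<xi> z - mpoly A m c' \<xi> z = mpoly A m (\<lambda>\<sigma>. c \<sigma> - c' \<sigma>) \<xi> z"
  by (simp add: mpoly_def sum_subtractf algebra_simps)

lemma mpoly_parseval:
  assumes "finite A" and p: "finite (set_pmf p)" and o: "\<And>i. i \<in> A \<Longrightarrow> ortho_system p m K (\<xi> i)"
  shows "expec (iid A d p) (\<lambda>z. (mpoly A m c \<xi> z)\<^sup>2) = (\<Sum>\<sigma>\<in>A \<rightarrow>\<^sub>E {..<m}. (c \<sigma>)\<^sup>2)"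
  using assms(1) o
proof (induction A arbitrary: c)
  case (insert i A)
  have "expec (iid (insert i A) d p) (\<lambda>z. (mpoly (insert i A) m c \<xi> z)\<^sup>2) =
    expec (iid A d p) (\<lambda>Y. expec p (\<lambda>z. (\<Sum>a<m. \<xi> i a z * mpoly A m (\<lambda>\<sigma>. c (\<sigma>(i := a))) \<xi> Y)\<^sup>2))"
    using insert.hyps by (simp add: expec_iid_insert p mpoly_insert mpoly_upd)
  also have "\<dots> = (\<Sum>a<m. expec (iid A d p) (\<lambda>Y. (mpoly A m (\<lambda>\<sigma>. c (\<sigma>(i := a))) \<xi> Y)\<^sup>2))"
    by (simp add: ortho_system_square[OF insert.prems[OF insertI1]] expec_sum)
  also have "\<dots> = (\<Sum>\<sigma>\<in>insert i A \<rightarrow>\<^sub>E {..<m}. (c \<sigma>)\<^sup>2)"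
    using insert by (simp add: sum_PiE_insert)
  finally show ?case .
qed (simp add: PiE_empty_domain)

text \<open>Induction over the coordinates: \<open>ortho_system_fourth\<close> handles the new
  coordinate with the others fixed, and Cauchy-Schwarz splits the mixed moments of
  \<open>Q a\<close> and \<open>Q b\<close>, so that the double sum closes up to a perfect square.
  Every active coordinate costs one factor \<open>C\<close>.\<close>

lemma mpoly_hypercontractive:
  assumes "finite A" and p: "finite (set_pmf p)" and o: "\<And>i. i \<in> A \<Longrightarrow> ortho_system p m K (\<xi> i)"
    and C: "4 \<le> C" "3 * K \<le> C\<^sup>2"
  shows "expec (iid A d p) (\<lambda>z. mpoly A m c \<xi> z ^ 4) \<le> (\<Sum>\<sigma>\<in>A \<rightarrow>\<^sub>E {..<m}. C ^ wt A \<sigma> * (c \<sigma>)\<^sup>2)\<^sup>2"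
  using assms(1) o
proof (induction A arbitrary: c)
  case empty
  then show ?case by (simp add: wt_def PiE_empty_domain power2_power2)
next
  case (insert i A)
  define Ca where "Ca a = (if a = 0 then 1 else C)" for a :: nat
  have Ca0: "0 \<le> Ca a" for a using C by (simp add: Ca_def)
  define Q where "Q a = mpoly A m (\<lambda>\<sigma>. c (\<sigma>(i := a))) \<xi>" for a
  define S where "S a = (\<Sum>\<sigma>\<in>A \<rightarrow>\<^sub>E {..<m}. C ^ wt A \<sigma> * (c (\<sigma>(i := a)))\<^sup>2)" for a
  have S0: "0 \<le> S a" for a using C by (auto simp: S_def intro!: sum_nonneg)
  have IH: "expec (iid A d p) (\<lambda>Y. Q a Y ^ 4) \<le> (S a)\<^sup>2" for a
    unfolding Q_def S_def using insert by blast
  have mixed: "expec (iid A d p) (\<lambda>Y. (Q a Y)\<^sup>2 * (Q b Y)\<^sup>2) \<le> S a * S b" for a b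
  proof -
    have "(expec (iid A d p) (\<lambda>Y. (Q a Y)\<^sup>2 * (Q b Y)\<^sup>2))\<^sup>2 \<le>
        expec (iid A d p) (\<lambda>Y. Q a Y ^ 4) * expec (iid A d p) (\<lambda>Y. Q b Y ^ 4)"
      using expec_cauchy_schwarz[of "iid A d p" "\<lambda>Y. (Q a Y)\<^sup>2" "\<lambda>Y. (Q b Y)\<^sup>2"] by (simp only: power2_power2)
    also have "\<dots> \<le> (S a)\<^sup>2 * (S b)\<^sup>2"
      by (intro mult_mono IH) (auto intro: expec_nonneg)
    finally have "(expec (iid A d p) (\<lambda>Y. (Q a Y)\<^sup>2 * (Q b Y)\<^sup>2))\<^sup>2 \<le> (S a * S b)\<^sup>2"
      by (simp only: power_mult_distrib)
    then show ?thesis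
      using S0 by (auto intro: power2_le_imp_le[OF _ mult_nonneg_nonneg])
  qed
  have "expec (iid (insert i A) d p) (\<lambda>z. mpoly (insert i A) m c \<xi> z ^ 4) =
    expec (iid A d p) (\<lambda>Y. expec p (\<lambda>z. (\<Sum>a<m. \<xi> i a z * Q a Y) ^ 4))"
    using insert.hyps by (simp add: expec_iid_insert p mpoly_insert mpoly_upd Q_def)
  also have "\<dots> \<le> expec (iid A d p) (\<lambda>Y. (\<Sum>a<m. Ca a * (Q a Y)\<^sup>2)\<^sup>2)"
    unfolding Ca_def using insert.prems by (intro expec_mono ortho_system_fourth[OF p _ C]) auto
  also have "\<dots> = (\<Sum>a<m. \<Sum>b<m. Ca a * Ca b * expec (iid A d p) (\<lambda>Y. (Q a Y)\<^sup>2 * (Q b Y)\<^sup>2))"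
    by (simp add: power2_eq_square[of "sum _ _"] expec_bilinear)
  also have "\<dots> \<le> (\<Sum>a<m. \<Sum>b<m. Ca a * Ca b * (S a * S b))"
    by (intro sum_mono mult_left_mono mixed) (simp add: Ca0)
  also have "\<dots> = (\<Sum>a<m. Ca a * S a)\<^sup>2"
    by (simp add: power2_eq_square sum_product mult_ac)
  also have "(\<Sum>a<m. Ca a * S a) = (\<Sum>\<sigma>\<in>insert i A \<rightarrow>\<^sub>E {..<m}. C ^ wt (insert i A) \<sigma> * (c \<sigma>)\<^sup>2)"
    unfolding sum_PiE_insert[OF insert.hyps(2)] wt_insert[OF insert.hyps] S_def sum_distrib_left
    by (intro sum.cong refl) (simp add: Ca_def)
  finally show ?case .
qed

text \<open>A nonconstant basis function has mean 0, so averaging over \<open>B\<close> deletes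
  every monomial that is active there. The surviving indices are those extended by 0 on
  \<open>B\<close>.\<close>

lemma mpoly_average:
  assumes "finite B" "finite J" "J \<inter> B = {}" and p: "finite (set_pmf p)"
    and o: "\<And>i. i \<in> B \<Longrightarrow> ortho_system p m K (\<xi> i)"
  shows "expec (iid B d p) (\<lambda>Y. mpoly (J \<union> B) m c \<xi> (glue J X Y)) =
    mpoly J m (\<lambda>\<sigma>. c (\<lambda>i. if i \<in> B then 0 else \<sigma> i)) \<xi> X"
  using assms(1,3) o
proof (induction B arbitrary: c)
  case empty
  show ?case by (auto simp: glue_def intro!: mpoly_cong)
next
  case (insert i B)
  have i: "i \<notin> J \<union> B" using insert by auto
  have o: "ortho_system p m K (\<xi> i)" using insert by auto
  then have m: "0 < m" by (simp add: ortho_system_def)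
  have "expec (iid (insert i B) d p) (\<lambda>Y. mpoly (J \<union> insert i B) m c \<xi> (glue J X Y)) =
    expec (iid B d p) (\<lambda>Y. \<Sum>a<m. expec p (\<xi> i a) * mpoly (J \<union> B) m (\<lambda>\<sigma>. c (\<sigma>(i := a))) \<xi> (glue J X Y))"
    using insert.hyps i assms(2)
    by (simp add: expec_iid_insert p mpoly_insert mpoly_upd glue_upd expec_sum expec_multc)
  also have "\<dots> = expec (iid B d p) (\<lambda>Y. mpoly (J \<union> B) m (\<lambda>\<sigma>. c (\<sigma>(i := 0))) \<xi> (glue J X Y))"
  proof (rule expec_cong)
    fix Y
    have "(\<Sum>a<m. expec p (\<xi> i a) * mpoly (J \<union> B) m (\<lambda>\<sigma>. c (\<sigma>(i := a))) \<xi> (glue J X Y)) =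
      (\<Sum>a<m. if a = 0 then mpoly (J \<union> B) m (\<lambda>\<sigma>. c (\<sigma>(i := a))) \<xi> (glue J X Y) else 0)"
      using ortho_system_mean[OF o] by (intro sum.cong) auto
    then show "(\<Sum>a<m. expec p (\<xi> i a) * mpoly (J \<union> B) m (\<lambda>\<sigma>. c (\<sigma>(i := a))) \<xi> (glue J X Y)) =
      mpoly (J \<union> B) m (\<lambda>\<sigma>. c (\<sigma>(i := 0))) \<xi> (glue J X Y)"
      using m by simp
  qed
  also have "\<dots> = mpoly J m (\<lambda>\<sigma>. c ((\<lambda>k. if k \<in> B then 0 else \<sigma> k)(i := 0))) \<xi> X"
    using insert by (subst insert.IH) auto
  also have "(\<lambda>\<sigma>. c ((\<lambda>k. if k \<in> B then 0 else \<sigma> k)(i := 0))) = (\<lambda>\<sigma>. c (\<lambda>k. if k \<in> insert i B then 0 else \<sigma> k))"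
    by (intro ext arg_cong[of _ _ c]) auto
  finally show ?case .
qed

section \<open>A reverse Hoelder inequality for partially shared randomness\<close>

text \<open>Bernoulli's inequality for the exponent \<open>h\<close> is used twice, once multiplied
  by \<open>u ^ h\<close>; this is why the exponent is even. The right-hand side is the excess of
  the power over its tangent at 1.\<close>

lemma power_excess_lower:
  fixes u :: real
  assumes "0 \<le> u"
  shows "h * (u - 1) * (u ^ h - 1) \<le> u ^ (2 * h) - 1 - 2 * real h * (u - 1)"
proof -
  have b: "real h * (u - 1) \<le> u ^ h - 1"
    using Bernoulli_inequality[of "u - 1" h] assms by simp
  then have "u ^ h * (real h * (u - 1)) \<le> u ^ h * (u ^ h - 1)"
    using assms by (intro mult_left_mono) auto
  then have "h * (u - 1) * u ^ h - u ^ h * u ^ h \<le> - (u ^ h)"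
    by (simp add: algebra_simps)
  moreover have "u ^ (2 * h) = u ^ h * u ^ h" by (simp add: mult_2 power_add)
  ultimately show ?thesis
    using b by (simp add: algebra_simps)
qed

text \<open>The error of the logarithm against its tangent at 1 is quadratic and has to be absorbed
  by a \<kappa>-fraction of the excess. Above 1 this is Bernoulli. Below 1, with y = 1 - u, only 1 -
  u^h \<ge> h y / (1 + h y) is available, which is why \<open>u\<close> has to stay within
  \<open>\<kappa> / 8\<close> of 1.\<close>

lemma quadratic_le_power_excess:
  fixes u \<kappa> :: real
  assumes \<kappa>: "0 < \<kappa>" "\<kappa> \<le> 1" and u: "1 - \<kappa> / 8 \<le> u" and h: "8 / \<kappa> \<le> real h"
  shows "4 * real h * (u - 1)\<^sup>2 \<le> \<kappa> * (u ^ (2 * h) - 1 - 2 * real h * (u - 1))"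
proof -
  have u0: "0 \<le> u" using u \<kappa> by linarith
  have h8: "8 \<le> \<kappa> * h" using h \<kappa> by (simp add: field_simps)
  have key: "4 * (u - 1)\<^sup>2 \<le> \<kappa> * ((u - 1) * (u ^ h - 1))"
  proof (cases "1 \<le> u")
    case True
    have "real h * (u - 1) \<le> u ^ h - 1"
      using Bernoulli_inequality[of "u - 1" h] u0 by simp
    then have "(u - 1) * (real h * (u - 1)) \<le> (u - 1) * (u ^ h - 1)"
      using True by (intro mult_left_mono) auto
    then have "\<kappa> * ((u - 1) * (real h * (u - 1))) \<le> \<kappa> * ((u - 1) * (u ^ h - 1))"
      using \<kappa>(1) by (rule mult_left_mono[OF _ less_imp_le])
    moreover have "8 * (u - 1)\<^sup>2 \<le> (\<kappa> * h) * (u - 1)\<^sup>2"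
      using h8 by (intro mult_right_mono) auto
    moreover have "\<kappa> * ((u - 1) * (real h * (u - 1))) = (\<kappa> * h) * (u - 1)\<^sup>2"
      by (simp add: power2_eq_square mult_ac)
    moreover have "0 \<le> (u - 1)\<^sup>2" by simp
    ultimately show ?thesis by linarith
  next
    case False
    define y where "y = 1 - u"
    have y: "0 < y" "y \<le> \<kappa> / 8" "y \<le> 1" "u = 1 - y" using False u \<kappa> by (auto simp: y_def)
    \<comment> \<open>Bernoulli is applied to 1 + y instead of u: since (1 + y) (1 - y) \<le> 1,
      this gives an upper bound for \<open>u ^ h\<close>.\<close>
    have "(1 + h * y) * u ^ h \<le> (1 + y) ^ h * u ^ h"
      using Bernoulli_inequality[of y h] y u0 by (intro mult_right_mono) auto
    also have "\<dots> = (1 - y\<^sup>2) ^ h"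
      by (simp add: y(4) power2_eq_square algebra_simps flip: power_mult_distrib)
    also have "\<dots> \<le> 1"
      using y by (intro power_le_one) (auto simp: power_le_one)
    finally have *: "h * y \<le> (1 + h * y) * (1 - u ^ h)" by (simp add: algebra_simps)
    have "4 * (1 + h * y) \<le> \<kappa> * h"
    proof -
      have "8 * (h * y) \<le> \<kappa> * h" using y(2) mult_left_mono[of y "\<kappa> / 8" "real h"] by (simp add: field_simps)
      with h8 show ?thesis by simp
    qed
    then have "y * (4 * (1 + h * y)) \<le> y * (\<kappa> * h)"
      using y by (intro mult_left_mono) auto
    also have "\<dots> = \<kappa> * (h * y)" by simp
    also have "\<dots> \<le> \<kappa> * ((1 + h * y) * (1 - u ^ h))"
      using * \<kappa> by (intro mult_left_mono) auto
    finally have "(1 + h * y) * (4 * y) \<le> (1 + h * y) * (\<kappa> * (1 - u ^ h))"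
      by (simp add: mult_ac)
    moreover have "0 < 1 + h * y" using y by (simp add: add_pos_nonneg)
    ultimately have "4 * y \<le> \<kappa> * (1 - u ^ h)" by (simp only: mult_le_cancel_left_pos)
    then have "y * (4 * y) \<le> y * (\<kappa> * (1 - u ^ h))"
      using y by (intro mult_left_mono) auto
    then show ?thesis by (simp add: y(4) power2_eq_square algebra_simps)
  qed
  have "4 * real h * (u - 1)\<^sup>2 \<le> \<kappa> * (h * (u - 1) * (u ^ h - 1))"
    using mult_left_mono[OF key, of "real h"] by (simp add: mult_ac)
  also have "\<dots> \<le> \<kappa> * (u ^ (2 * h) - 1 - 2 * real h * (u - 1))"
    using power_excess_lower[OF u0, of h] \<kappa> by (intro mult_left_mono) auto
  finally show ?thesis .
qed

text \<open>With x = h (u - 1) the excess is at least x^2 above 1, and 2 x - \<kappa> x^2 \<le>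
  1/\<kappa> by completing the square; below 1 the left-hand side is nonpositive. The bound is
  uniform in \<open>h\<close>, which is what lets a single small factor outweigh all others once
  \<open>h\<close> is large.\<close>

lemma linear_minus_power_excess_le:
  fixes u \<kappa> :: real
  assumes \<kappa>: "0 < \<kappa>" and u: "0 \<le> u"
  shows "2 * real h * (u - 1) - \<kappa> * (u ^ (2 * h) - 1 - 2 * real h * (u - 1)) \<le> 1 / \<kappa>"
proof -
  have b: "real h * (u - 1) \<le> u ^ h - 1"
    using Bernoulli_inequality[of "u - 1" h] u by simp
  have ex: "0 \<le> u ^ (2 * h) - 1 - 2 * real h * (u - 1)"
    using Bernoulli_inequality[of "u - 1" "2 * h"] u by simp
  show ?thesis
  proof (cases "1 \<le> u")
    case True
    define x where "x = real h * (u - 1)"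
    have x0: "0 \<le> x" using True by (simp add: x_def)
    have "x * x \<le> x * (u ^ h - 1)"
      using b x0 by (intro mult_left_mono) (auto simp: x_def)
    also have "\<dots> \<le> u ^ (2 * h) - 1 - 2 * real h * (u - 1)"
      using power_excess_lower[OF u, of h] by (simp add: x_def)
    finally have "\<kappa> * (x * x) \<le> \<kappa> * (u ^ (2 * h) - 1 - 2 * real h * (u - 1))"
      using \<kappa> by (intro mult_left_mono) auto
    moreover have "2 * x \<le> \<kappa> * (x * x) + 1 / \<kappa>"
    proof -
      have "0 \<le> (\<kappa> * x - 1)\<^sup>2 / \<kappa>" using \<kappa> by simp
      also have "\<dots> = \<kappa> * (x * x) + 1 / \<kappa> - 2 * x"
        using \<kappa> by (simp add: power2_eq_square field_simps)
      finally show ?thesis by simp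
    qed
    ultimately show ?thesis by (simp add: x_def)
  next
    case False
    then have "2 * real h * (u - 1) \<le> 0" by (simp add: mult_nonneg_nonpos)
    moreover have "0 \<le> \<kappa> * (u ^ (2 * h) - 1 - 2 * real h * (u - 1))" using ex \<kappa> by simp
    moreover have "0 < 1 / \<kappa>" using \<kappa> by simp
    ultimately show ?thesis by linarith
  qed
qed

text \<open>
  If all \<open>u j\<close> are close to 1 or larger, \<open>exp x \<ge> 1 + x\<close> reduces the claim to a single variable. If some
  \<open>u j\<close> is far below 1, the left-hand side is already negative.
\<close>

lemma prod_power_lower_bound:
  fixes u :: "'l::finite \<Rightarrow> real" and \<kappa> :: real
  assumes \<kappa>: "0 < \<kappa>" "\<kappa> \<le> 1" and u: "\<And>j. 0 \<le> u j"
    and h: "4 / \<kappa> * (2 + real CARD('l) / \<kappa>) \<le> real h"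
  shows "1 + (\<Sum>j\<in>UNIV. 2 * real h * (u j - 1)) - \<kappa> * (\<Sum>j\<in>UNIV. u j ^ (2 * h) - 1 - 2 * real h * (u j - 1))
    \<le> (\<Prod>j\<in>UNIV. u j ^ (2 * h))"
proof (cases "\<forall>j. 1 - \<kappa> / 8 \<le> u j")
  case True
  have h8: "8 / \<kappa> \<le> real h"
  proof -
    have "8 / \<kappa> \<le> 4 / \<kappa> * (2 + real CARD('l) / \<kappa>)" using \<kappa> by (simp add: field_simps)
    with h show ?thesis by linarith
  qed
  have pos: "0 < u j" "1 / 2 \<le> u j" for j
    using True[rule_format, of j] \<kappa> by linarith+
  have single: "2 * real h * (u j - 1) - \<kappa> * (u j ^ (2 * h) - 1 - 2 * real h * (u j - 1)) \<le> 2 * real h * ln (u j)" for j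
  proof -
    have "ln (1 / u j) \<le> 1 / u j - 1"
      using pos by (intro ln_le_minus_one) auto
    then have "1 - 1 / u j \<le> ln (u j)"
      using pos[of j] by (simp add: ln_div)
    moreover have "(u j - 1) - (1 - 1 / u j) \<le> 2 * (u j - 1)\<^sup>2"
    proof -
      have "(u j - 1) - (1 - 1 / u j) = (1 / u j) * (u j - 1)\<^sup>2"
        using pos[of j] by (simp add: field_simps power2_eq_square)
      also have "\<dots> \<le> 2 * (u j - 1)\<^sup>2"
        using pos[of j] by (intro mult_right_mono) (auto simp: field_simps)
      finally show ?thesis .
    qed
    ultimately have "(u j - 1) - ln (u j) \<le> 2 * (u j - 1)\<^sup>2" by linarith
    then have "2 * real h * ((u j - 1) - ln (u j)) \<le> 2 * real h * (2 * (u j - 1)\<^sup>2)"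
      by (intro mult_left_mono) auto
    also have "\<dots> \<le> \<kappa> * (u j ^ (2 * h) - 1 - 2 * real h * (u j - 1))"
      using quadratic_le_power_excess[OF \<kappa> _ h8, of "u j"] True by simp
    finally show ?thesis by (simp add: algebra_simps)
  qed
  have "1 + (\<Sum>j\<in>UNIV. 2 * real h * (u j - 1)) - \<kappa> * (\<Sum>j\<in>UNIV. u j ^ (2 * h) - 1 - 2 * real h * (u j - 1))
    \<le> 1 + (\<Sum>j\<in>UNIV. 2 * real h * ln (u j))"
  proof -
    have "(\<Sum>j\<in>UNIV. 2 * real h * (u j - 1) - \<kappa> * (u j ^ (2 * h) - 1 - 2 * real h * (u j - 1))) \<le>
      (\<Sum>j\<in>UNIV. 2 * real h * ln (u j))"
      by (intro sum_mono single)
    then show ?thesis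
      by (simp only: sum_subtractf[of "\<lambda>j. 2 * real h * (u j - 1)"] sum_distrib_left[symmetric, of \<kappa>])
  qed
  also have "\<dots> \<le> exp (\<Sum>j\<in>UNIV. 2 * real h * ln (u j))"
    by (rule exp_ge_add_one_self)
  also have "\<dots> = (\<Prod>j\<in>UNIV. u j ^ (2 * h))"
  proof -
    have "exp (2 * real h * ln (u j)) = u j ^ (2 * h)" for j
      using exp_of_nat_mult[of "2 * h" "ln (u j)"] pos(1)[of j] by simp
    then show ?thesis by (simp add: exp_sum)
  qed
  finally show ?thesis .
next
  case False
  then obtain k where k: "u k < 1 - \<kappa> / 8" by (auto simp: not_le)
  define T where "T j = 2 * real h * (u j - 1) - \<kappa> * (u j ^ (2 * h) - 1 - 2 * real h * (u j - 1))" for j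
  have ex: "0 \<le> \<kappa> * (u k ^ (2 * h) - 1 - 2 * real h * (u k - 1))"
    using Bernoulli_inequality[of "u k - 1" "2 * h"] u[of k] \<kappa> by simp
  have "(\<Sum>j\<in>UNIV. T j) = T k + (\<Sum>j\<in>UNIV - {k}. T j)"
    by (simp add: sum.remove[of UNIV k])
  also have "(\<Sum>j\<in>UNIV - {k}. T j) \<le> (\<Sum>j\<in>UNIV - {k}. 1 / \<kappa>)"
    unfolding T_def by (intro sum_mono linear_minus_power_excess_le \<kappa> u)
  also have "\<dots> \<le> (\<Sum>j\<in>(UNIV :: 'l set). 1 / \<kappa>)"
    using \<kappa> by (intro sum_mono2) auto
  also have "T k \<le> 2 * real h * (- \<kappa> / 8)"
  proof -
    have "2 * real h * (u k - 1) \<le> 2 * real h * (- \<kappa> / 8)"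
      using k by (intro mult_left_mono) auto
    then show ?thesis using ex by (simp add: T_def)
  qed
  \<comment> \<open>The threshold for \<open>h\<close> is made for this: the loss
    \<open>h * \<kappa> / 4\<close> of the small factor outweighs the leading 1 and the gains of at
    most 1/\<kappa> of the other factors.\<close>
  also have "2 * real h * (- \<kappa> / 8) \<le> - (2 + real CARD('l) / \<kappa>)"
  proof -
    have "\<kappa> / 4 * (4 / \<kappa> * (2 + real CARD('l) / \<kappa>)) = 2 + real CARD('l) / \<kappa>"
      using \<kappa> by simp
    then show ?thesis using mult_left_mono[OF h, of "\<kappa> / 4"] \<kappa> by simp
  qed
  finally have "1 + (\<Sum>j\<in>UNIV. T j) \<le> 0" by simp
  also have "0 \<le> (\<Prod>j\<in>UNIV. u j ^ (2 * h))" using u by (intro prod_nonneg) auto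
  finally have "1 + (\<Sum>j\<in>UNIV. T j) \<le> (\<Prod>j\<in>UNIV. u j ^ (2 * h))" .
  then show ?thesis
    unfolding T_def sum_subtractf[of "\<lambda>j. 2 * real h * (u j - 1)"] sum_distrib_left[symmetric, of \<kappa>]
    by linarith
qed

lemma prod_ge_one_plus_sum:
  fixes a :: "'i \<Rightarrow> real"
  assumes "finite I" "\<And>i. i \<in> I \<Longrightarrow> 1 \<le> a i"
  shows "1 + (\<Sum>i\<in>I. a i - 1) \<le> (\<Prod>i\<in>I. a i)"
  using assms
proof (induction I)
  case (insert i I)
  then have IH: "1 + (\<Sum>i\<in>I. a i - 1) \<le> (\<Prod>i\<in>I. a i)" by simp
  have "0 \<le> (\<Sum>i\<in>I. a i - 1)" using insert by (intro sum_nonneg) auto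
  then have "0 \<le> (a i - 1) * (\<Sum>i\<in>I. a i - 1)" using insert by (intro mult_nonneg_nonneg) auto
  moreover have "a i * (1 + (\<Sum>i\<in>I. a i - 1)) \<le> a i * (\<Prod>i\<in>I. a i)"
    using IH insert.prems[of i] by (intro mult_left_mono) auto
  ultimately show ?case using insert by (simp add: algebra_simps)
qed simp

text \<open>After every mean is normalised to 1, let a_j \<ge> 1 be the mean of the power. Shared
  seeds lose at most \<epsilon> \<Sum>(a_j - 1), by \<open>prod_power_lower_bound\<close> with
  \<kappa> = \<epsilon>, while independent seeds gain at least \<Sum>(a_j - 1). With weights 1 -
  \<epsilon> and \<epsilon> the balance is at least \<epsilon>^2 \<Sum>(a_j - 1) \<ge> 0.\<close>

lemma reverse_hoelder_mixture:
  fixes u :: "'l::finite \<Rightarrow> 'r \<Rightarrow> real" and \<epsilon> :: real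
  assumes p: "finite (set_pmf \<nu>)" and \<epsilon>: "0 < \<epsilon>" "\<epsilon> \<le> 1" and u: "\<And>j r. 0 \<le> u j r"
    and h: "4 / \<epsilon> * (2 + real CARD('l) / \<epsilon>) \<le> real h"
  shows "(\<Prod>j\<in>UNIV. expec \<nu> (u j) ^ (2 * h)) \<le>
    (1 - \<epsilon>) * expec \<nu> (\<lambda>r. \<Prod>j\<in>UNIV. u j r ^ (2 * h)) + \<epsilon> * (\<Prod>j\<in>UNIV. expec \<nu> (\<lambda>r. u j r ^ (2 * h)))"
proof (cases "\<exists>j. expec \<nu> (u j) = 0")
  case True
  then obtain j where j: "expec \<nu> (u j) = 0" by blast
  have "0 < 4 / \<epsilon> * (2 + real CARD('l) / \<epsilon>)" using \<epsilon> by (intro mult_pos_pos) (auto intro: add_pos_nonneg)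
  then have "0 < h" using h by linarith
  then have "(\<Prod>j\<in>UNIV. expec \<nu> (u j) ^ (2 * h)) = 0"
    using j by (intro prod_zero) auto
  moreover have "0 \<le> (1 - \<epsilon>) * expec \<nu> (\<lambda>r. \<Prod>j\<in>UNIV. u j r ^ (2 * h)) + \<epsilon> * (\<Prod>j\<in>UNIV. expec \<nu> (\<lambda>r. u j r ^ (2 * h)))"
    using u \<epsilon> by (intro add_nonneg_nonneg mult_nonneg_nonneg expec_nonneg prod_nonneg) auto
  ultimately show ?thesis by (simp only:)
next
  case False
  define e where "e j = expec \<nu> (u j)" for j
  have e: "0 < e j" for j
    using False expec_nonneg[of \<nu> "u j"] u by (force simp: e_def order.order_iff_strict)
  define v where "v j r = u j r / e j" for j r
  have v0: "0 \<le> v j r" for j r using u e[of j] by (simp add: v_def)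
  have Ev: "expec \<nu> (v j) = 1" for j
    unfolding v_def expec_divide using e[of j] by (simp add: e_def)
  define a where "a j = expec \<nu> (\<lambda>r. v j r ^ (2 * h))" for j
  have a1: "1 \<le> a j" for j
  proof -
    have "expec \<nu> (\<lambda>r. 1 + 2 * real h * (v j r - 1)) \<le> a j"
      unfolding a_def
    proof (rule expec_mono)
      fix r
      show "1 + 2 * real h * (v j r - 1) \<le> v j r ^ (2 * h)"
        using Bernoulli_inequality[of "v j r - 1" "2 * h"] v0[of j r] by simp
    qed
    then show ?thesis
      by (simp add: expec_add expec_cmult expec_diff Ev p)
  qed
  have mean: "expec \<nu> (\<lambda>r. c * (v j r - 1)) = 0" for c j
    by (simp add: expec_cmult expec_diff Ev p)
  have "1 - \<epsilon> * (\<Sum>j\<in>UNIV. a j - 1) =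
    expec \<nu> (\<lambda>r. 1 + (\<Sum>j\<in>UNIV. 2 * real h * (v j r - 1)) - \<epsilon> * (\<Sum>j\<in>UNIV. v j r ^ (2 * h) - 1 - 2 * real h * (v j r - 1)))"
    by (simp only: expec_add expec_diff expec_cmult[of _ \<epsilon>] expec_sum mean a_def expec_const[OF p]) simp
  also have "\<dots> \<le> expec \<nu> (\<lambda>r. \<Prod>j\<in>UNIV. v j r ^ (2 * h))"
    by (intro expec_mono prod_power_lower_bound \<epsilon> h v0)
  finally have 1: "1 - \<epsilon> * (\<Sum>j\<in>UNIV. a j - 1) \<le> expec \<nu> (\<lambda>r. \<Prod>j\<in>UNIV. v j r ^ (2 * h))" .
  have 2: "1 + (\<Sum>j\<in>UNIV. a j - 1) \<le> (\<Prod>j\<in>UNIV. a j)"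
    using a1 by (intro prod_ge_one_plus_sum) auto
  have s0: "0 \<le> (\<Sum>j\<in>UNIV. a j - 1)" using a1 by (intro sum_nonneg) (auto simp: algebra_simps)
  have "1 \<le> (1 - \<epsilon>) * (1 - \<epsilon> * (\<Sum>j\<in>UNIV. a j - 1)) + \<epsilon> * (1 + (\<Sum>j\<in>UNIV. a j - 1))"
  proof -
    have "(1 - \<epsilon>) * (1 - \<epsilon> * (\<Sum>j\<in>UNIV. a j - 1)) + \<epsilon> * (1 + (\<Sum>j\<in>UNIV. a j - 1)) =
      1 + \<epsilon> * \<epsilon> * (\<Sum>j\<in>UNIV. a j - 1)" by (simp add: algebra_simps)
    then show ?thesis using s0 by simp
  qed
  also have "\<dots> \<le> (1 - \<epsilon>) * expec \<nu> (\<lambda>r. \<Prod>j\<in>UNIV. v j r ^ (2 * h)) + \<epsilon> * (\<Prod>j\<in>UNIV. a j)"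
    using 1 2 \<epsilon> by (intro add_mono mult_left_mono) auto
  finally have norm: "1 \<le> (1 - \<epsilon>) * expec \<nu> (\<lambda>r. \<Prod>j\<in>UNIV. v j r ^ (2 * h)) + \<epsilon> * (\<Prod>j\<in>UNIV. a j)" .
  define E where "E = (\<Prod>j\<in>UNIV. e j ^ (2 * h))"
  have E0: "0 \<le> E" unfolding E_def using less_imp_le[OF e] by (intro prod_nonneg zero_le_power ballI) auto
  have uv: "u j r = e j * v j r" for j r using e[of j] by (simp add: v_def)
  have "E * expec \<nu> (\<lambda>r. \<Prod>j\<in>UNIV. v j r ^ (2 * h)) = expec \<nu> (\<lambda>r. \<Prod>j\<in>UNIV. u j r ^ (2 * h))"
    unfolding expec_cmult[symmetric] by (simp add: E_def uv power_mult_distrib prod.distrib)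
  moreover have "E * (\<Prod>j\<in>UNIV. a j) = (\<Prod>j\<in>UNIV. expec \<nu> (\<lambda>r. u j r ^ (2 * h)))"
    by (simp add: E_def uv a_def power_mult_distrib expec_cmult prod.distrib)
  ultimately show ?thesis
    using mult_left_mono[OF norm E0] by (simp add: algebra_simps E_def e_def)
qed

text \<open>With U_j for the b-th power of v_j this says that the mean of a product is at least the
  product of the L^(1/b) quasi-norms, the usual form of a reverse Hoelder inequality; stating it for
  powers avoids roots. The map \<open>\<pi> j\<close> extracts from a point what step
  \<open>j\<close> sees.\<close>

definition reverse_hoelder :: "'z pmf \<Rightarrow> ('l::finite \<Rightarrow> 'z \<Rightarrow> 'r) \<Rightarrow> nat \<Rightarrow> bool" where
  "reverse_hoelder p \<pi> b \<longleftrightarrow> (\<forall>v :: 'l \<Rightarrow> 'r \<Rightarrow> real. (\<forall>j r. 0 \<le> v j r) \<longrightarrow>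
    (\<Prod>j\<in>UNIV. expec p (\<lambda>z. v j (\<pi> j z)) ^ b) \<le> expec p (\<lambda>z. \<Prod>j\<in>UNIV. v j (\<pi> j z) ^ b))"

text \<open>Averaging each \<open>u j\<close> over its own new seed gives functions
  \<open>w j\<close> of the remaining coordinates. The induction hypothesis applies to these, and
  the one-coordinate inequality then to each fibre. No constant accumulates, so the size of
  \<open>B\<close> does not matter.\<close>

lemma reverse_hoelder_tensor:
  fixes u :: "'l::finite \<Rightarrow> (nat \<Rightarrow> 'r) \<Rightarrow> real" and \<pi> :: "'l \<Rightarrow> 'z \<Rightarrow> 'r"
  assumes "finite B" and p: "finite (set_pmf p)"
    and one: "reverse_hoelder p \<pi> b"
    and u: "\<And>j y. 0 \<le> u j y"
  shows "(\<Prod>j\<in>UNIV. expec (iid B d p) (\<lambda>Y. u j (\<lambda>i. \<pi> j (Y i))) ^ b) \<le>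
    expec (iid B d p) (\<lambda>Y. \<Prod>j\<in>UNIV. u j (\<lambda>i. \<pi> j (Y i)) ^ b)"
  using assms(1) u
proof (induction B arbitrary: u)
  case (insert i B)
  have upd: "(\<lambda>k. \<pi> j ((Y(i := z)) k)) = (\<lambda>k. \<pi> j (Y k))(i := \<pi> j z)" for j Y z by auto
  define w where "w j y = expec p (\<lambda>z. u j (y(i := \<pi> j z)))" for j y
  have w0: "0 \<le> w j y" for j y using insert.prems by (auto simp: w_def intro!: expec_nonneg)
  have "(\<Prod>j\<in>UNIV. expec (iid (insert i B) d p) (\<lambda>Y. u j (\<lambda>i. \<pi> j (Y i))) ^ b) =
    (\<Prod>j\<in>UNIV. expec (iid B d p) (\<lambda>Y. w j (\<lambda>i. \<pi> j (Y i))) ^ b)"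
    unfolding w_def expec_iid_insert[OF insert.hyps p] upd ..
  also have "\<dots> \<le> expec (iid B d p) (\<lambda>Y. \<Prod>j\<in>UNIV. w j (\<lambda>i. \<pi> j (Y i)) ^ b)"
    using insert.IH w0 by blast
  also have "\<dots> \<le> expec (iid B d p) (\<lambda>Y. expec p (\<lambda>z. \<Prod>j\<in>UNIV. u j ((\<lambda>k. \<pi> j (Y k))(i := \<pi> j z)) ^ b))"
  proof (rule expec_mono)
    fix Y
    show "(\<Prod>j\<in>UNIV. w j (\<lambda>i. \<pi> j (Y i)) ^ b) \<le> expec p (\<lambda>z. \<Prod>j\<in>UNIV. u j ((\<lambda>k. \<pi> j (Y k))(i := \<pi> j z)) ^ b)"
      unfolding w_def by (rule one[unfolded reverse_hoelder_def, rule_format]) (rule insert.prems)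
  qed
  also have "\<dots> = expec (iid (insert i B) d p) (\<lambda>Y. \<Prod>j\<in>UNIV. u j (\<lambda>i. \<pi> j (Y i)) ^ b)"
    unfolding expec_iid_insert[OF insert.hyps p] upd ..
  finally show ?case .
qed simp

section \<open>The matching ensemble\<close>

text \<open>Cholesky factorization by Schur complements. A zero pivot forces its whole row to
  vanish, so the formulas that divide by \<open>a\<close> stay correct with quotients by 0 equal to
  0.\<close>

lemma psd_factorization:
  fixes A :: "'i \<Rightarrow> 'i \<Rightarrow> real"
  assumes "finite S" and "\<And>x y. x \<in> S \<Longrightarrow> y \<in> S \<Longrightarrow> A x y = A y x"
    and "\<And>v. 0 \<le> (\<Sum>x\<in>S. \<Sum>y\<in>S. v x * v y * A x y)"
  shows "\<exists>B. \<forall>x\<in>S. \<forall>y\<in>S. A x y = (\<Sum>e\<in>S. B x e * B y e)"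
  using assms
proof (induction S arbitrary: A)
  case (insert d S)
  define a where "a = A d d"
  have sym: "A x d = A d x" if "x \<in> S" for x using insert.prems(1) that by simp
  have quad: "0 \<le> t * t * a + 2 * t * (\<Sum>y\<in>S. v y * A d y) + (\<Sum>x\<in>S. \<Sum>y\<in>S. v x * v y * A x y)" for t v
  proof -
    define v' where "v' = v(d := t)"
    have v': "v' d = t" "\<And>x. x \<in> S \<Longrightarrow> v' x = v x" using insert.hyps by (auto simp: v'_def)
    have "0 \<le> (\<Sum>x\<in>insert d S. \<Sum>y\<in>insert d S. v' x * v' y * A x y)" by (rule insert.prems)
    also have "\<dots> = t * t * a + (\<Sum>y\<in>S. t * v y * A d y) + (\<Sum>x\<in>S. v x * t * A d x) + (\<Sum>x\<in>S. \<Sum>y\<in>S. v x * v y * A x y)"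
      using insert.hyps by (simp add: v' sum.distrib a_def sym)
    also have "\<dots> = t * t * a + 2 * t * (\<Sum>y\<in>S. v y * A d y) + (\<Sum>x\<in>S. \<Sum>y\<in>S. v x * v y * A x y)"
      by (simp add: sum_distrib_left mult_ac flip: sum.distrib)
    finally show ?thesis .
  qed
  have a0: "0 \<le> a" using quad[of 1 "\<lambda>_. 0"] by simp
  have row0: "A d x = 0" if a: "a = 0" and x: "x \<in> S" for x
  proof (rule ccontr)
    assume ne: "A d x \<noteq> 0"
    define v where "v y = (if y = x then 1 else 0 :: real)" for y
    define c where "c = (\<Sum>x\<in>S. \<Sum>y\<in>S. v x * v y * A x y)"
    have "(\<Sum>y\<in>S. v y * A d y) = (\<Sum>y\<in>S. if y = x then A d y else 0)"
      by (intro sum.cong) (auto simp: v_def)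
    then have "(\<Sum>y\<in>S. v y * A d y) = A d x"
      using x insert.hyps by simp
    then have "0 \<le> 2 * t * A d x + c" for t
      using quad[of t v] a by (simp add: c_def)
    \<comment> \<open>At this \<open>t\<close> the linear function takes the value -1.\<close>
    from this[of "(- c - 1) / (2 * A d x)"] ne show False by (simp add: field_simps)
  qed
  define A' where "A' x y = A x y - A d x * A d y / a" for x y
  have "\<exists>B. \<forall>x\<in>S. \<forall>y\<in>S. A' x y = (\<Sum>e\<in>S. B x e * B y e)"
  proof (rule insert.IH)
    show "A' x y = A' y x" if "x \<in> S" "y \<in> S" for x y
      using insert.prems(1) that by (simp add: A'_def mult.commute)
    fix v :: "'i \<Rightarrow> real"
    define s where "s = (\<Sum>y\<in>S. v y * A d y)"
    have "(\<Sum>x\<in>S. \<Sum>y\<in>S. v x * v y * A' x y) =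
      (\<Sum>x\<in>S. \<Sum>y\<in>S. v x * v y * A x y) - (\<Sum>x\<in>S. \<Sum>y\<in>S. (v x * A d x) * (v y * A d y)) / a"
      by (simp add: A'_def right_diff_distrib sum_subtractf sum_divide_distrib mult_ac)
    also have "\<dots> = (\<Sum>x\<in>S. \<Sum>y\<in>S. v x * v y * A x y) - s * s / a"
      by (simp add: s_def sum_product)
    \<comment> \<open>This \<open>t\<close> minimises the quadratic form along the pivot
      direction.\<close>
    also have "\<dots> = (- s / a) * (- s / a) * a + 2 * (- s / a) * s + (\<Sum>x\<in>S. \<Sum>y\<in>S. v x * v y * A x y)"
      by simp
    finally show "0 \<le> (\<Sum>x\<in>S. \<Sum>y\<in>S. v x * v y * A' x y)"
      using quad[of "- s / a" v] by (simp only: s_def)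
  qed
  then obtain B where B: "\<And>x y. x \<in> S \<Longrightarrow> y \<in> S \<Longrightarrow> A' x y = (\<Sum>e\<in>S. B x e * B y e)" by blast
  \<comment> \<open>Column \<open>d\<close> carries the pivot part, so row \<open>d\<close> can be 0
    in all other columns.\<close>
  define B' where "B' x e = (if e = d then A d x / sqrt a else if x = d then 0 else B x e)" for x e
  have sq: "A d x / sqrt a * (A d y / sqrt a) = A d x * A d y / a" for x y
    using a0 by (simp add: abs_of_nonneg)
  have ad: "A d d * A d y / a = A d y" if "y \<in> insert d S" for y
    using row0 that by (cases "a = 0") (auto simp: a_def)
  have "A x y = (\<Sum>e\<in>insert d S. B' x e * B' y e)" if xy: "x \<in> insert d S" "y \<in> insert d S" for x y
  proof -
    have "(\<Sum>e\<in>insert d S. B' x e * B' y e) = A d x * A d y / a + (\<Sum>e\<in>S. B' x e * B' y e)"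
      using insert.hyps a0 by (simp add: B'_def sq)
    also have "(\<Sum>e\<in>S. B' x e * B' y e) = (if x = d \<or> y = d then 0 else A' x y)"
    proof (cases "x = d \<or> y = d")
      case True
      then show ?thesis using insert.hyps by (auto simp: B'_def intro!: sum.neutral)
    next
      case False
      then have "(\<Sum>e\<in>S. B' x e * B' y e) = (\<Sum>e\<in>S. B x e * B y e)"
        using insert.hyps by (intro sum.cong) (auto simp: B'_def)
      then show ?thesis using B xy False by auto
    qed
    finally show ?thesis
      using ad[OF xy(1)] ad[OF xy(2)] xy sym by (auto simp: A'_def mult.commute)
  qed
  then show ?case by blast
qed auto

section \<open>Covariance bounds from the maximal correlation\<close>

definition indep_step :: "'l \<Rightarrow> (('l \<Rightarrow> 'w) \<Rightarrow> 'b) \<Rightarrow> bool" where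
  "indep_step j G \<longleftrightarrow> (\<forall>x x'. (\<forall>i. i \<noteq> j \<longrightarrow> x i = x' i) \<longrightarrow> G x = G x')"

lemma corr_upper:
  fixes P :: "('l::finite \<Rightarrow> 'w::finite) pmf" and G :: "('l \<Rightarrow> 'w) \<Rightarrow> real"
  assumes \<rho>: "max_corr P \<le> \<rho>" and G: "indep_step j G"
    and "expec P (\<lambda>x. f (x j)) = 0" "expec P G = 0"
    and "expec P (\<lambda>x. (f (x j))\<^sup>2) = 1" "expec P (\<lambda>x. (G x)\<^sup>2) = 1"
  shows "expec P (\<lambda>x. f (x j) * G x) \<le> \<rho>"
proof -
  have fin: "finite (set_pmf P)" by simp
  define f' where "f' y = f (y j)" for y :: "'l \<Rightarrow> 'w"
  have f': "f' (restrict x {j}) = f (x j)" for x by (simp add: f'_def)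
  have G': "G (restrict x (UNIV - {j})) = G x" for x
  proof -
    have "\<forall>i. i \<noteq> j \<longrightarrow> restrict x (UNIV - {j}) i = x i" by simp
    then show ?thesis using G unfolding indep_step_def by blast
  qed
  have "expec P (\<lambda>x. f (x j) * G x) = pmf_cov P (\<lambda>x. f' (restrict x {j})) (\<lambda>x. G (restrict x (UNIV - {j})))"
    using assms by (simp add: pmf_cov_def f' G' expec_eq_expectation[OF fin])
  also have "\<dots> \<in> corr_values P {j} (UNIV - {j})"
    unfolding corr_values_def mem_Collect_eq using assms
    by (intro exI[of _ f'] exI[of _ G]) (simp add: f' G' expec_eq_expectation[OF fin])
  finally have mem: "expec P (\<lambda>x. f (x j) * G x) \<in> corr_values P {j} (UNIV - {j})" .
  have "expec P (\<lambda>x. f (x j) * G x) \<le> corr P {j} (UNIV - {j})"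
    unfolding corr_def using mem corr_values_le_1[of _ P "{j}" "UNIV - {j}"]
    by (auto intro!: cSup_upper bdd_aboveI[of _ 1])
  also have "\<dots> \<le> max_corr P"
    unfolding max_corr_def by (rule Max_ge) auto
  finally show ?thesis using \<rho> by simp
qed

text \<open>Squaring covers both signs of the covariance, which are obtained from \<open>up\<close>
  at s = 1 and s = -1, and makes the bound homogeneous. When a second moment vanishes, normalisation
  is impossible and Cauchy-Schwarz shows that the left-hand side is 0.\<close>

lemma corr_bound:
  fixes P :: "('l::finite \<Rightarrow> 'w::finite) pmf" and G :: "('l \<Rightarrow> 'w) \<Rightarrow> real"
  assumes \<rho>: "max_corr P \<le> \<rho>" and G: "indep_step j G"
    and f0: "expec P (\<lambda>x. f (x j)) = 0" and G0: "expec P G = 0"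
  shows "(expec P (\<lambda>x. f (x j) * G x))\<^sup>2 \<le> \<rho>\<^sup>2 * (expec P (\<lambda>x. (f (x j))\<^sup>2) * expec P (\<lambda>x. (G x)\<^sup>2))"
proof (cases "expec P (\<lambda>x. (f (x j))\<^sup>2) = 0 \<or> expec P (\<lambda>x. (G x)\<^sup>2) = 0")
  case True
  then show ?thesis using expec_cauchy_schwarz[of P "\<lambda>x. f (x j)" G] by auto
next
  case False
  define a where "a = expec P (\<lambda>x. (f (x j))\<^sup>2)"
  define b where "b = expec P (\<lambda>x. (G x)\<^sup>2)"
  have "0 \<le> a" "0 \<le> b" unfolding a_def b_def by (rule expec_square_nonneg)+
  with False have ab: "0 < a" "0 < b" by (auto simp: a_def b_def)
  define c where "c = expec P (\<lambda>x. f (x j) * G x)"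
  have up: "s * c / (sqrt a * sqrt b) \<le> \<rho>" if s: "s\<^sup>2 = 1" for s
  proof -
    have "expec P (\<lambda>x. (s * f (x j) / sqrt a) * (G x / sqrt b)) \<le> \<rho>"
    proof (rule corr_upper[OF \<rho>])
      show "indep_step j (\<lambda>x. G x / sqrt b)" using G by (auto simp: indep_step_def)
      show "expec P (\<lambda>x. s * f (x j) / sqrt a) = 0" "expec P (\<lambda>x. G x / sqrt b) = 0"
        by (simp_all add: expec_divide expec_cmult f0 G0)
      show "expec P (\<lambda>x. (s * f (x j) / sqrt a)\<^sup>2) = 1" "expec P (\<lambda>x. (G x / sqrt b)\<^sup>2) = 1"
        using ab by (simp_all add: power_divide power_mult_distrib expec_divide s flip: a_def b_def)
    qed
    also have "expec P (\<lambda>x. (s * f (x j) / sqrt a) * (G x / sqrt b)) = expec P (\<lambda>x. s * (f (x j) * G x) / (sqrt a * sqrt b))"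
      by (intro expec_cong) simp
    also have "\<dots> = s * c / (sqrt a * sqrt b)"
      by (simp only: expec_divide expec_cmult c_def)
    finally show ?thesis .
  qed
  have "\<bar>c / (sqrt a * sqrt b)\<bar> \<le> \<rho>"
    using up[of 1] up[of "-1"] by (simp add: abs_le_iff)
  then have "(c / (sqrt a * sqrt b))\<^sup>2 \<le> \<rho>\<^sup>2"
    using abs_ge_zero order_trans by (intro power2_le_iff_abs_le[THEN iffD2]) blast+
  then have "c\<^sup>2 / (a * b) \<le> \<rho>\<^sup>2"
    using ab by (simp add: power_divide power_mult_distrib)
  then show ?thesis
    using ab by (simp add: pos_divide_le_eq a_def b_def c_def)
qed

text \<open>Fix \<open>j\<close> and collect the other summands in \<open>G\<close>. From c^2 \<le>
  \<rho>^2 a b follows 2|c| \<le> \<rho>^2 a + b, so the variance a + 2c + b of the sum is at least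
  (1 - \<rho>^2) a. Averaging over \<open>j\<close> costs the factor CARD('l).\<close>

lemma variance_sum_lower:
  fixes P :: "('l::finite \<Rightarrow> 'w::finite) pmf" and F :: "'l \<Rightarrow> 'w \<Rightarrow> real"
  assumes \<rho>: "max_corr P \<le> \<rho>" and F0: "\<And>j. expec P (\<lambda>x. F j (x j)) = 0"
  shows "(1 - \<rho>\<^sup>2) / CARD('l) * (\<Sum>j\<in>UNIV. expec P (\<lambda>x. (F j (x j))\<^sup>2)) \<le> expec P (\<lambda>x. (\<Sum>j\<in>UNIV. F j (x j))\<^sup>2)"
proof -
  define V where "V = expec P (\<lambda>x. (\<Sum>j\<in>UNIV. F j (x j))\<^sup>2)"
  have each: "(1 - \<rho>\<^sup>2) * expec P (\<lambda>x. (F j (x j))\<^sup>2) \<le> V" for j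
  proof -
    define G where "G x = (\<Sum>i\<in>UNIV - {j}. F i (x i))" for x
    define a b c where "a = expec P (\<lambda>x. (F j (x j))\<^sup>2)" and "b = expec P (\<lambda>x. (G x)\<^sup>2)"
      and "c = expec P (\<lambda>x. F j (x j) * G x)"
    have ab: "0 \<le> a" "0 \<le> b" unfolding a_def b_def by (rule expec_square_nonneg)+
    have "indep_step j G" by (auto simp: indep_step_def G_def intro!: sum.cong)
    moreover have "expec P G = 0" unfolding G_def expec_sum by (simp add: F0)
    ultimately have c: "c\<^sup>2 \<le> \<rho>\<^sup>2 * (a * b)"
      unfolding a_def b_def c_def by (rule corr_bound[OF \<rho> _ F0])
    have "(2 * c)\<^sup>2 \<le> (\<rho>\<^sup>2 * a + b)\<^sup>2"
    proof -
      have "0 \<le> (\<rho>\<^sup>2 * a - b)\<^sup>2" by simp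
      also have "\<dots> = (\<rho>\<^sup>2 * a + b)\<^sup>2 - 4 * (\<rho>\<^sup>2 * (a * b))"
        by (simp add: power2_eq_square algebra_simps)
      finally show ?thesis using c by (simp add: power_mult_distrib)
    qed
    then have "\<bar>2 * c\<bar> \<le> \<rho>\<^sup>2 * a + b"
      using ab by (intro power2_le_iff_abs_le[THEN iffD1]) auto
    moreover have "V = a + 2 * c + b"
    proof -
      have "V = expec P (\<lambda>x. (F j (x j))\<^sup>2 + 2 * (F j (x j) * G x) + (G x)\<^sup>2)"
        unfolding V_def G_def
        by (intro expec_cong) (simp add: sum.remove[of UNIV j] power2_sum algebra_simps)
      then show ?thesis by (simp only: expec_add expec_cmult a_def b_def c_def)
    qed
    ultimately show ?thesis by (simp add: a_def[symmetric] algebra_simps)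
  qed
  have "(\<Sum>j\<in>UNIV. (1 - \<rho>\<^sup>2) * expec P (\<lambda>x. (F j (x j))\<^sup>2)) \<le> (\<Sum>j\<in>(UNIV :: 'l set). V)"
    by (intro sum_mono each)
  then have "(1 - \<rho>\<^sup>2) * (\<Sum>j\<in>UNIV. expec P (\<lambda>x. (F j (x j))\<^sup>2)) \<le> CARD('l) * V"
    by (simp add: sum_distrib_left)
  then show ?thesis by (simp add: V_def[symmetric] field_simps)
qed

section \<open>Seeds that are shared or independent, and the functions of them\<close>

lemma expec_bernoulli:
  fixes f :: "bool \<Rightarrow> real"
  assumes "0 < \<epsilon>" "\<epsilon> < 1"
  shows "expec (bernoulli_pmf \<epsilon>) f = \<epsilon> * f True + (1 - \<epsilon>) * f False"
  using assms by (simp add: expec_def set_pmf_bernoulli UNIV_bool)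

lemma expec_uniform:
  fixes f :: "'a::finite \<Rightarrow> real"
  shows "expec (pmf_of_set UNIV) f = (\<Sum>x\<in>UNIV. f x) / CARD('a)"
  by (simp add: expec_def sum_divide_distrib)

text \<open>A coin of bias \<open>\<epsilon>\<close> decides between independent seeds and one
  common seed; \<open>Q\<close> is the resulting law of the tuple of seeds.\<close>

lemma mixture_expec:
  fixes \<nu> :: "'r pmf" and \<epsilon> :: real
  assumes \<nu>: "finite (set_pmf \<nu>)" and \<epsilon>: "0 < \<epsilon>" "\<epsilon> < 1"
  obtains Q :: "('l::finite \<Rightarrow> 'r) pmf"
  where "finite (set_pmf Q)" "\<And>F :: ('l \<Rightarrow> 'r) \<Rightarrow> real. expec Q F =
    (1 - \<epsilon>) * expec \<nu> (\<lambda>r. F (\<lambda>_. r)) + \<epsilon> * expec (iid UNIV undefined \<nu>) F"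
proof
  define M where "M = pair_pmf (bernoulli_pmf \<epsilon>) (pair_pmf \<nu> (iid (UNIV :: 'l set) undefined \<nu>))"
  define Q where "Q = map_pmf (\<lambda>(b, r, s). if b then s else (\<lambda>_. r)) M"
  have fin: "finite (set_pmf M)" using \<nu> by (simp add: M_def)
  then show "finite (set_pmf Q)" by (simp add: Q_def)
  show "expec Q F = (1 - \<epsilon>) * expec \<nu> (\<lambda>r. F (\<lambda>_. r)) + \<epsilon> * expec (iid UNIV undefined \<nu>) F"
    for F :: "('l \<Rightarrow> 'r) \<Rightarrow> real"
    unfolding Q_def expec_map_pmf[OF fin]
    using \<nu> by (simp add: M_def expec_pair_pmf expec_bernoulli[OF \<epsilon>])
qed

lemma expec_iid_two:
  fixes f g :: "'r \<Rightarrow> real" and j k :: "'l::finite"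
  assumes "finite (set_pmf \<nu>)"
  shows "expec (iid UNIV d \<nu>) (\<lambda>r. f (r j)) = expec \<nu> f"
    and "j \<noteq> k \<Longrightarrow> expec (iid UNIV d \<nu>) (\<lambda>r. f (r j) * g (r k)) = expec \<nu> f * expec \<nu> g"
proof -
  define h where "h i = (if i = j then f else (\<lambda>_. 1))" for i
  have "(\<Prod>i\<in>UNIV. h i (r i)) = f (r j)" for r
    by (subst prod.remove[of _ j]) (auto simp: h_def intro!: prod.neutral)
  moreover have "(\<Prod>i\<in>UNIV. expec \<nu> (h i)) = expec \<nu> f"
    by (subst prod.remove[of _ j]) (auto simp: h_def assms intro!: prod.neutral)
  ultimately show "expec (iid UNIV d \<nu>) (\<lambda>r. f (r j)) = expec \<nu> f"
    using expec_iid_prod[of UNIV \<nu> d h] assms by simp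
next
  assume jk: "j \<noteq> k"
  define h where "h i = (if i = j then f else if i = k then g else (\<lambda>_. 1))" for i
  have U: "(UNIV :: 'l set) = insert j (insert k (UNIV - {j, k}))" by auto
  have "(\<Prod>i\<in>UNIV. h i (r i)) = f (r j) * g (r k)" for r
    using jk by (subst U) (auto simp: h_def)
  moreover have "(\<Prod>i\<in>UNIV. expec \<nu> (h i)) = expec \<nu> f * expec \<nu> g"
    using jk by (subst U) (auto simp: h_def assms)
  ultimately show "expec (iid UNIV d \<nu>) (\<lambda>r. f (r j) * g (r k)) = expec \<nu> f * expec \<nu> g"
    using expec_iid_prod[of UNIV \<nu> d h] assms by simp
qed

lemma sum_UNIV_prod:
  "(\<Sum>d\<in>(UNIV :: ('a::finite \<times> 'b::finite) set). f d) = (\<Sum>x\<in>UNIV. \<Sum>y\<in>UNIV. f (x, y))"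
  by (simp add: sum.cartesian_product flip: UNIV_Times_UNIV)

text \<open>A seed is a uniform sign together with a uniform column of a factor \<open>B\<close> of
  \<open>A\<close>, so that under a single seed the vector \<open>w\<close> has mean
  \<open>\<pi>\<close> and covariance \<open>A\<close>. Two different steps see the same seed only
  with probability 1 - \<epsilon>, hence the off-diagonal blocks of \<open>A\<close> are those of
  the target covariance \<open>C\<close> divided by 1 - \<epsilon>. This \<open>A\<close> is
  positive semidefinite because 1 - \<epsilon> times its quadratic form equals Var(\<Sum> F_j) -
  \<epsilon> \<Sum> Var(F_j), which is nonnegative by \<open>variance_sum_lower\<close>.\<close>

lemma matching_ensemble:
  fixes P :: "('l::finite \<Rightarrow> 'w::finite) pmf"
  assumes \<rho>: "max_corr P \<le> \<rho>" "0 < \<rho>" "\<rho> < 1"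
  obtains Q :: "('l \<Rightarrow> bool \<times> 'l \<times> 'w) pmf" and w :: "'l \<Rightarrow> 'w \<Rightarrow> bool \<times> 'l \<times> 'w \<Rightarrow> real" and b :: nat
  where "finite (set_pmf Q)"
    and "\<And>j x. expec Q (\<lambda>r. w j x (r j)) = expec P (\<lambda>X. of_bool (X j = x))"
    and "\<And>j x k y. expec Q (\<lambda>r. w j x (r j) * w k y (r k)) = expec P (\<lambda>X. of_bool (X j = x) * of_bool (X k = y))"
    and "0 < b" "reverse_hoelder Q (\<lambda>j r. r j) b"
proof -
  have finP: "finite (set_pmf P)" by simp
  \<comment> \<open>Half the constant of \<open>variance_sum_lower\<close>.\<close>
  define \<epsilon> where "\<epsilon> = (1 - \<rho>\<^sup>2) / CARD('l) / 2"
  have r2: "\<rho>\<^sup>2 < 1" "0 < \<rho>\<^sup>2" using \<rho> by (auto simp: power_less_one_iff)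
  have \<epsilon>0: "0 < \<epsilon>" using r2 by (simp add: \<epsilon>_def)
  have c1: "1 \<le> real CARD('l)" by (simp add: Suc_leI)
  have \<epsilon>le: "\<epsilon> \<le> (1 - \<rho>\<^sup>2) / CARD('l)" using r2 c1 by (simp add: \<epsilon>_def field_simps)
  have "\<epsilon> \<le> (1 - \<rho>\<^sup>2) / 1" using \<epsilon>le r2 c1 by (smt (verit) frac_le)
  then have \<epsilon>1: "\<epsilon> < 1" using r2 by (simp only: div_by_1)
  define \<pi> :: "'l \<times> 'w \<Rightarrow> real" where "\<pi> d = expec P (\<lambda>X. of_bool (X (fst d) = snd d))" for d :: "'l \<times> 'w"
  define I where "I d X = of_bool (X (fst d) = snd d) - \<pi> d" for d :: "'l \<times> 'w" and X :: "'l \<Rightarrow> 'w"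
  define C where "C d d' = expec P (\<lambda>X. I d X * I d' X)" for d d'
  \<comment> \<open>only the shared seed, of probability \<open>1 - \<epsilon>\<close>, produces covariance between different steps\<close>
  define A where "A d d' = (if fst d = fst d' then C d d' else C d d' / (1 - \<epsilon>))" for d d'
  have C_eq: "C d d' = expec P (\<lambda>X. of_bool (X (fst d) = snd d) * of_bool (X (fst d') = snd d')) - \<pi> d * \<pi> d'" for d d'
    by (simp add: C_def I_def left_diff_distrib right_diff_distrib expec_diff expec_cmult expec_multc finP flip: \<pi>_def)
  have "\<exists>B :: 'l \<times> 'w \<Rightarrow> 'l \<times> 'w \<Rightarrow> real. \<forall>x\<in>UNIV. \<forall>y\<in>UNIV. A x y = (\<Sum>e\<in>UNIV. B x e * B y e)"
  proof (rule psd_factorization)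
    show "A x y = A y x" for x y by (simp add: A_def C_def mult.commute)
    fix v :: "'l \<times> 'w \<Rightarrow> real"
    define F where "F j y = (\<Sum>x\<in>UNIV. v (j, x) * (of_bool (y = x) - \<pi> (j, x)))" for j y
    have FI: "F j (X j) = (\<Sum>x\<in>UNIV. v (j, x) * I (j, x) X)" for j X
      by (simp add: F_def I_def)
    have IE: "expec P (I d) = 0" for d
      unfolding I_def[abs_def] expec_diff by (simp add: \<pi>_def finP)
    have F0: "expec P (\<lambda>X. F j (X j)) = 0" for j
      unfolding FI expec_sum expec_cmult by (simp add: IE)
    define c where "c j k = expec P (\<lambda>X. F j (X j) * F k (X k))" for j k
    have cC: "c j k = (\<Sum>x\<in>UNIV. \<Sum>y\<in>UNIV. v (j, x) * v (k, y) * C (j, x) (k, y))" for j k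
      unfolding c_def FI expec_bilinear C_def ..
    have "(1 - \<epsilon>) * (\<Sum>d\<in>UNIV. \<Sum>d'\<in>UNIV. v d * v d' * A d d') =
      (1 - \<epsilon>) * (\<Sum>j\<in>UNIV. \<Sum>x\<in>UNIV. \<Sum>k\<in>UNIV. \<Sum>y\<in>UNIV. v (j, x) * v (k, y) * A (j, x) (k, y))"
      by (simp only: sum_UNIV_prod)
    also have "\<dots> = (\<Sum>j\<in>UNIV. \<Sum>k\<in>UNIV. (1 - \<epsilon>) * (\<Sum>x\<in>UNIV. \<Sum>y\<in>UNIV. v (j, x) * v (k, y) * A (j, x) (k, y)))"
      unfolding sum_distrib_left by (intro sum.cong refl sum.swap)
    also have "\<dots> = (\<Sum>j\<in>UNIV. \<Sum>k\<in>UNIV. c j k - (if j = k then \<epsilon> * c j k else 0))"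
    proof (intro sum.cong refl)
      fix j k
      have "(\<Sum>x\<in>UNIV. \<Sum>y\<in>UNIV. v (j, x) * v (k, y) * A (j, x) (k, y)) = (if j = k then c j k else c j k / (1 - \<epsilon>))"
        by (simp add: A_def cC sum_divide_distrib)
      then show "(1 - \<epsilon>) * (\<Sum>x\<in>UNIV. \<Sum>y\<in>UNIV. v (j, x) * v (k, y) * A (j, x) (k, y)) = c j k - (if j = k then \<epsilon> * c j k else 0)"
        using \<epsilon>1 by (cases "j = k", simp add: left_diff_distrib, simp)
    qed
    also have "\<dots> = (\<Sum>j\<in>UNIV. \<Sum>k\<in>UNIV. c j k) - \<epsilon> * (\<Sum>j\<in>UNIV. c j j)"
      by (simp add: sum_subtractf sum_distrib_left)
    also have "(\<Sum>j\<in>UNIV. \<Sum>k\<in>UNIV. c j k) = expec P (\<lambda>x. (\<Sum>j\<in>UNIV. F j (x j))\<^sup>2)"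
      by (simp add: power2_eq_square expec_prod_sums c_def)
    finally have eq: "(1 - \<epsilon>) * (\<Sum>d\<in>UNIV. \<Sum>d'\<in>UNIV. v d * v d' * A d d') =
      expec P (\<lambda>x. (\<Sum>j\<in>UNIV. F j (x j))\<^sup>2) - \<epsilon> * (\<Sum>j\<in>UNIV. expec P (\<lambda>x. (F j (x j))\<^sup>2))"
      by (simp add: c_def power2_eq_square)
    have "\<epsilon> * (\<Sum>j\<in>UNIV. expec P (\<lambda>x. (F j (x j))\<^sup>2)) \<le> (1 - \<rho>\<^sup>2) / CARD('l) * (\<Sum>j\<in>UNIV. expec P (\<lambda>x. (F j (x j))\<^sup>2))"
      by (intro mult_right_mono \<epsilon>le sum_nonneg expec_square_nonneg)
    also have "\<dots> \<le> expec P (\<lambda>x. (\<Sum>j\<in>UNIV. F j (x j))\<^sup>2)"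
      by (rule variance_sum_lower[OF \<rho>(1) F0])
    finally have "0 \<le> (1 - \<epsilon>) * (\<Sum>d\<in>UNIV. \<Sum>d'\<in>UNIV. v d * v d' * A d d')" by (simp add: eq)
    then show "0 \<le> (\<Sum>d\<in>UNIV. \<Sum>d'\<in>UNIV. v d * v d' * A d d')"
      using \<epsilon>1 by (simp add: zero_le_mult_iff)
  qed simp
  then obtain B :: "'l \<times> 'w \<Rightarrow> 'l \<times> 'w \<Rightarrow> real" where B: "\<And>d d'. A d d' = (\<Sum>e\<in>UNIV. B d e * B d' e)" by auto
  define D where "D = real CARD('l \<times> 'w)"
  have D0: "0 < D" unfolding D_def by (rule of_nat_0_less_iff[THEN iffD2]) (simp add: card_gt_0_iff)
  \<comment> \<open>The sign centres the second summand, and \<open>sqrt D\<close> compensates for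
    the probability 1/D of each column.\<close>
  define w where "w j x r = \<pi> (j, x) + (if fst r then 1 else -1) * sqrt D * B (j, x) (snd r)"
    for j :: 'l and x :: 'w and r :: "bool \<times> 'l \<times> 'w"
  define \<nu> where "\<nu> = pmf_of_set (UNIV :: (bool \<times> 'l \<times> 'w) set)"
  have fin: "finite (set_pmf \<nu>)" by simp
  have E\<nu>: "expec \<nu> f = (\<Sum>e\<in>UNIV. f (True, e) + f (False, e)) / (2 * D)" for f :: "_ \<Rightarrow> real"
  proof -
    have "(\<Sum>r\<in>UNIV. f r) = (\<Sum>s\<in>UNIV. \<Sum>e\<in>UNIV. f (s, e))"
      by (rule sum_UNIV_prod)
    then show ?thesis
      unfolding \<nu>_def expec_uniform by (simp add: UNIV_bool sum.distrib D_def card_prod algebra_simps)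
  qed
  have Ew: "expec \<nu> (w j x) = \<pi> (j, x)" for j x
    by (simp add: E\<nu> w_def D_def)
  have Eww: "expec \<nu> (\<lambda>r. w j x r * w k y r) = \<pi> (j, x) * \<pi> (k, y) + A (j, x) (k, y)" for j x k y
  proof -
    have "w j x (True, e) * w k y (True, e) + w j x (False, e) * w k y (False, e) =
      2 * (\<pi> (j, x) * \<pi> (k, y)) + 2 * D * (B (j, x) e * B (k, y) e)" for e
      using D0 by (simp add: w_def algebra_simps)
    then have "expec \<nu> (\<lambda>r. w j x r * w k y r) = (2 * D * (\<pi> (j, x) * \<pi> (k, y)) + 2 * D * A (j, x) (k, y)) / (2 * D)"
      by (simp add: E\<nu> sum.distrib B sum_distrib_left D_def)
    then show ?thesis using D0 by (simp add: add_divide_distrib)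
  qed
  obtain Q :: "('l \<Rightarrow> bool \<times> 'l \<times> 'w) pmf" where finQ: "finite (set_pmf Q)"
    and Q: "\<And>F :: _ \<Rightarrow> real. expec Q F = (1 - \<epsilon>) * expec \<nu> (\<lambda>r. F (\<lambda>_. r)) + \<epsilon> * expec (iid UNIV undefined \<nu>) F"
    using mixture_expec[OF fin \<epsilon>0 \<epsilon>1] by metis
  obtain h :: nat where h: "4 / \<epsilon> * (2 + real CARD('l) / \<epsilon>) \<le> real h"
    using real_arch_simple by blast
  show thesis
  proof (rule that[of Q w "2 * h"])
    show "finite (set_pmf Q)" by (rule finQ)
    have "0 < 4 / \<epsilon> * (2 + real CARD('l) / \<epsilon>)" using \<epsilon>0 by (intro mult_pos_pos) (auto intro: add_pos_nonneg)
    then show "0 < 2 * h" using h by linarith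
    show "expec Q (\<lambda>r. w j x (r j)) = expec P (\<lambda>X. of_bool (X j = x))" for j x
      unfolding Q by (simp add: expec_iid_two[OF fin] Ew \<pi>_def algebra_simps)
    show "expec Q (\<lambda>r. w j x (r j) * w k y (r k)) = expec P (\<lambda>X. of_bool (X j = x) * of_bool (X k = y))" for j x k y
    proof (cases "j = k")
      case True
      \<comment> \<open>In both branches of the mixture the seed of a single step has law \<nu>, so
        blocks within one step need no rescaling.\<close>
      have "expec Q (\<lambda>r. w j x (r j) * w k y (r k)) = expec \<nu> (\<lambda>r. w j x r * w k y r)"
        unfolding Q True expec_iid_two(1)[OF fin, of _ "\<lambda>r. w k x r * w k y r"] by (simp add: algebra_simps)
      then show ?thesis by (simp add: Eww A_def C_eq True)
    next
      case False
      have "expec Q (\<lambda>r. w j x (r j) * w k y (r k)) =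
        (1 - \<epsilon>) * (\<pi> (j, x) * \<pi> (k, y) + C (j, x) (k, y) / (1 - \<epsilon>)) + \<epsilon> * (\<pi> (j, x) * \<pi> (k, y))"
        unfolding Q expec_iid_two(2)[OF fin False] by (simp add: Eww Ew A_def False)
      also have "\<dots> = \<pi> (j, x) * \<pi> (k, y) + C (j, x) (k, y)"
      proof -
        have "(1 - \<epsilon>) * (C (j, x) (k, y) / (1 - \<epsilon>)) = C (j, x) (k, y)" using \<epsilon>1 by simp
        then show ?thesis unfolding distrib_left[of "1 - \<epsilon>"] by (simp add: algebra_simps)
      qed
      finally show ?thesis by (simp add: C_eq)
    qed
    show "reverse_hoelder Q (\<lambda>j r. r j) (2 * h)"
      unfolding reverse_hoelder_def
    proof (intro allI impI)
      fix v :: "'l \<Rightarrow> bool \<times> 'l \<times> 'w \<Rightarrow> real"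
      assume "\<forall>j r. 0 \<le> v j r"
      then have v: "\<And>j r. 0 \<le> v j r" by blast
      have "expec Q (\<lambda>r. v j (r j)) = expec \<nu> (v j)" for j
        unfolding Q by (simp add: expec_iid_two[OF fin] algebra_simps)
      moreover have "expec Q (\<lambda>r. \<Prod>j\<in>UNIV. v j (r j) ^ (2 * h)) =
        (1 - \<epsilon>) * expec \<nu> (\<lambda>r. \<Prod>j\<in>UNIV. v j r ^ (2 * h)) + \<epsilon> * (\<Prod>j\<in>UNIV. expec \<nu> (\<lambda>r. v j r ^ (2 * h)))"
        unfolding Q by (subst expec_iid_prod) (simp_all add: fin)
      ultimately show "(\<Prod>j\<in>UNIV. expec Q (\<lambda>r. v j (r j)) ^ (2 * h)) \<le> expec Q (\<lambda>r. \<Prod>j\<in>UNIV. v j (r j) ^ (2 * h))"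
        using reverse_hoelder_mixture[OF fin \<epsilon>0 _ v h] \<epsilon>1 by simp
    qed
  qed
qed

section \<open>The replacement argument\<close>

lemma expec_of_real: "expec p (\<lambda>z. of_real (f z)) = (of_real (expec p f) :: 'b::real_algebra_1)"
  unfolding expec_def of_real_sum real_scaleR_def of_real_mult by (simp add: scaleR_conv_of_real)

text \<open>The common part \<open>a\<close> factors out as a unimodular constant, and the Taylor
  polynomial \<open>T\<close> of degree 2 has the same mean on both sides. Only the two remainders,
  at most |x|^3/6 each, are left.\<close>

lemma char_function_swap:
  fixes \<Delta> \<Delta>' :: "'z \<Rightarrow> real"
  assumes p: "finite (set_pmf p)" and "expec p \<Delta> = expec p \<Delta>'"
    and "expec p (\<lambda>z. (\<Delta> z)\<^sup>2) = expec p (\<lambda>z. (\<Delta>' z)\<^sup>2)"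
  shows "cmod (expec p (\<lambda>z. iexp (a + \<Delta> z)) - expec p (\<lambda>z. iexp (a + \<Delta>' z))) \<le>
    (expec p (\<lambda>z. \<bar>\<Delta> z\<bar> ^ 3) + expec p (\<lambda>z. \<bar>\<Delta>' z\<bar> ^ 3)) / 6"
proof -
  define T where "T x = 1 + \<i> * complex_of_real x - complex_of_real (x\<^sup>2) / 2" for x
  have R: "cmod (iexp x - T x) \<le> \<bar>x\<bar> ^ 3 / 6" for x
  proof -
    have "(\<Sum>k\<le>2. (\<i> * complex_of_real x) ^ k / fact k) = T x"
    proof -
      have "{..2} = {0, 1, 2 :: nat}" by auto
      then show ?thesis by (simp add: T_def power_mult_distrib)
    qed
    then show ?thesis using iexp_approx1[of x 2] by (simp add: fact_numeral)
  qed
  have ET: "expec p (\<lambda>z. T (\<Theta> z)) =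
    1 + \<i> * complex_of_real (expec p \<Theta>) - complex_of_real (expec p (\<lambda>z. (\<Theta> z)\<^sup>2)) / 2" for \<Theta>
  proof -
    have "expec p (\<lambda>z. T (\<Theta> z)) = expec p (\<lambda>z. 1 + \<i> * complex_of_real (\<Theta> z) - complex_of_real ((\<Theta> z)\<^sup>2) * (1 / 2))"
      by (simp add: T_def)
    also have "\<dots> = 1 + \<i> * complex_of_real (expec p \<Theta>) - complex_of_real (expec p (\<lambda>z. (\<Theta> z)\<^sup>2)) * (1 / 2)"
      by (simp only: expec_diff expec_add expec_cmult expec_multc expec_of_real expec_const[OF p])
    finally show ?thesis by simp
  qed
  have rem: "cmod (expec p (\<lambda>z. iexp (\<Theta> z) - T (\<Theta> z))) \<le> expec p (\<lambda>z. \<bar>\<Theta> z\<bar> ^ 3) / 6" for \<Theta>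
  proof -
    have "cmod (expec p (\<lambda>z. iexp (\<Theta> z) - T (\<Theta> z))) \<le> expec p (\<lambda>z. cmod (iexp (\<Theta> z) - T (\<Theta> z)))"
      by (rule norm_expec)
    also have "\<dots> \<le> expec p (\<lambda>z. \<bar>\<Theta> z\<bar> ^ 3 / 6)"
      by (rule expec_mono) (rule R)
    finally show ?thesis by (simp only: expec_divide)
  qed
  have "expec p (\<lambda>z. iexp (a + \<Delta> z)) - expec p (\<lambda>z. iexp (a + \<Delta>' z)) =
    iexp a * (expec p (\<lambda>z. iexp (\<Delta> z)) - expec p (\<lambda>z. iexp (\<Delta>' z)))"
    by (simp add: distrib_left exp_add expec_cmult right_diff_distrib)
  also have "expec p (\<lambda>z. iexp (\<Delta> z)) - expec p (\<lambda>z. iexp (\<Delta>' z)) =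
    expec p (\<lambda>z. iexp (\<Delta> z) - T (\<Delta> z)) - expec p (\<lambda>z. iexp (\<Delta>' z) - T (\<Delta>' z))"
    by (simp add: expec_diff ET assms)
  also have "cmod (iexp a * \<dots>) \<le> expec p (\<lambda>z. \<bar>\<Delta> z\<bar> ^ 3) / 6 + expec p (\<lambda>z. \<bar>\<Delta>' z\<bar> ^ 3) / 6"
    by (simp add: norm_mult) (intro order_trans[OF norm_triangle_ineq4] add_mono rem)
  finally show ?thesis by (simp add: add_divide_distrib)
qed

text \<open>The coefficients of sin^2 x = 1/2 - (e^(2ix) + e^(-2ix))/4 have total absolute value 1,
  and this survives products, so passing to characters does not magnify errors. Steps outside
  \<open>S\<close> only have frequency 0; \<open>S\<close> will be a singleton or the set of all
  steps.\<close>

lemma prod_sin_square_expansion: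
  fixes S :: "'l::finite set"
  obtains W :: "('l \<Rightarrow> real) set" and c :: "('l \<Rightarrow> real) \<Rightarrow> real"
  where "finite W" "\<And>v j. v \<in> W \<Longrightarrow> \<bar>v j\<bar> \<le> 2" "(\<Sum>v\<in>W. \<bar>c v\<bar>) = 1"
    "\<And>x. complex_of_real (\<Prod>j\<in>S. (sin (x j))\<^sup>2) = (\<Sum>v\<in>W. complex_of_real (c v) * iexp (\<Sum>j\<in>UNIV. v j * x j))"
proof -
  define V where "V j = (if j \<in> S then {-2, 0, 2 :: real} else {0})" for j
  define d :: "'l \<Rightarrow> real \<Rightarrow> real" where "d j v = (if j \<in> S then if v = 0 then 1 / 2 else -1 / 4 else 1)" for j and v :: real
  have finV: "finite (V j)" for j by (simp add: V_def)
  have one: "(if j \<in> S then complex_of_real ((sin x)\<^sup>2) else 1) = (\<Sum>v\<in>V j. complex_of_real (d j v) * iexp (v * x))" for j x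
  proof (cases "j \<in> S")
    case True
    have "(\<Sum>v\<in>V j. complex_of_real (d j v) * iexp (v * x)) = 1 / 2 - (iexp (2 * x) + iexp (- (2 * x))) / 4"
      using True by (simp add: V_def d_def field_simps)
    also have "iexp (2 * x) + iexp (- (2 * x)) = complex_of_real (2 * cos (2 * x))"
      unfolding cis_conv_exp[symmetric] by (simp add: complex_eq_iff)
    also have "1 / 2 - complex_of_real (2 * cos (2 * x)) / 4 = complex_of_real ((1 - cos (2 * x)) / 2)"
      by simp
    also have "(1 - cos (2 * x)) / 2 = (sin x)\<^sup>2" by (simp add: cos_double_sin)
    finally show ?thesis using True by simp
  qed (simp add: V_def d_def)
  show thesis
  proof (rule that[of "PiE UNIV V" "\<lambda>v. \<Prod>j\<in>UNIV. d j (v j)"])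
    show "finite (PiE UNIV V)" by (intro finite_PiE finV) auto
    show "\<bar>v j\<bar> \<le> 2" if "v \<in> PiE UNIV V" for v j
    proof -
      have "v j \<in> V j" using that by auto
      then show ?thesis by (auto simp: V_def split: if_splits)
    qed
    have "(\<Sum>v\<in>PiE UNIV V. \<bar>\<Prod>j\<in>UNIV. d j (v j)\<bar>) = (\<Prod>j\<in>UNIV. \<Sum>v\<in>V j. \<bar>d j v\<bar>)"
      unfolding abs_prod by (rule prod_sum_PiE[symmetric]) (auto simp: finV)
    also have "\<dots> = 1" by (intro prod.neutral) (simp add: V_def d_def)
    finally show "(\<Sum>v\<in>PiE UNIV V. \<bar>\<Prod>j\<in>UNIV. d j (v j)\<bar>) = 1" .
    fix x :: "'l \<Rightarrow> real"
    have "complex_of_real (\<Prod>j\<in>S. (sin (x j))\<^sup>2) = (\<Prod>j\<in>UNIV. if j \<in> S then complex_of_real ((sin (x j))\<^sup>2) else 1)"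
      by (simp add: prod.If_cases)
    also have "\<dots> = (\<Prod>j\<in>UNIV. \<Sum>v\<in>V j. complex_of_real (d j v) * iexp (v * x j))"
      by (simp only: one)
    also have "\<dots> = (\<Sum>v\<in>PiE UNIV V. \<Prod>j\<in>UNIV. complex_of_real (d j (v j)) * iexp (v j * x j))"
      by (rule prod_sum_PiE) (auto simp: finV)
    also have "\<dots> = (\<Sum>v\<in>PiE UNIV V. complex_of_real (\<Prod>j\<in>UNIV. d j (v j)) * iexp (\<Sum>j\<in>UNIV. v j * x j))"
      by (simp add: prod.distrib exp_sum sum_distrib_left)
    finally show "complex_of_real (\<Prod>j\<in>S. (sin (x j))\<^sup>2) =
      (\<Sum>v\<in>PiE UNIV V. complex_of_real (\<Prod>j\<in>UNIV. d j (v j)) * iexp (\<Sum>j\<in>UNIV. v j * x j))" .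
  qed
qed

section \<open>Lindeberg replacement, conditional on frozen coordinates\<close>

definition matching_systems ::
  "'z pmf \<Rightarrow> real \<Rightarrow> ('l \<Rightarrow> nat) \<Rightarrow> ('l \<Rightarrow> nat \<Rightarrow> 'z \<Rightarrow> real) \<Rightarrow> ('l \<Rightarrow> nat \<Rightarrow> 'z \<Rightarrow> real) \<Rightarrow> bool" where
  "matching_systems p K m \<alpha> \<beta> \<longleftrightarrow>
    (\<forall>j. ortho_system p (m j) K (\<alpha> j) \<and> ortho_system p (m j) K (\<beta> j)) \<and>
    (\<forall>j k. \<forall>a<m j. \<forall>b<m k. expec p (\<lambda>z. \<alpha> j a z * \<alpha> k b z) = expec p (\<lambda>z. \<beta> j a z * \<beta> k b z))"

text \<open>Both systems live on one product space, whose points will be pairs of an original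
  outcome and a tuple of seeds. Replacing a coordinate thus changes the functions evaluated there,
  never the law.\<close>

definition hybrid :: "('l \<Rightarrow> nat \<Rightarrow> 'z \<Rightarrow> real) \<Rightarrow> ('l \<Rightarrow> nat \<Rightarrow> 'z \<Rightarrow> real) \<Rightarrow> nat set \<Rightarrow> 'l \<Rightarrow> nat \<Rightarrow> nat \<Rightarrow> 'z \<Rightarrow> real" where
  "hybrid \<alpha> \<beta> I j i = (if i \<in> I then \<beta> j else \<alpha> j)"

lemma hybrid_ortho: "matching_systems p K m \<alpha> \<beta> \<Longrightarrow> ortho_system p (m j) K (hybrid \<alpha> \<beta> I j i)"
  by (simp add: matching_systems_def hybrid_def)

text \<open>With all coordinates but \<open>i\<close> fixed, the exponent is
  \<open>a + \<Delta>\<close>, where \<open>a\<close> is the same for both systems and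
  \<open>\<Delta>\<close> combines nonconstant basis functions of all steps linearly. This is why
  second moments across different steps have to match. \<open>D\<close> is the part of the exponent
  that is active at \<open>i\<close>.\<close>

lemma lindeberg_step:
  fixes v :: "'l::finite \<Rightarrow> real" and c :: "'l \<Rightarrow> (nat \<Rightarrow> nat) \<Rightarrow> real"
  assumes ms: "matching_systems p K m \<alpha> \<beta>" and p: "finite (set_pmf p)"
    and A: "finite A" "i \<in> A"
  defines "G \<equiv> \<lambda>I z. \<Sum>j\<in>UNIV. v j * mpoly A (m j) (c j) (hybrid \<alpha> \<beta> I j) z"
    and "D \<equiv> \<lambda>I z. \<Sum>j\<in>UNIV. v j * mpoly A (m j) (\<lambda>\<sigma>. if \<sigma> i = 0 then 0 else c j \<sigma>) (hybrid \<alpha> \<beta> I j) z"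
  shows "cmod (expec p (\<lambda>z. iexp (G (insert i I) (w(i := z)))) - expec p (\<lambda>z. iexp (G I (w(i := z))))) \<le>
    (expec p (\<lambda>z. \<bar>D (insert i I) (w(i := z))\<bar> ^ 3) + expec p (\<lambda>z. \<bar>D I (w(i := z))\<bar> ^ 3)) / 6"
proof -
  define A' where "A' = A - {i}"
  have A': "finite A'" "i \<notin> A'" "A = insert i A'" using A by (auto simp: A'_def)
  have m: "0 < m j" for j using ms by (auto simp: matching_systems_def ortho_system_def)
  have split: "{..<m j} = insert 0 {1..<m j}" for j using m[of j] by auto
  define q where "q j a = mpoly A' (m j) (\<lambda>\<sigma>. c j (\<sigma>(i := a))) (hybrid \<alpha> \<beta> I j) w" for j a
  define \<gamma> where "\<gamma> H d = hybrid \<alpha> \<beta> H (fst d) i (snd d)" for H and d :: "'l \<times> nat"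
  define \<D> where "\<D> = Sigma UNIV (\<lambda>j. {1..<m j})"
  define \<Delta> where "\<Delta> H z = (\<Sum>d\<in>\<D>. (v (fst d) * q (fst d) (snd d)) * \<gamma> H d z)" for H z
  define a where "a = (\<Sum>j\<in>UNIV. v j * q j 0)"
  have H: "mpoly A' (m j) e (hybrid \<alpha> \<beta> H j) (w(i := z)) = mpoly A' (m j) e (hybrid \<alpha> \<beta> I j) w"
    if "H = I \<or> H = insert i I" for H j z e
    using that A' by (subst mpoly_upd) (auto simp: hybrid_def intro!: mpoly_cong)
  have Delta: "\<Delta> H z = (\<Sum>j\<in>UNIV. v j * (\<Sum>b=1..<m j. hybrid \<alpha> \<beta> H j i b z * q j b))" for H z
    unfolding \<Delta>_def \<D>_def by (simp add: sum_distrib_left sum.Sigma \<gamma>_def split_beta mult_ac)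
  have D: "D H (w(i := z)) = \<Delta> H z" if h: "H = I \<or> H = insert i I" for H z
  proof -
    have "mpoly A (m j) (\<lambda>\<sigma>. if \<sigma> i = 0 then 0 else c j \<sigma>) (hybrid \<alpha> \<beta> H j) (w(i := z)) =
      (\<Sum>b=1..<m j. hybrid \<alpha> \<beta> H j i b z * q j b)" for j
    proof -
      have z: "mpoly A' (m j) (\<lambda>\<sigma>. 0) \<xi> y = 0" for \<xi> y by (simp add: mpoly_def)
      have "mpoly A (m j) (\<lambda>\<sigma>. if \<sigma> i = 0 then 0 else c j \<sigma>) (hybrid \<alpha> \<beta> H j) (w(i := z)) =
        (\<Sum>b<m j. hybrid \<alpha> \<beta> H j i b z * mpoly A' (m j) (\<lambda>\<sigma>. if b = 0 then 0 else c j (\<sigma>(i := b))) (hybrid \<alpha> \<beta> I j) w)"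
        unfolding A'(3) mpoly_insert[OF A'(1,2)] H[OF h] by simp
      also have "\<dots> = (\<Sum>b=1..<m j. hybrid \<alpha> \<beta> H j i b z * q j b)"
        unfolding split by (simp add: z q_def)
      finally show ?thesis .
    qed
    then show ?thesis by (simp add: D_def Delta)
  qed
  have G: "G H (w(i := z)) = a + \<Delta> H z" if h: "H = I \<or> H = insert i I" and z: "z \<in> set_pmf p" for H z
  proof -
    have "hybrid \<alpha> \<beta> H j i 0 z = 1" for j
      using hybrid_ortho[OF ms, of j H i] z by (simp add: ortho_system_def)
    then have "mpoly A (m j) (c j) (hybrid \<alpha> \<beta> H j) (w(i := z)) =
      q j 0 + (\<Sum>b=1..<m j. hybrid \<alpha> \<beta> H j i b z * q j b)" for j
      unfolding A'(3) mpoly_insert[OF A'(1,2)] H[OF h] split by (simp add: q_def)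
    then show ?thesis by (simp add: G_def Delta a_def distrib_left sum.distrib)
  qed
  have mean: "expec p (\<Delta> H) = 0" for H
    unfolding \<Delta>_def expec_sum expec_cmult \<gamma>_def \<D>_def
    using ortho_system_mean[OF hybrid_ortho[OF ms]] by (intro sum.neutral) auto
  have cov: "expec p (\<lambda>z. \<gamma> H d z * \<gamma> H e z) = expec p (\<lambda>z. \<alpha> (fst d) (snd d) z * \<alpha> (fst e) (snd e) z)"
    if "d \<in> \<D>" "e \<in> \<D>" for H d e
    using ms that by (auto simp: \<gamma>_def hybrid_def matching_systems_def \<D>_def)
  have var: "expec p (\<lambda>z. (\<Delta> H z)\<^sup>2) = (\<Sum>d\<in>\<D>. \<Sum>e\<in>\<D>. (v (fst d) * q (fst d) (snd d)) * (v (fst e) * q (fst e) (snd e)) *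
      expec p (\<lambda>z. \<alpha> (fst d) (snd d) z * \<alpha> (fst e) (snd e) z))" for H
    unfolding power2_eq_square \<Delta>_def expec_bilinear by (intro sum.cong refl) (simp add: cov)
  have "expec p (\<lambda>z. iexp (G H (w(i := z)))) = expec p (\<lambda>z. iexp (a + \<Delta> H z))" if "H = I \<or> H = insert i I" for H
    using that by (intro expec_cong) (simp add: G)
  then show ?thesis
    using char_function_swap[OF p, of "\<Delta> (insert i I)" "\<Delta> I" a] by (simp add: mean var D)
qed

text \<open>The absolute value of the conditional difference stays inside the average over
  \<open>J\<close>, because the reverse Hoelder inequality will be applied separately for each
  frozen \<open>X\<close>. The coordinates in \<open>I\<close> are swapped one at a time, each swap
  being exposed by resampling.\<close>

lemma lindeberg_conditional:
  fixes v :: "'l::finite \<Rightarrow> real" and c :: "'l \<Rightarrow> (nat \<Rightarrow> nat) \<Rightarrow> real"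
  assumes ms: "matching_systems p K m \<alpha> \<beta>" and p: "finite (set_pmf p)"
    and fin: "finite J" "finite B" and disj: "J \<inter> B = {}"
  defines "A \<equiv> J \<union> B"
  defines "G \<equiv> \<lambda>I z. \<Sum>j\<in>UNIV. v j * mpoly A (m j) (c j) (hybrid \<alpha> \<beta> I j) z"
    and "D \<equiv> \<lambda>I i z. \<Sum>j\<in>UNIV. v j * mpoly A (m j) (\<lambda>\<sigma>. if \<sigma> i = 0 then 0 else c j \<sigma>) (hybrid \<alpha> \<beta> I j) z"
  assumes err: "\<And>I i. i \<in> B \<Longrightarrow> expec (iid A d p) (\<lambda>z. \<bar>D I i z\<bar> ^ 3) \<le> 3 * err i"
    and I: "I \<subseteq> B"
  shows "expec (iid J d p) (\<lambda>X. cmod (expec (iid B d p) (\<lambda>Y. iexp (G I (glue J X Y))) -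
    expec (iid B d p) (\<lambda>Y. iexp (G {} (glue J X Y))))) \<le> (\<Sum>i\<in>I. err i)"
  using finite_subset[OF I fin(2)] I
proof (induction I)
  case (insert i I)
  have i: "i \<in> B" "i \<notin> J" "i \<in> A" using insert disj by (auto simp: A_def)
  have finA: "finite A" using fin by (simp add: A_def)
  define \<Phi> where "\<Phi> I X = expec (iid B d p) (\<lambda>Y. iexp (G I (glue J X Y)))" for I X
  have step: "cmod (\<Phi> (insert i I) X - \<Phi> I X) \<le>
    expec (iid B d p) (\<lambda>Y. (\<bar>D (insert i I) i (glue J X Y)\<bar> ^ 3 + \<bar>D I i (glue J X Y)\<bar> ^ 3) / 6)" for X
  proof -
    have R: "expec (iid B d p) (\<lambda>Y. T (glue J X Y)) = expec (iid B d p) (\<lambda>Y. expec p (\<lambda>z. T ((glue J X Y)(i := z))))"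
      for T :: "_ \<Rightarrow> real"
      by (subst expec_iid_resample[OF fin(2) i(1) p]) (simp only: glue_upd[OF i(2)])
    have eq: "\<Phi> (insert i I) X - \<Phi> I X = expec (iid B d p) (\<lambda>Y.
      expec p (\<lambda>z. iexp (G (insert i I) ((glue J X Y)(i := z)))) - expec p (\<lambda>z. iexp (G I ((glue J X Y)(i := z)))))"
      unfolding \<Phi>_def by (subst (1 2) expec_iid_resample[OF fin(2) i(1) p]) (simp only: glue_upd[OF i(2)] expec_diff)
    have "cmod (\<Phi> (insert i I) X - \<Phi> I X) \<le> expec (iid B d p) (\<lambda>Y. (expec p (\<lambda>z. \<bar>D (insert i I) i ((glue J X Y)(i := z))\<bar> ^ 3) +
        expec p (\<lambda>z. \<bar>D I i ((glue J X Y)(i := z))\<bar> ^ 3)) / 6)"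
      unfolding eq unfolding G_def D_def
      by (rule order_trans[OF norm_expec]) (intro expec_mono lindeberg_step[OF ms p finA i(3)])
    also have "\<dots> = expec (iid B d p) (\<lambda>Y. (\<bar>D (insert i I) i (glue J X Y)\<bar> ^ 3 + \<bar>D I i (glue J X Y)\<bar> ^ 3) / 6)"
    proof -
      have "(expec p f + expec p g) / 6 = expec p (\<lambda>z. (f z + g z) / 6)" for f g :: "_ \<Rightarrow> real"
        by (simp add: expec_divide expec_add)
      then show ?thesis
        by (simp only: R[of "\<lambda>w. (\<bar>D (insert i I) i w\<bar> ^ 3 + \<bar>D I i w\<bar> ^ 3) / 6"])
    qed
    finally show ?thesis .
  qed
  have "expec (iid J d p) (\<lambda>X. cmod (\<Phi> (insert i I) X - \<Phi> {} X)) \<le>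
    expec (iid J d p) (\<lambda>X. cmod (\<Phi> (insert i I) X - \<Phi> I X) + cmod (\<Phi> I X - \<Phi> {} X))"
  proof (rule expec_mono)
    fix X
    show "cmod (\<Phi> (insert i I) X - \<Phi> {} X) \<le> cmod (\<Phi> (insert i I) X - \<Phi> I X) + cmod (\<Phi> I X - \<Phi> {} X)"
      using norm_triangle_ineq[of "\<Phi> (insert i I) X - \<Phi> I X" "\<Phi> I X - \<Phi> {} X"] by simp
  qed
  also have "\<dots> = expec (iid J d p) (\<lambda>X. cmod (\<Phi> (insert i I) X - \<Phi> I X)) + expec (iid J d p) (\<lambda>X. cmod (\<Phi> I X - \<Phi> {} X))"
    by (rule expec_add)
  also have "expec (iid J d p) (\<lambda>X. cmod (\<Phi> (insert i I) X - \<Phi> I X)) \<le> expec (iid J d p) (\<lambda>X.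
      expec (iid B d p) (\<lambda>Y. (\<bar>D (insert i I) i (glue J X Y)\<bar> ^ 3 + \<bar>D I i (glue J X Y)\<bar> ^ 3) / 6))"
    by (intro expec_mono step)
  also have "\<dots> = expec (iid A d p) (\<lambda>z. (\<bar>D (insert i I) i z\<bar> ^ 3 + \<bar>D I i z\<bar> ^ 3) / 6)"
    unfolding A_def by (rule expec_iid_glue[OF fin disj p, symmetric])
  \<comment> \<open>Two third moments of at most \<open>3 * err i\<close> each are divided by
    6.\<close>
  also have "\<dots> \<le> err i"
    using err[OF i(1), of "insert i I"] err[OF i(1), of I] by (simp add: expec_divide expec_add)
  also have "expec (iid J d p) (\<lambda>X. cmod (\<Phi> I X - \<Phi> {} X)) \<le> (\<Sum>i\<in>I. err i)"
    using insert unfolding \<Phi>_def by auto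
  finally show ?case using insert.hyps by (simp add: \<Phi>_def)
qed (simp add: p fin)

lemma abs_sum_cube_le:
  fixes x v :: "'l::finite \<Rightarrow> real"
  assumes v: "\<And>j. \<bar>v j\<bar> \<le> 2"
  shows "\<bar>\<Sum>j\<in>UNIV. v j * x j\<bar> ^ 3 \<le> 8 * real CARD('l) ^ 3 * (\<Sum>j\<in>UNIV. \<bar>x j\<bar> ^ 3)"
proof -
  define M where "M = (MAX j. \<bar>x j\<bar>)"
  have M: "\<bar>x j\<bar> \<le> M" for j unfolding M_def by (rule Max_ge) auto
  have "M \<in> range (\<lambda>j. \<bar>x j\<bar>)" unfolding M_def by (rule Max_in) auto
  then obtain k where k: "M = \<bar>x k\<bar>" by auto
  have "\<bar>\<Sum>j\<in>UNIV. v j * x j\<bar> \<le> (\<Sum>j\<in>UNIV. \<bar>v j * x j\<bar>)" by (rule sum_abs)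
  also have "\<dots> \<le> (\<Sum>j\<in>(UNIV :: 'l set). 2 * M)"
    unfolding abs_mult by (intro sum_mono mult_mono v M) auto
  finally have "\<bar>\<Sum>j\<in>UNIV. v j * x j\<bar> \<le> 2 * real CARD('l) * M" by simp
  then have "\<bar>\<Sum>j\<in>UNIV. v j * x j\<bar> ^ 3 \<le> (2 * real CARD('l) * M) ^ 3"
    by (intro power_mono) auto
  also have "\<dots> = 8 * real CARD('l) ^ 3 * M ^ 3" by (simp add: power_mult_distrib)
  also have "M ^ 3 \<le> (\<Sum>j\<in>UNIV. \<bar>x j\<bar> ^ 3)"
    unfolding k by (rule member_le_sum[of k UNIV "\<lambda>j. \<bar>x j\<bar> ^ 3"]) auto
  finally show ?thesis by (simp add: mult_left_mono)
qed

text \<open>The bound |x|^3 \<le> (L/2) x^2 + x^4/(2L) interpolates between the second moment s,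
  given by Parseval, and the fourth, which hypercontractivity bounds by (C^k s)^2 \<le> L^2 s. At L
  = C^k t each term contributes at most L s/2.\<close>

lemma mpoly_third_moment:
  assumes A: "finite A" and p: "finite (set_pmf p)" and o: "\<And>i. i \<in> A \<Longrightarrow> ortho_system p m K (\<xi> i)"
    and C: "4 \<le> C" "3 * K \<le> C\<^sup>2"
    and deg: "\<And>\<sigma>. \<sigma> \<in> A \<rightarrow>\<^sub>E {..<m} \<Longrightarrow> k < wt A \<sigma> \<Longrightarrow> c \<sigma> = 0"
    and t: "0 < t" "(\<Sum>\<sigma>\<in>A \<rightarrow>\<^sub>E {..<m}. (c \<sigma>)\<^sup>2) \<le> t\<^sup>2"
  shows "expec (iid A d p) (\<lambda>z. \<bar>mpoly A m c \<xi> z\<bar> ^ 3) \<le> C ^ k * t * (\<Sum>\<sigma>\<in>A \<rightarrow>\<^sub>E {..<m}. (c \<sigma>)\<^sup>2)"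
proof -
  define s where "s = (\<Sum>\<sigma>\<in>A \<rightarrow>\<^sub>E {..<m}. (c \<sigma>)\<^sup>2)"
  define F where "F = mpoly A m c \<xi>"
  define L where "L = C ^ k * t"
  have L: "0 < L" using C t by (simp add: L_def)
  have s0: "0 \<le> s" by (auto simp: s_def intro: sum_nonneg)
  have E2: "expec (iid A d p) (\<lambda>z. (F z)\<^sup>2) = s"
    unfolding F_def s_def by (rule mpoly_parseval[OF A p o])
  have "(\<Sum>\<sigma>\<in>A \<rightarrow>\<^sub>E {..<m}. C ^ wt A \<sigma> * (c \<sigma>)\<^sup>2) \<le> (\<Sum>\<sigma>\<in>A \<rightarrow>\<^sub>E {..<m}. C ^ k * (c \<sigma>)\<^sup>2)"
  proof (intro sum_mono)
    fix \<sigma> assume "\<sigma> \<in> A \<rightarrow>\<^sub>E {..<m}"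
    then show "C ^ wt A \<sigma> * (c \<sigma>)\<^sup>2 \<le> C ^ k * (c \<sigma>)\<^sup>2"
      using deg[of \<sigma>] C by (cases "k < wt A \<sigma>") (auto intro!: mult_right_mono power_increasing)
  qed
  also have "\<dots> = C ^ k * s" by (simp add: s_def sum_distrib_left)
  finally have le: "(\<Sum>\<sigma>\<in>A \<rightarrow>\<^sub>E {..<m}. C ^ wt A \<sigma> * (c \<sigma>)\<^sup>2)\<^sup>2 \<le> (C ^ k * s)\<^sup>2"
    using C by (intro power_mono sum_nonneg) auto
  have "expec (iid A d p) (\<lambda>z. F z ^ 4) \<le> (\<Sum>\<sigma>\<in>A \<rightarrow>\<^sub>E {..<m}. C ^ wt A \<sigma> * (c \<sigma>)\<^sup>2)\<^sup>2"
    unfolding F_def by (rule mpoly_hypercontractive[OF A p o C])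
 also note le
  also have "(C ^ k * s)\<^sup>2 = (C ^ k)\<^sup>2 * s * s" by (simp add: power2_eq_square)
  also have "\<dots> \<le> (C ^ k)\<^sup>2 * s * t\<^sup>2"
    using t s0 by (intro mult_left_mono) (auto simp: s_def)
  also have "\<dots> = L\<^sup>2 * s" by (simp add: L_def power_mult_distrib)
  finally have E4: "expec (iid A d p) (\<lambda>z. F z ^ 4) \<le> L\<^sup>2 * s" .
  have pt: "\<bar>x\<bar> ^ 3 \<le> L / 2 * x\<^sup>2 + 1 / (2 * L) * x ^ 4" for x :: real
  proof -
    have "0 \<le> x\<^sup>2 * (L - \<bar>x\<bar>)\<^sup>2 / (2 * L)" using L by simp
    also have "x\<^sup>2 * (L - \<bar>x\<bar>)\<^sup>2 = L\<^sup>2 * x\<^sup>2 + x ^ 4 - 2 * L * \<bar>x\<bar> ^ 3"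
    proof -
      have "x\<^sup>2 * (L - \<bar>x\<bar>)\<^sup>2 = \<bar>x\<bar>\<^sup>2 * (L - \<bar>x\<bar>)\<^sup>2" by simp
      also have "\<dots> = L\<^sup>2 * \<bar>x\<bar>\<^sup>2 + \<bar>x\<bar> ^ 4 - 2 * L * \<bar>x\<bar> ^ 3"
        by (simp only: power2_eq_square power3_eq_cube power4_eq_xxxx) algebra
      finally show ?thesis by simp
    qed
    finally show ?thesis using L by (simp add: field_simps power2_eq_square)
  qed
  have "expec (iid A d p) (\<lambda>z. \<bar>F z\<bar> ^ 3) \<le> expec (iid A d p) (\<lambda>z. L / 2 * (F z)\<^sup>2 + 1 / (2 * L) * F z ^ 4)"
    by (intro expec_mono pt)
  also have "\<dots> = L / 2 * s + 1 / (2 * L) * expec (iid A d p) (\<lambda>z. F z ^ 4)"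
    by (simp only: expec_add expec_cmult E2)
  also have "\<dots> \<le> L / 2 * s + 1 / (2 * L) * (L\<^sup>2 * s)"
    using E4 L by (intro add_left_mono mult_left_mono) auto
  also have "\<dots> = L * s" using L by (simp add: power2_eq_square)
  finally show ?thesis by (simp add: F_def L_def s_def)
qed

definition influence :: "nat set \<Rightarrow> nat \<Rightarrow> ((nat \<Rightarrow> nat) \<Rightarrow> real) \<Rightarrow> nat \<Rightarrow> real" where
  "influence A m c i = (\<Sum>\<sigma>\<in>A \<rightarrow>\<^sub>E {..<m}. if \<sigma> i = 0 then 0 else (c \<sigma>)\<^sup>2)"

text \<open>Exchanging the sums counts each \<open>\<sigma>\<close> once per active coordinate,
  hence at most \<open>k\<close> times when its coefficient is nonzero.\<close>

lemma sum_influence_le: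
  assumes A: "finite A" and deg: "\<And>\<sigma>. \<sigma> \<in> A \<rightarrow>\<^sub>E {..<m} \<Longrightarrow> k < wt A \<sigma> \<Longrightarrow> c \<sigma> = 0"
    and c1: "(\<Sum>\<sigma>\<in>A \<rightarrow>\<^sub>E {..<m}. (c \<sigma>)\<^sup>2) \<le> 1" and B: "B \<subseteq> A"
  shows "(\<Sum>i\<in>B. influence A m c i) \<le> k"
proof -
  have "(\<Sum>i\<in>B. influence A m c i) \<le> (\<Sum>i\<in>A. influence A m c i)"
    using A B by (intro sum_mono2) (auto simp: influence_def intro!: sum_nonneg)
  also have "\<dots> = (\<Sum>\<sigma>\<in>A \<rightarrow>\<^sub>E {..<m}. \<Sum>i\<in>A. if \<sigma> i = 0 then 0 else (c \<sigma>)\<^sup>2)"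
    unfolding influence_def by (rule sum.swap)
  also have "\<dots> = (\<Sum>\<sigma>\<in>A \<rightarrow>\<^sub>E {..<m}. wt A \<sigma> * (c \<sigma>)\<^sup>2)"
  proof (intro sum.cong refl)
    fix \<sigma>
    have "(\<Sum>i\<in>A. if \<sigma> i = 0 then 0 else (c \<sigma>)\<^sup>2) = (\<Sum>i\<in>{i\<in>A. \<sigma> i \<noteq> 0}. (c \<sigma>)\<^sup>2)"
      using A by (intro sum.mono_neutral_cong_right) auto
    then show "(\<Sum>i\<in>A. if \<sigma> i = 0 then 0 else (c \<sigma>)\<^sup>2) = wt A \<sigma> * (c \<sigma>)\<^sup>2"
      by (simp add: wt_def)
  qed
  also have "\<dots> \<le> (\<Sum>\<sigma>\<in>A \<rightarrow>\<^sub>E {..<m}. k * (c \<sigma>)\<^sup>2)"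
  proof (intro sum_mono)
    fix \<sigma> assume "\<sigma> \<in> A \<rightarrow>\<^sub>E {..<m}"
    then show "wt A \<sigma> * (c \<sigma>)\<^sup>2 \<le> k * (c \<sigma>)\<^sup>2"
      using deg[of \<sigma>] by (cases "k < wt A \<sigma>") (auto intro!: mult_right_mono)
  qed
  also have "\<dots> \<le> k" using mult_left_mono[OF c1, of "real k"] by (simp add: sum_distrib_left)
  finally show ?thesis .
qed

text \<open>Characters are compared one by one and recombined with coefficients of total absolute
  value 1. The third moments are at most C^k t times the influences, whose sum is at most
  \<open>k\<close> per step, so the total error is of order t however many coordinates are
  replaced.\<close>

lemma invariance_conditional:
  fixes S :: "'l::finite set"
  assumes ms: "matching_systems p K m \<alpha> \<beta>" and p: "finite (set_pmf p)"
    and C: "4 \<le> C" "3 * K \<le> C\<^sup>2"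
    and fin: "finite J" "finite B" and disj: "J \<inter> B = {}"
  defines "A \<equiv> J \<union> B"
  assumes deg: "\<And>j \<sigma>. \<sigma> \<in> A \<rightarrow>\<^sub>E {..<m j} \<Longrightarrow> k < wt A \<sigma> \<Longrightarrow> c j \<sigma> = 0"
    and c1: "\<And>j. (\<Sum>\<sigma>\<in>A \<rightarrow>\<^sub>E {..<m j}. (c j \<sigma>)\<^sup>2) \<le> 1"
    and t: "0 < t" and infl: "\<And>j i. i \<in> B \<Longrightarrow> influence A (m j) (c j) i \<le> t\<^sup>2"
  shows "expec (iid J d p) (\<lambda>X. \<bar>
      expec (iid B d p) (\<lambda>Y. \<Prod>j\<in>S. (sin (mpoly A (m j) (c j) (hybrid \<alpha> \<beta> B j) (glue J X Y)))\<^sup>2) -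
      expec (iid B d p) (\<lambda>Y. \<Prod>j\<in>S. (sin (mpoly A (m j) (c j) (hybrid \<alpha> \<beta> {} j) (glue J X Y)))\<^sup>2)\<bar>)
    \<le> 3 * real CARD('l) ^ 4 * C ^ k * k * t"
proof -
  have finA: "finite A" using fin by (simp add: A_def)
  define L where "L = real CARD('l)"
  \<comment> \<open>The cube of the sum over the steps contributes 8 L^3, and
    \<open>lindeberg_conditional\<close> allows three times \<open>err i\<close>; the resulting 8/3
    is rounded up to 3.\<close>
  define err where "err i = 3 * L ^ 3 * (C ^ k * t) * (\<Sum>j\<in>UNIV. influence A (m j) (c j) i)" for i
  have pos: "0 \<le> 3 * L ^ 3 * (C ^ k * t)" using C t by (simp add: L_def)
  have infl0: "0 \<le> influence A (m j) (c j) i" for i j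
    by (auto simp: influence_def intro!: sum_nonneg)
  have err_sum: "(\<Sum>i\<in>B. err i) \<le> 3 * L ^ 4 * C ^ k * k * t"
  proof -
    have "(\<Sum>i\<in>B. err i) = 3 * L ^ 3 * (C ^ k * t) * (\<Sum>j\<in>UNIV. \<Sum>i\<in>B. influence A (m j) (c j) i)"
      unfolding err_def sum_distrib_left[symmetric] by (subst sum.swap) simp
    also have "\<dots> \<le> 3 * L ^ 3 * (C ^ k * t) * (\<Sum>j\<in>(UNIV :: 'l set). real k)"
      by (intro mult_left_mono[OF _ pos] sum_mono sum_influence_le[OF finA deg c1]) (auto simp: A_def)
    also have "\<dots> = 3 * L ^ 4 * C ^ k * k * t"
      by (simp add: L_def power3_eq_cube power4_eq_xxxx)
    finally show ?thesis .
  qed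
  have third: "expec (iid A d p) (\<lambda>z. \<bar>\<Sum>j\<in>UNIV. v j * mpoly A (m j) (\<lambda>\<sigma>. if \<sigma> i = 0 then 0 else c j \<sigma>) (hybrid \<alpha> \<beta> I j) z\<bar> ^ 3)
      \<le> 3 * err i" if v: "\<And>j. \<bar>v j\<bar> \<le> 2" and i: "i \<in> B" for v :: "'l \<Rightarrow> real" and I i
  proof -
    define F where "F j = mpoly A (m j) (\<lambda>\<sigma>. if \<sigma> i = 0 then 0 else c j \<sigma>) (hybrid \<alpha> \<beta> I j)" for j
    have inf: "(\<Sum>\<sigma>\<in>A \<rightarrow>\<^sub>E {..<m j}. (if \<sigma> i = 0 then 0 else c j \<sigma>)\<^sup>2) = influence A (m j) (c j) i" for j
      unfolding influence_def by (intro sum.cong) auto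
    have F: "expec (iid A d p) (\<lambda>z. \<bar>F j z\<bar> ^ 3) \<le> C ^ k * t * influence A (m j) (c j) i" for j
      unfolding F_def inf[symmetric]
      by (rule mpoly_third_moment[OF finA p hybrid_ortho[OF ms] C]) (use deg infl[OF i] t inf in auto)
    have "expec (iid A d p) (\<lambda>z. \<bar>\<Sum>j\<in>UNIV. v j * F j z\<bar> ^ 3) \<le>
      expec (iid A d p) (\<lambda>z. 8 * L ^ 3 * (\<Sum>j\<in>UNIV. \<bar>F j z\<bar> ^ 3))"
      unfolding L_def by (intro expec_mono abs_sum_cube_le v)
    also have "\<dots> = 8 * L ^ 3 * (\<Sum>j\<in>UNIV. expec (iid A d p) (\<lambda>z. \<bar>F j z\<bar> ^ 3))"
      by (simp only: expec_cmult expec_sum)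
    also have "\<dots> \<le> 8 * L ^ 3 * (\<Sum>j\<in>UNIV. C ^ k * t * influence A (m j) (c j) i)"
      by (intro mult_left_mono sum_mono F) (simp add: L_def)
    also have "\<dots> = 8 / 3 * err i" by (simp add: err_def sum_distrib_left mult_ac)
    also have "\<dots> \<le> 3 * err i"
    proof -
      have "0 \<le> err i" unfolding err_def by (intro mult_nonneg_nonneg[OF pos] sum_nonneg infl0)
      then show ?thesis by simp
    qed
    finally show ?thesis by (simp add: F_def)
  qed
  obtain W :: "('l \<Rightarrow> real) set" and e where W: "finite W" "\<And>v j. v \<in> W \<Longrightarrow> \<bar>v j\<bar> \<le> 2" "(\<Sum>v\<in>W. \<bar>e v\<bar>) = 1"
    and exp: "\<And>x. complex_of_real (\<Prod>j\<in>S. (sin (x j))\<^sup>2) = (\<Sum>v\<in>W. complex_of_real (e v) * iexp (\<Sum>j\<in>UNIV. v j * x j))"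
    by (rule prod_sin_square_expansion[of S]) (rule that)
  define M where "M I j = mpoly A (m j) (c j) (hybrid \<alpha> \<beta> I j)" for I j
  define \<Phi> where "\<Phi> v I X = expec (iid B d p) (\<lambda>Y. iexp (\<Sum>j\<in>UNIV. v j * M I j (glue J X Y)))" for v I X
  define \<Psi> where "\<Psi> I X = expec (iid B d p) (\<lambda>Y. \<Prod>j\<in>S. (sin (M I j (glue J X Y)))\<^sup>2)" for I X
  have \<Psi>: "complex_of_real (\<Psi> I X) = (\<Sum>v\<in>W. complex_of_real (e v) * \<Phi> v I X)" for I X
    unfolding \<Psi>_def \<Phi>_def by (simp only: expec_of_real[symmetric] exp expec_sum expec_cmult)
  have diff: "\<bar>\<Psi> B X - \<Psi> {} X\<bar> \<le> (\<Sum>v\<in>W. \<bar>e v\<bar> * cmod (\<Phi> v B X - \<Phi> v {} X))" for X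
  proof -
    have "\<bar>\<Psi> B X - \<Psi> {} X\<bar> = cmod (complex_of_real (\<Psi> B X) - complex_of_real (\<Psi> {} X))"
      by (simp flip: of_real_diff)
    also have "\<dots> = cmod (\<Sum>v\<in>W. complex_of_real (e v) * (\<Phi> v B X - \<Phi> v {} X))"
      unfolding \<Psi> by (simp add: sum_subtractf right_diff_distrib)
    also have "\<dots> \<le> (\<Sum>v\<in>W. \<bar>e v\<bar> * cmod (\<Phi> v B X - \<Phi> v {} X))"
      by (rule order_trans[OF norm_sum]) (simp add: norm_mult)
    finally show ?thesis .
  qed
  have "expec (iid J d p) (\<lambda>X. \<bar>\<Psi> B X - \<Psi> {} X\<bar>) \<le>
    (\<Sum>v\<in>W. \<bar>e v\<bar> * expec (iid J d p) (\<lambda>X. cmod (\<Phi> v B X - \<Phi> v {} X)))"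
    using expec_mono[of "iid J d p", OF diff] by (simp only: expec_sum expec_cmult)
  also have "\<dots> \<le> (\<Sum>v\<in>W. \<bar>e v\<bar> * (\<Sum>i\<in>B. err i))"
    unfolding \<Phi>_def M_def A_def
    by (intro sum_mono mult_left_mono lindeberg_conditional[OF ms p fin disj]) (use third W(2) in \<open>auto simp: A_def\<close>)
  also have "\<dots> = (\<Sum>i\<in>B. err i)" by (simp add: W(3) flip: sum_distrib_right)
  finally show ?thesis using err_sum by (simp add: \<Psi>_def M_def L_def)
qed

section \<open>Correlation and noise\<close>

lemma expec_marginal:
  fixes P :: "('l::finite \<Rightarrow> 'w::finite) pmf"
  shows "expec (marginal P j) f = expec P (\<lambda>X. f (X j))"
  unfolding marginal_def by (rule expec_map_pmf) simp

lemma fourier_basis_expec: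
  fixes P :: "('l::finite \<Rightarrow> 'w::finite) pmf"
  assumes "fourier_basis (marginal P j) m \<phi>" "a < m" "b < m"
  shows "expec (marginal P j) (\<lambda>x. \<phi> a x * \<phi> b x) = (if a = b then 1 else 0)"
  using assms by (simp add: fourier_basis_def flip: expec_eq_expectation)

text \<open>Bessel's inequality for the indicator of \<open>x\<close>, whose coefficients are \<pi>
  \<phi>_a(x) and whose squared norm is \<pi>. Here \<open>g\<close> is its projection.\<close>

lemma fourier_basis_bessel:
  fixes P :: "('l::finite \<Rightarrow> 'w::finite) pmf"
  assumes b: "fourier_basis (marginal P j) m \<phi>" and x: "x \<in> set_pmf (marginal P j)"
  shows "(\<Sum>a<m. (\<phi> a x)\<^sup>2) \<le> 1 / pmf (marginal P j) x"
proof -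
  define q where "q = marginal P j"
  define \<pi> where "\<pi> = pmf q x"
  have \<pi>: "0 < \<pi>" using x by (simp add: \<pi>_def q_def pmf_positive)
  have point: "expec q (\<lambda>y. of_bool (y = x) * f y) = \<pi> * f x" for f :: "'w \<Rightarrow> real"
  proof -
    have "expec q (\<lambda>y. of_bool (y = x) * f y) = (\<Sum>y\<in>set_pmf q. if y = x then \<pi> * f x else 0)"
      unfolding expec_def by (intro sum.cong) (auto simp: \<pi>_def)
    then show ?thesis using x by (simp add: q_def)
  qed
  define T where "T = (\<Sum>a<m. (\<phi> a x)\<^sup>2)"
  define g where "g y = (\<Sum>a<m. \<pi> * \<phi> a x * \<phi> a y)" for y
  have "expec q (\<lambda>y. of_bool (y = x) * g y) = \<pi>\<^sup>2 * T"
    unfolding point by (simp add: g_def T_def sum_distrib_left power2_eq_square mult_ac)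
  moreover have "expec q (\<lambda>y. g y * g y) = \<pi>\<^sup>2 * T"
  proof -
    have "expec q (\<lambda>y. g y * g y) = (\<Sum>a<m. \<Sum>b<m. (\<pi> * \<phi> a x) * (\<pi> * \<phi> b x) * (if a = b then 1 else 0))"
      unfolding g_def expec_bilinear using fourier_basis_expec[OF b] by (intro sum.cong refl) (auto simp: q_def)
    also have "\<dots> = (\<Sum>a<m. (\<pi> * \<phi> a x) * (\<pi> * \<phi> a x))"
      by (simp add: if_distrib cong: if_cong)
    finally show ?thesis by (simp add: T_def sum_distrib_left power2_eq_square mult_ac)
  qed
  moreover have "expec q (\<lambda>y. of_bool (y = x) * of_bool (y = x)) = \<pi>"
    unfolding point by simp
  moreover have "0 \<le> expec q (\<lambda>y. (of_bool (y = x) - g y)\<^sup>2)"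
    by (rule expec_square_nonneg)
  moreover have "expec q (\<lambda>y. (of_bool (y = x) - g y)\<^sup>2) =
    expec q (\<lambda>y. of_bool (y = x) * of_bool (y = x) - 2 * (of_bool (y = x) * g y) + g y * g y)"
    by (intro expec_cong) (simp add: power2_eq_square algebra_simps)
  ultimately have "0 \<le> \<pi> - \<pi>\<^sup>2 * T" by (simp add: expec_add expec_diff expec_cmult mult.commute)
  then have "\<pi> * (\<pi> * T) \<le> \<pi> * 1" by (simp add: power2_eq_square mult_ac)
  then have "\<pi> * T \<le> 1" using \<pi> by simp
  then show ?thesis using \<pi> by (simp add: T_def \<pi>_def q_def field_simps)
qed

text \<open>Averaging the Bessel bound: each basis function contributes 1 on one side, each point of
  the support 1 on the other. This removes \<open>m\<close> from the later constants.\<close>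

lemma fourier_basis_size:
  fixes P :: "('l::finite \<Rightarrow> 'w::finite) pmf"
  assumes b: "fourier_basis (marginal P j) m \<phi>"
  shows "m \<le> CARD('w)"
proof -
  define q where "q = marginal P j"
  have "real m = (\<Sum>a<m. expec q (\<lambda>x. \<phi> a x * \<phi> a x))"
    using fourier_basis_expec[OF b] by (simp add: q_def)
  also have "\<dots> = expec q (\<lambda>x. \<Sum>a<m. \<phi> a x * \<phi> a x)" by (simp add: expec_sum)
  also have "\<dots> = (\<Sum>x\<in>set_pmf q. pmf q x * (\<Sum>a<m. (\<phi> a x)\<^sup>2))"
    by (simp add: expec_def power2_eq_square)
  also have "\<dots> \<le> (\<Sum>x\<in>set_pmf q. pmf q x * (1 / pmf q x))"
    unfolding q_def by (intro sum_mono mult_left_mono fourier_basis_bessel[OF b]) auto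
  also have "\<dots> = (\<Sum>x\<in>set_pmf q. 1)"
    by (intro sum.cong) (auto simp: set_pmf_iff)
  also have "\<dots> \<le> real CARD('w)" by (simp add: card_mono)
  finally show ?thesis by simp
qed

lemma sum_of_bool_eq:
  fixes f :: "'w::finite \<Rightarrow> real"
  shows "(\<Sum>x\<in>UNIV. f x * of_bool (y = x)) = f y"
proof -
  have "(\<Sum>x\<in>UNIV. f x * of_bool (y = x)) = (\<Sum>x\<in>UNIV. if y = x then f x else 0)"
    by (intro sum.cong) auto
  then show ?thesis by simp
qed

text \<open>The constants of the theorem are chosen before the Fourier basis, so the bound refers to
  \<open>P\<close> alone.\<close>

definition basis_bound :: "('l::finite \<Rightarrow> 'w::finite) pmf \<Rightarrow> real" where
  "basis_bound P = (\<Sum>j\<in>UNIV. \<Sum>x\<in>set_pmf (marginal P j). 1 / pmf (marginal P j) x)"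

lemma basis_bound_ge:
  assumes "fourier_basis (marginal P j) m \<phi>"
  shows "(\<Sum>x\<in>set_pmf (marginal P j). \<Sum>a<m. (\<phi> a x)\<^sup>2) \<le> basis_bound P"
proof -
  have "(\<Sum>x\<in>set_pmf (marginal P j). \<Sum>a<m. (\<phi> a x)\<^sup>2) \<le> (\<Sum>x\<in>set_pmf (marginal P j). 1 / pmf (marginal P j) x)"
    by (intro sum_mono fourier_basis_bessel[OF assms])
  also have "\<dots> \<le> basis_bound P"
    unfolding basis_bound_def
    by (rule member_le_sum[of j UNIV "\<lambda>j. \<Sum>x\<in>set_pmf (marginal P j). 1 / pmf (marginal P j) x"])
       (auto intro!: sum_nonneg)
  finally show ?thesis .
qed

text \<open>\<open>W j f\<close> extends the replacement of indicators linearly to functions of step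
  \<open>j\<close>, so all first and second moments match (\<open>W1\<close>, \<open>W2\<close>).
  Identities that hold in mean square therefore carry over pointwise on the support of
  \<open>Q\<close>: \<open>W j\<close> maps 1 to 1, and \<open>w j x\<close> vanishes for
  \<open>x\<close> outside the support of step \<open>j\<close>. The former gives the constant
  function at index 0; the latter confines the sums to the support, where \<open>basis_bound\<close>
  is available.\<close>

lemma matching_systems_exist:
  fixes P :: "('l::finite \<Rightarrow> 'w::finite) pmf"
  assumes \<rho>: "max_corr P \<le> \<rho>" "0 < \<rho>" "\<rho> < 1"
  obtains Q :: "('l \<Rightarrow> bool \<times> 'l \<times> 'w) pmf" and w :: "'l \<Rightarrow> 'w \<Rightarrow> bool \<times> 'l \<times> 'w \<Rightarrow> real" and b :: nat and K :: real
  where "finite (set_pmf Q)" "0 \<le> K"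
    and "0 < b" "reverse_hoelder Q (\<lambda>j r. r j) b"
    and "\<forall>m \<phi>. (\<forall>j. fourier_basis (marginal P j) (m j) (\<phi> j)) \<longrightarrow>
      matching_systems (pair_pmf P Q) K m (\<lambda>j a z. \<phi> j a (fst z j)) (\<lambda>j a z. \<Sum>x\<in>UNIV. w j x (snd z j) * \<phi> j a x)"
proof -
  obtain Q :: "('l \<Rightarrow> bool \<times> 'l \<times> 'w) pmf" and w :: "'l \<Rightarrow> 'w \<Rightarrow> bool \<times> 'l \<times> 'w \<Rightarrow> real" and b :: nat
    where finQ: "finite (set_pmf Q)"
    and E1: "\<And>j x. expec Q (\<lambda>r. w j x (r j)) = expec P (\<lambda>X. of_bool (X j = x))"
    and E2: "\<And>j x k y. expec Q (\<lambda>r. w j x (r j) * w k y (r k)) = expec P (\<lambda>X. of_bool (X j = x) * of_bool (X k = y))"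
    and b: "0 < b" and rev: "reverse_hoelder Q (\<lambda>j r. r j) b"
    by (rule matching_ensemble[OF \<rho>]) (rule that)
  have finP: "finite (set_pmf P)" by simp
  define W where "W j f r = (\<Sum>x\<in>UNIV. f x * w j x (r j))" for j f and r :: "'l \<Rightarrow> bool \<times> 'l \<times> 'w"
  have W1: "expec Q (W j f) = expec P (\<lambda>X. f (X j))" for j f
  proof -
    have "expec Q (W j f) = (\<Sum>x\<in>UNIV. f x * expec P (\<lambda>X. of_bool (X j = x)))"
      unfolding W_def[abs_def] by (simp add: expec_sum expec_cmult E1)
    also have "\<dots> = expec P (\<lambda>X. \<Sum>x\<in>UNIV. f x * of_bool (X j = x))"
      by (simp only: expec_sum expec_cmult)
    finally show ?thesis by (simp only: sum_of_bool_eq)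
  qed
  have W2: "expec Q (\<lambda>r. W j f r * W k g r) = expec P (\<lambda>X. f (X j) * g (X k))" for j k f g
  proof -
    have "expec Q (\<lambda>r. W j f r * W k g r) =
      (\<Sum>x\<in>UNIV. \<Sum>y\<in>UNIV. f x * g y * expec P (\<lambda>X. of_bool (X j = x) * of_bool (X k = y)))"
      unfolding W_def expec_bilinear by (simp add: E2)
    also have "\<dots> = expec P (\<lambda>X. (\<Sum>x\<in>UNIV. f x * of_bool (X j = x)) * (\<Sum>y\<in>UNIV. g y * of_bool (X k = y)))"
      by (rule expec_bilinear[symmetric])
    finally show ?thesis by (simp only: sum_of_bool_eq)
  qed
  have W0: "W j f r = 0" if "expec P (\<lambda>X. (f (X j))\<^sup>2) = 0" "r \<in> set_pmf Q" for j f r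
  proof -
    have "expec Q (\<lambda>r. (W j f r)\<^sup>2) = 0"
      using that(1) by (simp add: power2_eq_square W2)
    then have "(W j f r)\<^sup>2 = 0" using that(2) finQ by (intro expec_eq_0D[of Q "\<lambda>r. (W j f r)\<^sup>2"]) auto
    then show ?thesis by simp
  qed
  have supp: "w j x (r j) = 0" if "x \<notin> set_pmf (marginal P j)" "r \<in> set_pmf Q" for j x r
  proof -
    have "expec P (\<lambda>X. (of_bool (x = X j) :: real)\<^sup>2) = expec P (\<lambda>X. 0)"
      using that(1) by (intro expec_cong) (auto simp: marginal_def)
    then have "W j (\<lambda>y. of_bool (x = y)) r = 0" using that(2) by (intro W0) (simp_all add: finP)
    then show ?thesis
      using sum_of_bool_eq[of "\<lambda>y. w j y (r j)" x] by (simp only: W_def mult.commute[of "of_bool _"])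
  qed
  have one: "W j (\<lambda>_. 1) r = 1" if "r \<in> set_pmf Q" for j r
  proof -
    have "expec Q (\<lambda>r. (W j (\<lambda>_. 1) r - 1)\<^sup>2) = 0"
    proof -
      have "expec Q (\<lambda>r. (W j (\<lambda>_. 1) r - 1)\<^sup>2) = expec Q (\<lambda>r. W j (\<lambda>_. 1) r * W j (\<lambda>_. 1) r - 2 * W j (\<lambda>_. 1) r + 1)"
        by (intro expec_cong) (simp add: power2_eq_square algebra_simps)
      then show ?thesis
        by (simp add: expec_add expec_diff expec_cmult W1 W2 finP finQ)
    qed
    then have "(W j (\<lambda>_. 1) r - 1)\<^sup>2 = 0"
      using that finQ by (intro expec_eq_0D[of Q "\<lambda>r. (W j (\<lambda>_. 1) r - 1)\<^sup>2"]) auto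
    then show ?thesis by simp
  qed
  define L where "L = 1 + (\<Sum>r\<in>set_pmf Q. \<Sum>j\<in>UNIV. \<Sum>x\<in>UNIV. (w j x (r j))\<^sup>2)"
  have L1: "1 \<le> L" by (auto simp: L_def intro!: sum_nonneg)
  have L: "(\<Sum>x\<in>S. (w j x (r j))\<^sup>2) \<le> L" if "r \<in> set_pmf Q" for j r S
  proof -
    have "(\<Sum>x\<in>S. (w j x (r j))\<^sup>2) \<le> (\<Sum>x\<in>UNIV. (w j x (r j))\<^sup>2)" by (intro sum_mono2) auto
    also have "\<dots> \<le> (\<Sum>j\<in>UNIV. \<Sum>x\<in>UNIV. (w j x (r j))\<^sup>2)"
      by (rule member_le_sum[of j UNIV "\<lambda>j. \<Sum>x\<in>UNIV. (w j x (r j))\<^sup>2"]) (auto intro!: sum_nonneg)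
    also have "\<dots> \<le> (\<Sum>r\<in>set_pmf Q. \<Sum>j\<in>UNIV. \<Sum>x\<in>UNIV. (w j x (r j))\<^sup>2)"
      using that finQ by (intro member_le_sum[of r _ "\<lambda>r. \<Sum>j\<in>UNIV. \<Sum>x\<in>UNIV. (w j x (r j))\<^sup>2"]) (auto intro!: sum_nonneg)
    finally show ?thesis by (simp add: L_def)
  qed
  have B0: "0 \<le> basis_bound P" by (auto simp: basis_bound_def intro!: sum_nonneg)
  \<comment> \<open>By Cauchy-Schwarz the replaced system is bounded by the squared length
    \<open>L\<close> of the vector \<open>w\<close> times the bound for the basis. As 1 \<le>
    \<open>L\<close>, the same \<open>K\<close> serves the original system.\<close>
  define K where "K = L * basis_bound P"
  have K0: "0 \<le> K" using L1 B0 by (simp add: K_def)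
  have BK: "basis_bound P \<le> K" using L1 B0 mult_right_mono[of 1 L "basis_bound P"] by (simp add: K_def)
  show thesis
  proof (rule that[OF finQ K0 b rev], intro allI impI)
    fix m :: "'l \<Rightarrow> nat" and \<phi> :: "'l \<Rightarrow> nat \<Rightarrow> 'w \<Rightarrow> real"
    assume "\<forall>j. fourier_basis (marginal P j) (m j) (\<phi> j)"
    then have fb: "\<And>j. fourier_basis (marginal P j) (m j) (\<phi> j)" by blast
    define \<alpha> where "\<alpha> j a z = \<phi> j a (fst z j)" for j a and z :: "('l \<Rightarrow> 'w) \<times> ('l \<Rightarrow> bool \<times> 'l \<times> 'w)"
    define \<beta> where "\<beta> j a z = (\<Sum>x\<in>UNIV. w j x (snd z j) * \<phi> j a x)" for j a and z :: "('l \<Rightarrow> 'w) \<times> ('l \<Rightarrow> bool \<times> 'l \<times> 'w)"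
    have \<beta>W: "\<beta> j a z = W j (\<phi> j a) (snd z)" for j a z
      by (simp add: \<beta>_def W_def mult.commute)
    have fst_E: "expec (pair_pmf P Q) (\<lambda>z. f (fst z)) = expec P f" for f :: "_ \<Rightarrow> real"
      by (simp add: expec_pair_pmf finP finQ)
    have snd_E: "expec (pair_pmf P Q) (\<lambda>z. f (snd z)) = expec Q f" for f :: "_ \<Rightarrow> real"
      by (simp add: expec_pair_pmf finP finQ)
    have \<alpha>\<alpha>: "expec (pair_pmf P Q) (\<lambda>z. \<alpha> j a z * \<alpha> k c z) = expec P (\<lambda>X. \<phi> j a (X j) * \<phi> k c (X k))" for j k a c
      unfolding \<alpha>_def by (rule fst_E)
    have \<beta>\<beta>: "expec (pair_pmf P Q) (\<lambda>z. \<beta> j a z * \<beta> k c z) = expec P (\<lambda>X. \<phi> j a (X j) * \<phi> k c (X k))" for j k a c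
      unfolding \<beta>W W2[symmetric] by (rule snd_E)
    have orth: "expec P (\<lambda>X. \<phi> j a (X j) * \<phi> j c (X j)) = (if a = c then 1 else 0)" if "a < m j" "c < m j" for j a c
      using fourier_basis_expec[OF fb that] by (simp add: expec_marginal)
    have m: "0 < m j" and \<phi>0: "x \<in> set_pmf (marginal P j) \<Longrightarrow> \<phi> j 0 x = 1" for j x
      using fb[of j] by (auto simp: fourier_basis_def)
    have "ortho_system (pair_pmf P Q) (m j) K (\<alpha> j)" for j
      unfolding ortho_system_def
    proof (intro conjI ballI allI impI m)
      fix z assume "z \<in> set_pmf (pair_pmf P Q)"
      then have x: "fst z j \<in> set_pmf (marginal P j)" by (auto simp: marginal_def)
      then show "\<alpha> j 0 z = 1" by (simp add: \<alpha>_def \<phi>0)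
      have "(\<Sum>a<m j. (\<alpha> j a z)\<^sup>2) \<le> (\<Sum>x\<in>set_pmf (marginal P j). \<Sum>a<m j. (\<phi> j a x)\<^sup>2)"
        unfolding \<alpha>_def using x by (intro member_le_sum[of "fst z j"]) (auto intro!: sum_nonneg)
      also have "\<dots> \<le> K" using basis_bound_ge[OF fb] BK by (rule order_trans)
      finally show "(\<Sum>a<m j. (\<alpha> j a z)\<^sup>2) \<le> K" .
    qed (simp add: \<alpha>\<alpha> orth)
    moreover have "ortho_system (pair_pmf P Q) (m j) K (\<beta> j)" for j
      unfolding ortho_system_def
    proof (intro conjI ballI allI impI m)
      fix z assume "z \<in> set_pmf (pair_pmf P Q)"
      then have r: "snd z \<in> set_pmf Q" by auto
      define S where "S = set_pmf (marginal P j)"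
      have \<beta>S: "\<beta> j a z = (\<Sum>x\<in>S. w j x (snd z j) * \<phi> j a x)" for a
        unfolding \<beta>_def S_def using supp[OF _ r] by (intro sum.mono_neutral_right) auto
      have "\<beta> j 0 z = (\<Sum>x\<in>S. w j x (snd z j))"
        unfolding \<beta>S by (intro sum.cong) (auto simp: S_def \<phi>0)
      also have "\<dots> = (\<Sum>x\<in>UNIV. w j x (snd z j))"
        unfolding S_def using supp[OF _ r] by (intro sum.mono_neutral_left) auto
      also have "\<dots> = 1" using one[OF r, of j] by (simp add: W_def)
      finally show "\<beta> j 0 z = 1" .
      have "(\<Sum>a<m j. (\<beta> j a z)\<^sup>2) \<le> (\<Sum>a<m j. L * (\<Sum>x\<in>S. (\<phi> j a x)\<^sup>2))"
      proof (intro sum_mono)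
        fix a
        have "(\<beta> j a z)\<^sup>2 \<le> (\<Sum>x\<in>S. (w j x (snd z j))\<^sup>2) * (\<Sum>x\<in>S. (\<phi> j a x)\<^sup>2)"
          unfolding \<beta>S by (rule Cauchy_Schwarz_ineq_sum)
        also have "\<dots> \<le> L * (\<Sum>x\<in>S. (\<phi> j a x)\<^sup>2)"
          by (intro mult_right_mono L[OF r] sum_nonneg) auto
        finally show "(\<beta> j a z)\<^sup>2 \<le> L * (\<Sum>x\<in>S. (\<phi> j a x)\<^sup>2)" .
      qed
      also have "\<dots> = L * (\<Sum>x\<in>S. \<Sum>a<m j. (\<phi> j a x)\<^sup>2)"
        unfolding sum_distrib_left[symmetric] by (subst sum.swap) simp
      also have "\<dots> \<le> K"
        unfolding K_def S_def using L1 by (intro mult_left_mono basis_bound_ge[OF fb]) auto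
      finally show "(\<Sum>a<m j. (\<beta> j a z)\<^sup>2) \<le> K" .
    qed (simp add: \<beta>\<beta> orth)
    ultimately show "matching_systems (pair_pmf P Q) K m (\<lambda>j a z. \<phi> j a (fst z j)) (\<lambda>j a z. \<Sum>x\<in>UNIV. w j x (snd z j) * \<phi> j a x)"
      unfolding matching_systems_def \<alpha>_def[symmetric] \<beta>_def[symmetric] by (simp add: \<alpha>\<alpha> \<beta>\<beta>)
  qed
qed

text \<open>The nonconstant coefficients b_a of \<open>H\<close> define its centred projection
  \<open>f\<close> onto functions of step \<open>j\<close>. The covariance of f with H and the
  second moment of f are both s = \<Sum> b_a^2, so \<open>corr_bound\<close> reads s^2 \<le>
  \<rho>^2 s Var(H).\<close>

lemma correlation_decay_one:
  fixes P :: "('l::finite \<Rightarrow> 'w::finite) pmf"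
  assumes \<rho>: "max_corr P \<le> \<rho>" "0 < \<rho>"
    and o: "ortho_system P m K (\<lambda>a x. \<phi> a (x j))" and H: "indep_step j H"
  shows "(\<Sum>a<m. (if a = 0 then 1 else 1 / \<rho>\<^sup>2) * (expec P (\<lambda>x. \<phi> a (x j) * H x))\<^sup>2) \<le> expec P (\<lambda>x. (H x)\<^sup>2)"
proof -
  have finP: "finite (set_pmf P)" by simp
  have m: "0 < m" and \<phi>0: "\<And>x. x \<in> set_pmf P \<Longrightarrow> \<phi> 0 (x j) = 1"
    using o by (auto simp: ortho_system_def)
  have split: "{..<m} = insert 0 {1..<m}" using m by auto
  define b where "b a = expec P (\<lambda>x. \<phi> a (x j) * H x)" for a
  define G where "G x = H x - b 0" for x
  define f where "f y = (\<Sum>a=1..<m. b a * \<phi> a y)" for y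
  define s where "s = (\<Sum>a=1..<m. (b a)\<^sup>2)"
  have b0: "b 0 = expec P H"
    unfolding b_def by (intro expec_cong) (simp add: \<phi>0)
  have EG: "expec P G = 0" unfolding G_def[abs_def] by (simp add: expec_diff finP b0)
  have E\<phi>: "expec P (\<lambda>x. \<phi> a (x j)) = 0" if "a \<in> {1..<m}" for a
    using ortho_system_mean[OF o, of a] that by simp
  have Ef: "expec P (\<lambda>x. f (x j)) = 0"
    unfolding f_def expec_sum expec_cmult by (simp add: E\<phi>)
  have EfG: "expec P (\<lambda>x. f (x j) * G x) = s"
  proof -
    have "expec P (\<lambda>x. f (x j) * G x) = expec P (\<lambda>x. f (x j) * H x - b 0 * f (x j))"
      by (intro expec_cong) (simp add: G_def algebra_simps)
    also have "\<dots> = expec P (\<lambda>x. \<Sum>a=1..<m. b a * (\<phi> a (x j) * H x))"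
      by (simp add: expec_diff expec_cmult Ef) (simp add: f_def sum_distrib_right mult.assoc)
    also have "\<dots> = s"
      by (simp add: expec_sum expec_cmult s_def power2_eq_square flip: b_def)
    finally show ?thesis .
  qed
  have Ef2: "expec P (\<lambda>x. (f (x j))\<^sup>2) = s"
    using ortho_system_square[OF o, of "\<lambda>a. if a = 0 then 0 else b a"]
    by (simp add: split f_def s_def if_distrib mult.commute cong: if_cong)
  have EG2: "expec P (\<lambda>x. (G x)\<^sup>2) = expec P (\<lambda>x. (H x)\<^sup>2) - (b 0)\<^sup>2"
  proof -
    have "expec P (\<lambda>x. (G x)\<^sup>2) = expec P (\<lambda>x. (H x)\<^sup>2 - 2 * b 0 * H x + (b 0)\<^sup>2)"
      by (intro expec_cong) (simp add: G_def power2_eq_square algebra_simps)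
    also have "\<dots> = expec P (\<lambda>x. (H x)\<^sup>2) - 2 * b 0 * b 0 + (b 0)\<^sup>2"
      by (simp only: expec_add expec_diff expec_cmult expec_const[OF finP] b0)
    finally show ?thesis by (simp add: power2_eq_square)
  qed
  have "indep_step j G" using H unfolding indep_step_def G_def by metis
  from corr_bound[OF \<rho>(1) this Ef EG]
  have "s\<^sup>2 \<le> \<rho>\<^sup>2 * (s * (expec P (\<lambda>x. (H x)\<^sup>2) - (b 0)\<^sup>2))"
    by (simp only: EfG Ef2 EG2)
  then have *: "s * s \<le> s * (\<rho>\<^sup>2 * (expec P (\<lambda>x. (H x)\<^sup>2) - (b 0)\<^sup>2))"
    by (simp add: power2_eq_square mult_ac)
  have s0: "0 \<le> s" by (auto simp: s_def intro: sum_nonneg)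
  have G0: "0 \<le> expec P (\<lambda>x. (H x)\<^sup>2) - (b 0)\<^sup>2"
    unfolding EG2[symmetric] by (rule expec_square_nonneg)
  have "s \<le> \<rho>\<^sup>2 * (expec P (\<lambda>x. (H x)\<^sup>2) - (b 0)\<^sup>2)"
    using * s0 G0 by (cases "s = 0") auto
  then have "s / \<rho>\<^sup>2 \<le> expec P (\<lambda>x. (H x)\<^sup>2) - (b 0)\<^sup>2"
    using \<rho>(2) by (simp add: pos_divide_le_eq mult.commute)
  moreover have "(\<Sum>a<m. (if a = 0 then 1 else 1 / \<rho>\<^sup>2) * (b a)\<^sup>2) = (b 0)\<^sup>2 + s / \<rho>\<^sup>2"
    by (simp add: split s_def sum_divide_distrib)
  ultimately show ?thesis by (simp add: b_def)
qed

text \<open>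
  In operator form: conditioning on the other steps is a contraction composed with the noise operator
  that multiplies \<open>\<phi>\<^sub>\<sigma>\<close> by \<open>\<rho>\<close> to the power \<open>|\<sigma>|\<close>.
\<close>

lemma correlation_decay:
  fixes P :: "('l::finite \<Rightarrow> 'w::finite) pmf" and H :: "(nat \<Rightarrow> 'l \<Rightarrow> 'w) \<Rightarrow> real"
  assumes \<rho>: "max_corr P \<le> \<rho>" "0 < \<rho>"
    and o: "ortho_system P m K (\<lambda>a x. \<phi> a (x j))" and "finite A"
    and H: "\<And>X X'. (\<And>i k. k \<noteq> j \<Longrightarrow> X i k = X' i k) \<Longrightarrow> H X = H X'"
  shows "(\<Sum>\<sigma>\<in>A \<rightarrow>\<^sub>E {..<m}. (1 / \<rho>\<^sup>2) ^ wt A \<sigma> * (expec (iid A d P) (\<lambda>X. (\<Prod>i\<in>A. \<phi> (\<sigma> i) (X i j)) * H X))\<^sup>2)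
    \<le> expec (iid A d P) (\<lambda>X. (H X)\<^sup>2)"
  using assms(4) H
proof (induction A arbitrary: H)
  case empty
  show ?case by (simp add: wt_def PiE_empty_domain)
next
  case (insert i A)
  have finP: "finite (set_pmf P)" by simp
  define \<omega> where "\<omega> a = (if a = 0 then 1 else 1 / \<rho>\<^sup>2)" for a :: nat
  \<comment> \<open>The coefficient of \<open>H\<close> in coordinate \<open>i\<close>, as a
    function of the other coordinates. It is again independent of step \<open>j\<close>, so the
    induction hypothesis applies to it.\<close>
  define Ha where "Ha a Y = expec P (\<lambda>x. \<phi> a (x j) * H (Y(i := x)))" for a Y
  define B where "B a \<sigma> = expec (iid A d P) (\<lambda>Y. (\<Prod>k\<in>A. \<phi> (\<sigma> k) (Y k j)) * Ha a Y)" for a \<sigma>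
  have coeff: "expec (iid (insert i A) d P) (\<lambda>X. (\<Prod>k\<in>insert i A. \<phi> ((\<sigma>(i := a)) k) (X k j)) * H X) = B a \<sigma>" for a \<sigma>
  proof -
    have "(\<Prod>k\<in>insert i A. \<phi> ((\<sigma>(i := a)) k) ((Y(i := x)) k j)) = \<phi> a (x j) * (\<Prod>k\<in>A. \<phi> (\<sigma> k) (Y k j))" for Y x
    proof -
      have "(\<Prod>k\<in>A. \<phi> ((\<sigma>(i := a)) k) ((Y(i := x)) k j)) = (\<Prod>k\<in>A. \<phi> (\<sigma> k) (Y k j))"
        using insert.hyps by (intro prod.cong) auto
      then show ?thesis using insert.hyps by simp
    qed
    then show ?thesis
      unfolding B_def Ha_def expec_iid_insert[OF insert.hyps finP] by (simp add: mult_ac flip: expec_cmult)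
  qed
  have IH: "(\<Sum>\<sigma>\<in>A \<rightarrow>\<^sub>E {..<m}. (1 / \<rho>\<^sup>2) ^ wt A \<sigma> * (B a \<sigma>)\<^sup>2) \<le> expec (iid A d P) (\<lambda>Y. (Ha a Y)\<^sup>2)" for a
    unfolding B_def
  proof (rule insert.IH)
    fix X X' :: "nat \<Rightarrow> 'l \<Rightarrow> 'w" assume eq: "\<And>i k. k \<noteq> j \<Longrightarrow> X i k = X' i k"
    have "H (X(i := x)) = H (X'(i := x))" for x by (rule insert.prems) (simp add: eq)
    then show "Ha a X = Ha a X'" by (simp add: Ha_def)
  qed
  have "(\<Sum>\<sigma>\<in>insert i A \<rightarrow>\<^sub>E {..<m}. (1 / \<rho>\<^sup>2) ^ wt (insert i A) \<sigma> *
      (expec (iid (insert i A) d P) (\<lambda>X. (\<Prod>i\<in>insert i A. \<phi> (\<sigma> i) (X i j)) * H X))\<^sup>2) =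
    (\<Sum>a<m. \<omega> a * (\<Sum>\<sigma>\<in>A \<rightarrow>\<^sub>E {..<m}. (1 / \<rho>\<^sup>2) ^ wt A \<sigma> * (B a \<sigma>)\<^sup>2))"
    unfolding sum_PiE_insert[OF insert.hyps(2)] coeff wt_insert[OF insert.hyps] sum_distrib_left
    by (intro sum.cong refl) (simp add: \<omega>_def)
  also have "\<dots> \<le> (\<Sum>a<m. \<omega> a * expec (iid A d P) (\<lambda>Y. (Ha a Y)\<^sup>2))"
    by (intro sum_mono mult_left_mono IH) (simp add: \<omega>_def)
  also have "\<dots> = expec (iid A d P) (\<lambda>Y. \<Sum>a<m. \<omega> a * (Ha a Y)\<^sup>2)"
    by (simp add: expec_sum expec_cmult)
  also have "\<dots> \<le> expec (iid A d P) (\<lambda>Y. expec P (\<lambda>x. (H (Y(i := x)))\<^sup>2))"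
    unfolding \<omega>_def Ha_def
  proof (intro expec_mono correlation_decay_one[OF \<rho> o])
    fix Y :: "nat \<Rightarrow> 'l \<Rightarrow> 'w"
    show "indep_step j (\<lambda>x. H (Y(i := x)))"
      unfolding indep_step_def by (intro allI impI insert.prems) auto
  qed
  also have "\<dots> = expec (iid (insert i A) d P) (\<lambda>X. (H X)\<^sup>2)"
    by (simp add: expec_iid_insert[OF insert.hyps finP])
  finally show ?case .
qed

text \<open>Bernoulli gives 1 - (1 - \<delta>)^s \<le> s \<delta>, and s \<rho>^s is at most the
  geometric sum. Uniformity in \<open>s\<close> is the point: noise hardly affects low weights, and
  the correlation suppresses high ones.\<close>

lemma noise_damping:
  fixes \<rho> \<delta> :: real
  assumes \<rho>: "0 < \<rho>" "\<rho> < 1" and \<delta>: "0 \<le> \<delta>" "\<delta> \<le> 1"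
  shows "(1 - (1 - \<delta>) ^ s) * \<rho> ^ s \<le> \<delta> / (1 - \<rho>)"
proof -
  have "1 - (1 - \<delta>) ^ s \<le> s * \<delta>"
    using Bernoulli_inequality[of "- \<delta>" s] \<delta> by simp
  then have "(1 - (1 - \<delta>) ^ s) * \<rho> ^ s \<le> s * \<delta> * \<rho> ^ s"
    using \<rho> by (intro mult_right_mono) auto
  also have "\<dots> = \<delta> * (\<Sum>i<s. \<rho> ^ s)" by simp
  also have "\<dots> \<le> \<delta> * (\<Sum>i<s. \<rho> ^ i)"
    using \<rho> \<delta> by (intro mult_left_mono sum_mono power_decreasing) auto
  also have "(\<Sum>i<s. \<rho> ^ i) = (1 - \<rho> ^ s) / (1 - \<rho>)"
    using \<rho> by (simp add: sum_gp_strict)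
  also have "\<dots> \<le> 1 / (1 - \<rho>)" using \<rho> by (intro divide_right_mono) auto
  finally show ?thesis using \<delta> by (simp add: mult_left_mono)
qed

text \<open>\<open>H\<close> is built from the other steps, so \<open>correlation_decay\<close>
  bounds its coefficients \<open>B \<sigma>\<close> in square sum even after division by \<rho>^(wt
  \<sigma>). The factor \<rho>^(wt \<sigma>) gained in this way meets the damping 1 - (1 -
  \<delta>)^(wt \<sigma>) in \<open>noise_damping\<close>.\<close>

lemma noise_error:
  fixes P :: "('l::finite \<Rightarrow> 'w::finite) pmf" and H :: "(nat \<Rightarrow> 'l \<Rightarrow> 'w) \<Rightarrow> real"
  assumes \<rho>: "max_corr P \<le> \<rho>" "0 < \<rho>" "\<rho> < 1" and \<delta>: "0 < \<delta>" "\<delta> \<le> 1"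
    and o: "ortho_system P m K (\<lambda>a x. \<phi> a (x j))" and A: "finite A"
    and H: "\<And>X X'. (\<And>i k. k \<noteq> j \<Longrightarrow> X i k = X' i k) \<Longrightarrow> H X = H X'"
    and H1: "\<And>X. X \<in> set_pmf (iid A d P) \<Longrightarrow> \<bar>H X\<bar> \<le> 1"
    and c1: "(\<Sum>\<sigma>\<in>A \<rightarrow>\<^sub>E {..<m}. (c \<sigma>)\<^sup>2) \<le> 1"
  defines "\<xi> \<equiv> \<lambda>i a x. \<phi> a (x j)"
  shows "\<bar>expec (iid A d P) (\<lambda>X. (mpoly A m c \<xi> X - mpoly A m (\<lambda>\<sigma>. (1 - \<delta>) ^ wt A \<sigma> * c \<sigma>) \<xi> X) * H X)\<bar> \<le> \<delta> / (1 - \<rho>)"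
proof -
  have finP: "finite (set_pmf P)" by simp
  define \<theta> where "\<theta> = \<delta> / (1 - \<rho>)"
  have \<theta>: "0 < \<theta>" using \<rho> \<delta> by (simp add: \<theta>_def)
  define B where "B \<sigma> = expec (iid A d P) (\<lambda>X. (\<Prod>i\<in>A. \<phi> (\<sigma> i) (X i j)) * H X)" for \<sigma>
  define s where "s \<sigma> = wt A \<sigma>" for \<sigma>
  have "expec (iid A d P) (\<lambda>X. (mpoly A m c \<xi> X - mpoly A m (\<lambda>\<sigma>. (1 - \<delta>) ^ wt A \<sigma> * c \<sigma>) \<xi> X) * H X) =
    expec (iid A d P) (\<lambda>X. \<Sum>\<sigma>\<in>A \<rightarrow>\<^sub>E {..<m}. (1 - (1 - \<delta>) ^ s \<sigma>) * c \<sigma> * ((\<Prod>i\<in>A. \<phi> (\<sigma> i) (X i j)) * H X))"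
    unfolding mpoly_diff unfolding mpoly_def sum_distrib_right
    by (intro expec_cong sum.cong refl) (simp add: s_def \<xi>_def algebra_simps)
  also have "\<dots> = (\<Sum>\<sigma>\<in>A \<rightarrow>\<^sub>E {..<m}. (1 - (1 - \<delta>) ^ s \<sigma>) * c \<sigma> * B \<sigma>)"
    by (simp only: expec_sum expec_cmult B_def)
  also have "\<bar>\<dots>\<bar> \<le> (\<Sum>\<sigma>\<in>A \<rightarrow>\<^sub>E {..<m}. \<bar>(1 - (1 - \<delta>) ^ s \<sigma>) * c \<sigma> * B \<sigma>\<bar>)"
    by (rule sum_abs)
  also have "\<dots> \<le> (\<Sum>\<sigma>\<in>A \<rightarrow>\<^sub>E {..<m}. \<theta> / 2 * (c \<sigma>)\<^sup>2 + \<theta> / 2 * ((1 / \<rho>\<^sup>2) ^ s \<sigma> * (B \<sigma>)\<^sup>2))"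
  proof (intro sum_mono)
    fix \<sigma>
    define r where "r = \<rho> ^ s \<sigma>"
    have r: "0 < r" using \<rho> by (simp add: r_def)
    define g where "g = 1 - (1 - \<delta>) ^ s \<sigma>"
    have g: "0 \<le> g" "g * r \<le> \<theta>"
      using noise_damping[OF \<rho>(2,3), of \<delta> "s \<sigma>"] \<delta> by (auto simp: g_def r_def \<theta>_def intro: power_le_one)
    \<comment> \<open>Rescaled so that the squares, summed over \<open>\<sigma>\<close>, stay at
      most 1.\<close>
    define y where "y = \<bar>B \<sigma>\<bar> / r"
    have y2: "y\<^sup>2 = (1 / \<rho>\<^sup>2) ^ s \<sigma> * (B \<sigma>)\<^sup>2"
      by (simp add: y_def r_def power_divide power2_eq_square power_mult_distrib)
    have "\<bar>g * c \<sigma> * B \<sigma>\<bar> = (g * r) * (\<bar>c \<sigma>\<bar> * y)"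
      using r g by (simp add: y_def abs_mult)
    also have "\<dots> \<le> \<theta> * (\<bar>c \<sigma>\<bar> * y)"
      using g r by (intro mult_right_mono) (auto simp: y_def)
    also have "\<dots> \<le> \<theta> * (((c \<sigma>)\<^sup>2 + y\<^sup>2) / 2)"
    proof (intro mult_left_mono)
      have "0 \<le> (\<bar>c \<sigma>\<bar> - y)\<^sup>2" by simp
      then show "\<bar>c \<sigma>\<bar> * y \<le> ((c \<sigma>)\<^sup>2 + y\<^sup>2) / 2" by (simp add: power2_diff)
    qed (use \<theta> in simp)
    also have "\<dots> = \<theta> / 2 * (c \<sigma>)\<^sup>2 + \<theta> / 2 * ((1 / \<rho>\<^sup>2) ^ s \<sigma> * (B \<sigma>)\<^sup>2)"
      unfolding y2[symmetric] by (simp add: algebra_simps)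
    finally show "\<bar>(1 - (1 - \<delta>) ^ s \<sigma>) * c \<sigma> * B \<sigma>\<bar> \<le> \<theta> / 2 * (c \<sigma>)\<^sup>2 + \<theta> / 2 * ((1 / \<rho>\<^sup>2) ^ s \<sigma> * (B \<sigma>)\<^sup>2)"
      by (simp add: g_def)
  qed
  also have "\<dots> = \<theta> / 2 * (\<Sum>\<sigma>\<in>A \<rightarrow>\<^sub>E {..<m}. (c \<sigma>)\<^sup>2) + \<theta> / 2 * (\<Sum>\<sigma>\<in>A \<rightarrow>\<^sub>E {..<m}. (1 / \<rho>\<^sup>2) ^ s \<sigma> * (B \<sigma>)\<^sup>2)"
    by (simp add: sum.distrib sum_distrib_left)
  also have "\<dots> \<le> \<theta> / 2 * 1 + \<theta> / 2 * 1"
  proof (intro add_mono mult_left_mono c1)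
    have "(\<Sum>\<sigma>\<in>A \<rightarrow>\<^sub>E {..<m}. (1 / \<rho>\<^sup>2) ^ s \<sigma> * (B \<sigma>)\<^sup>2) \<le> expec (iid A d P) (\<lambda>X. (H X)\<^sup>2)"
      unfolding s_def B_def by (rule correlation_decay[OF \<rho>(1,2) o A H])
    also have "\<dots> \<le> expec (iid A d P) (\<lambda>X. 1)"
      using H1 by (intro expec_mono) (simp add: abs_square_le_1)
    finally show "(\<Sum>\<sigma>\<in>A \<rightarrow>\<^sub>E {..<m}. (1 / \<rho>\<^sup>2) ^ s \<sigma> * (B \<sigma>)\<^sup>2) \<le> 1" using A by simp
  qed (use \<theta> in auto)
  also have "\<dots> = \<theta>" by simp
  finally show ?thesis by (simp only: \<theta>_def)
qed

text \<open>The damped polynomial is the average of the original one when each coordinate is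
  independently redrawn with probability \<delta> and kept otherwise. Averages of values in [0,1]
  stay in [0,1].\<close>

lemma noise_range:
  fixes P :: "('l::finite \<Rightarrow> 'w::finite) pmf"
  assumes \<delta>: "0 < \<delta>" "\<delta> < 1"
    and o: "ortho_system P m K (\<lambda>a x. \<phi> a (x j))" and A: "finite A"
  defines "\<xi> \<equiv> \<lambda>i a x. \<phi> a (x j)"
  assumes range: "\<And>X. (\<And>i. i \<in> A \<Longrightarrow> X i \<in> set_pmf P) \<Longrightarrow> 0 \<le> mpoly A m c \<xi> X \<and> mpoly A m c \<xi> X \<le> 1"
    and X: "\<And>i. i \<in> A \<Longrightarrow> X i \<in> set_pmf P"
  shows "0 \<le> mpoly A m (\<lambda>\<sigma>. (1 - \<delta>) ^ wt A \<sigma> * c \<sigma>) \<xi> X \<and> mpoly A m (\<lambda>\<sigma>. (1 - \<delta>) ^ wt A \<sigma> * c \<sigma>) \<xi> X \<le> 1"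
proof -
  have finP: "finite (set_pmf P)" by simp
  define R where "R = pair_pmf (bernoulli_pmf \<delta>) P"
  have finR: "finite (set_pmf R)" by (simp add: R_def)
  define mix where "mix y i = (if fst (y i) then snd (y i) else X i)" for y :: "nat \<Rightarrow> bool \<times> ('l \<Rightarrow> 'w)" and i
  have one: "expec R (\<lambda>y. \<phi> a ((if fst y then snd y else X i) j)) = (if a = 0 then 1 else 1 - \<delta>) * \<phi> a (X i j)"
    if "i \<in> A" "a < m" for i a
  proof -
    have "expec R (\<lambda>y. \<phi> a ((if fst y then snd y else X i) j)) = \<delta> * expec P (\<lambda>x. \<phi> a (x j)) + (1 - \<delta>) * \<phi> a (X i j)"
      by (simp add: R_def expec_pair_pmf expec_bernoulli \<delta> finP)
    then show ?thesis
      using ortho_system_mean[OF o that(2)] o X[OF that(1)] by (auto simp: ortho_system_def)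
  qed
  have damp: "(1 - \<delta>) ^ wt A \<sigma> = (\<Prod>i\<in>A. if \<sigma> i = 0 then 1 else 1 - \<delta>)" for \<sigma>
  proof -
    have "A \<inter> - {i. \<sigma> i = 0} = {i\<in>A. \<sigma> i \<noteq> 0}" by auto
    then show ?thesis by (simp only: prod.If_cases[OF A] wt_def) simp
  qed
  have "mpoly A m (\<lambda>\<sigma>. (1 - \<delta>) ^ wt A \<sigma> * c \<sigma>) \<xi> X =
    (\<Sum>\<sigma>\<in>A \<rightarrow>\<^sub>E {..<m}. c \<sigma> * (\<Prod>i\<in>A. (if \<sigma> i = 0 then 1 else 1 - \<delta>) * \<phi> (\<sigma> i) (X i j)))"
    unfolding mpoly_def damp by (intro sum.cong refl) (simp add: prod.distrib \<xi>_def)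
  also have "\<dots> = (\<Sum>\<sigma>\<in>A \<rightarrow>\<^sub>E {..<m}. c \<sigma> * expec (iid A undefined R) (\<lambda>y. \<Prod>i\<in>A. \<phi> (\<sigma> i) (mix y i j)))"
  proof (intro sum.cong refl arg_cong2[of _ _ _ _ "(*)"])
    fix \<sigma> assume \<sigma>: "\<sigma> \<in> A \<rightarrow>\<^sub>E {..<m}"
    have "expec (iid A undefined R) (\<lambda>y. \<Prod>i\<in>A. \<phi> (\<sigma> i) (mix y i j)) =
      (\<Prod>i\<in>A. expec R (\<lambda>y. \<phi> (\<sigma> i) ((if fst y then snd y else X i) j)))"
      unfolding mix_def using A finR by (rule expec_iid_prod)
    also have "\<dots> = (\<Prod>i\<in>A. (if \<sigma> i = 0 then 1 else 1 - \<delta>) * \<phi> (\<sigma> i) (X i j))"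
      using \<sigma> by (intro prod.cong refl one) auto
    finally show "(\<Prod>i\<in>A. (if \<sigma> i = 0 then 1 else 1 - \<delta>) * \<phi> (\<sigma> i) (X i j)) =
      expec (iid A undefined R) (\<lambda>y. \<Prod>i\<in>A. \<phi> (\<sigma> i) (mix y i j))" by simp
  qed
  also have "\<dots> = expec (iid A undefined R) (\<lambda>y. mpoly A m c \<xi> (mix y))"
    unfolding mpoly_def \<xi>_def by (simp only: expec_sum expec_cmult)
  finally have eq: "mpoly A m (\<lambda>\<sigma>. (1 - \<delta>) ^ wt A \<sigma> * c \<sigma>) \<xi> X = expec (iid A undefined R) (\<lambda>y. mpoly A m c \<xi> (mix y))" .
  have mix: "0 \<le> mpoly A m c \<xi> (mix y) \<and> mpoly A m c \<xi> (mix y) \<le> 1" if "y \<in> set_pmf (iid A undefined R)" for y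
  proof (rule range)
    fix i assume i: "i \<in> A"
    show "mix y i \<in> set_pmf P"
      using set_iidD[OF that A i] X[OF i] by (auto simp: mix_def R_def)
  qed
  have "expec (iid A undefined R) (\<lambda>y. mpoly A m c \<xi> (mix y)) \<le> expec (iid A undefined R) (\<lambda>y. 1)"
    using mix by (intro expec_mono) auto
  moreover have "0 \<le> expec (iid A undefined R) (\<lambda>y. mpoly A m c \<xi> (mix y))"
    using mix by (intro expec_nonneg) auto
  ultimately show ?thesis unfolding eq using A finR by simp
qed

text \<open>The factors are smoothed one step at a time. All other factors, smoothed or not, form a
  function \<open>H\<close> of the other steps that is bounded by 1 on the support, as
  \<open>noise_error\<close> requires.\<close>

lemma noise_product_error:
  fixes P :: "('l::finite \<Rightarrow> 'w::finite) pmf" and c :: "'l \<Rightarrow> (nat \<Rightarrow> nat) \<Rightarrow> real"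
  assumes \<rho>: "max_corr P \<le> \<rho>" "0 < \<rho>" "\<rho> < 1" and \<delta>: "0 < \<delta>" "\<delta> < 1"
    and o: "\<And>j. ortho_system P (m j) K (\<lambda>a x. \<phi> j a (x j))" and A: "finite A"
    and c1: "\<And>j. (\<Sum>\<sigma>\<in>A \<rightarrow>\<^sub>E {..<m j}. (c j \<sigma>)\<^sup>2) \<le> 1"
  defines "F \<equiv> \<lambda>j. mpoly A (m j) (c j) (\<lambda>i a x. \<phi> j a (x j))"
    and "G \<equiv> \<lambda>j. mpoly A (m j) (\<lambda>\<sigma>. (1 - \<delta>) ^ wt A \<sigma> * c j \<sigma>) (\<lambda>i a x. \<phi> j a (x j))"
  assumes range: "\<And>j X. (\<And>i. i \<in> A \<Longrightarrow> X i \<in> set_pmf P) \<Longrightarrow> 0 \<le> F j X \<and> F j X \<le> 1"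
  shows "expec (iid A d P) (\<lambda>X. \<Prod>j\<in>UNIV. G j X) - CARD('l) * (\<delta> / (1 - \<rho>)) \<le> expec (iid A d P) (\<lambda>X. \<Prod>j\<in>UNIV. F j X)"
proof -
  have F1: "0 \<le> F j X \<and> F j X \<le> 1" if "X \<in> set_pmf (iid A d P)" for j X
    using range set_iidD[OF that A] by blast
  have G1: "0 \<le> G j X \<and> G j X \<le> 1" if "X \<in> set_pmf (iid A d P)" for j X
    unfolding G_def by (rule noise_range[OF \<delta> o A]) (use range set_iidD[OF that A] in \<open>auto simp: F_def\<close>)
  define M where "M S k X = (if k \<in> S then G k X else F k X)" for S k X
  have M1: "0 \<le> M S k X \<and> M S k X \<le> 1" if "X \<in> set_pmf (iid A d P)" for S k X
    using F1[OF that] G1[OF that] by (simp add: M_def)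
  have "expec (iid A d P) (\<lambda>X. \<Prod>k\<in>UNIV. M S k X) - card S * (\<delta> / (1 - \<rho>)) \<le> expec (iid A d P) (\<lambda>X. \<Prod>j\<in>UNIV. F j X)"
    if "finite S" for S
    using that
  proof (induction S)
    case empty
    then show ?case by (simp add: M_def)
  next
    case (insert j S)
    define H where "H X = (\<Prod>k\<in>UNIV - {j}. M S k X)" for X
    have "\<bar>expec (iid A d P) (\<lambda>X. (F j X - G j X) * H X)\<bar> \<le> \<delta> / (1 - \<rho>)"
      unfolding F_def G_def
    proof (rule noise_error[OF \<rho> \<delta>(1) _ o A _ _ c1])
      show "\<delta> \<le> 1" using \<delta> by simp
      show "\<bar>H X\<bar> \<le> 1" if "X \<in> set_pmf (iid A d P)" for X
        unfolding H_def abs_prod using M1[OF that] by (intro prod_le_1) auto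
      show "H X = H X'" if "\<And>i k. k \<noteq> j \<Longrightarrow> X i k = X' i k" for X X'
        unfolding H_def M_def F_def G_def mpoly_def using that
        by (intro prod.cong refl if_cong sum.cong arg_cong2[of _ _ _ _ "(*)"]) auto
    qed
    moreover have "(F j X - G j X) * H X = (\<Prod>k\<in>UNIV. M S k X) - (\<Prod>k\<in>UNIV. M (insert j S) k X)" for X
    proof -
      have "(\<Prod>k\<in>UNIV - {j}. M (insert j S) k X) = H X"
        unfolding H_def by (intro prod.cong) (auto simp: M_def)
      then show ?thesis
        using insert.hyps by (simp add: prod.remove[of UNIV j] M_def[of _ j] H_def left_diff_distrib)
    qed
    ultimately have "\<bar>expec (iid A d P) (\<lambda>X. \<Prod>k\<in>UNIV. M S k X) - expec (iid A d P) (\<lambda>X. \<Prod>k\<in>UNIV. M (insert j S) k X)\<bar> \<le> \<delta> / (1 - \<rho>)"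
      by (simp add: expec_diff)
    then show ?case using insert by (simp add: algebra_simps add_divide_distrib)
  qed
  from this[of UNIV] show ?thesis by (simp add: M_def)
qed

section \<open>The lower bound\<close>

lemma sin_square_lipschitz: "\<bar>(sin x)\<^sup>2 - (sin y)\<^sup>2\<bar> \<le> \<bar>x - y\<bar>" for x y :: real
proof -
  have "(sin x)\<^sup>2 - (sin y)\<^sup>2 = (sin x)\<^sup>2 * ((sin y)\<^sup>2 + (cos y)\<^sup>2) - (sin y)\<^sup>2 * ((sin x)\<^sup>2 + (cos x)\<^sup>2)"
    by simp
  also have "\<dots> = sin (x + y) * sin (x - y)"
    unfolding sin_add sin_diff power2_eq_square by (simp only: algebra_simps)
  finally have "\<bar>(sin x)\<^sup>2 - (sin y)\<^sup>2\<bar> = \<bar>sin (x + y)\<bar> * \<bar>sin (x - y)\<bar>"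
    by (simp add: abs_mult)
  also have "\<dots> \<le> 1 * \<bar>x - y\<bar>"
    by (intro mult_mono abs_sin_le_one abs_sin_x_le_abs_x) auto
  finally show ?thesis by simp
qed

lemma sin_square_le:
  fixes x :: real
  assumes "0 \<le> x" "x \<le> 1"
  shows "(sin x)\<^sup>2 \<le> x"
proof -
  have "\<bar>sin x\<bar> \<le> \<bar>x\<bar>" by (rule abs_sin_x_le_abs_x)
  then have "(sin x)\<^sup>2 \<le> x\<^sup>2" by (rule power_mono[of "\<bar>sin x\<bar>" "\<bar>x\<bar>" 2, simplified])
  also have "\<dots> \<le> x" using assms mult_left_mono[of x 1 x] by (simp add: power2_eq_square)
  finally show ?thesis .
qed

text \<open>sin x - x/2 is nondecreasing on [0,1], since 1 < \<pi>/3 and the cosine is at least 1/2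
  up to \<pi>/3.\<close>

lemma sin_square_ge:
  fixes x :: real
  assumes "0 \<le> x" "x \<le> 1"
  shows "x\<^sup>2 / 4 \<le> (sin x)\<^sup>2"
proof -
  have "sin 0 - 0 / 2 \<le> sin x - x / 2"
  proof (rule DERIV_nonneg_imp_nondecreasing[OF assms(1)])
    fix y :: real assume y: "0 \<le> y" "y \<le> x"
    have "cos (pi / 3) \<le> cos y"
      using y assms pi_gt3 by (intro cos_monotone_0_pi_le) auto
    then have "0 \<le> cos y - 1 / 2" by (simp add: cos_60)
    moreover have "((\<lambda>x. sin x - x / 2) has_real_derivative cos y - 1 / 2) (at y)"
      by (auto intro!: derivative_eq_intros)
    ultimately show "\<exists>d. ((\<lambda>x. sin x - x / 2) has_real_derivative d) (at y) \<and> 0 \<le> d" by blast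
  qed
  then have "x / 2 \<le> sin x" by simp
  then have "(x / 2)\<^sup>2 \<le> (sin x)\<^sup>2" using assms by (intro power_mono) auto
  then show ?thesis by (simp add: power_divide)
qed

lemma sin_square_le_one: "(sin x)\<^sup>2 \<le> 1" for x :: real
  by (simp add: abs_square_le_1)

lemma expec_square_le:
  fixes f :: "'a \<Rightarrow> real"
  assumes "finite (set_pmf p)"
  shows "(expec p f)\<^sup>2 \<le> expec p (\<lambda>x. (f x)\<^sup>2)"
  using expec_cauchy_schwarz[of p f "\<lambda>_. 1"] assms by simp

lemma expec_abs_le:
  fixes f :: "'a \<Rightarrow> real"
  assumes "finite (set_pmf p)" "expec p (\<lambda>x. (f x)\<^sup>2) \<le> s\<^sup>2" "0 \<le> s"
  shows "expec p (\<lambda>x. \<bar>f x\<bar>) \<le> s"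
proof -
  have "(expec p (\<lambda>x. \<bar>f x\<bar>))\<^sup>2 \<le> s\<^sup>2"
    using expec_square_le[OF assms(1), of "\<lambda>x. \<bar>f x\<bar>"] assms(2) by simp
  then show ?thesis using assms(3) by (rule power2_le_imp_le)
qed

text \<open>Only indices of weight above \<open>k\<close> are dropped, and noise has multiplied
  their coefficients by at most (1 - \<delta>)^k. Parseval makes this an L^2 bound that does not see
  the number of coordinates.\<close>

lemma truncation_error:
  assumes A: "finite A" and p: "finite (set_pmf p)" and o: "\<And>i. i \<in> A \<Longrightarrow> ortho_system p m K (\<xi> i)"
    and \<delta>: "0 < \<delta>" "\<delta> < 1" and c1: "(\<Sum>\<sigma>\<in>A \<rightarrow>\<^sub>E {..<m}. (c \<sigma>)\<^sup>2) \<le> 1"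
  shows "expec (iid A d p) (\<lambda>z. \<bar>mpoly A m (\<lambda>\<sigma>. (1 - \<delta>) ^ wt A \<sigma> * c \<sigma>) \<xi> z -
      mpoly A m (\<lambda>\<sigma>. if wt A \<sigma> \<le> k then (1 - \<delta>) ^ wt A \<sigma> * c \<sigma> else 0) \<xi> z\<bar>) \<le> (1 - \<delta>) ^ k"
proof (rule expec_abs_le)
  have "expec (iid A d p) (\<lambda>z. (mpoly A m (\<lambda>\<sigma>. (1 - \<delta>) ^ wt A \<sigma> * c \<sigma>) \<xi> z -
      mpoly A m (\<lambda>\<sigma>. if wt A \<sigma> \<le> k then (1 - \<delta>) ^ wt A \<sigma> * c \<sigma> else 0) \<xi> z)\<^sup>2) =
    (\<Sum>\<sigma>\<in>A \<rightarrow>\<^sub>E {..<m}. ((1 - \<delta>) ^ wt A \<sigma> * c \<sigma> - (if wt A \<sigma> \<le> k then (1 - \<delta>) ^ wt A \<sigma> * c \<sigma> else 0))\<^sup>2)"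
    unfolding mpoly_diff by (rule mpoly_parseval[OF A p o])
  also have "\<dots> \<le> (\<Sum>\<sigma>\<in>A \<rightarrow>\<^sub>E {..<m}. ((1 - \<delta>) ^ k)\<^sup>2 * (c \<sigma>)\<^sup>2)"
  proof (intro sum_mono)
    fix \<sigma>
    show "((1 - \<delta>) ^ wt A \<sigma> * c \<sigma> - (if wt A \<sigma> \<le> k then (1 - \<delta>) ^ wt A \<sigma> * c \<sigma> else 0))\<^sup>2 \<le> ((1 - \<delta>) ^ k)\<^sup>2 * (c \<sigma>)\<^sup>2"
    proof (cases "wt A \<sigma> \<le> k")
      case False
      have "((1 - \<delta>) ^ wt A \<sigma>)\<^sup>2 \<le> ((1 - \<delta>) ^ k)\<^sup>2"
        using False \<delta> by (intro power_mono power_decreasing) auto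
      then show ?thesis using False by (simp add: power_mult_distrib mult_right_mono)
    qed simp
  qed
  also have "\<dots> \<le> ((1 - \<delta>) ^ k)\<^sup>2"
    using mult_left_mono[OF c1, of "((1 - \<delta>) ^ k)\<^sup>2"] by (simp add: sum_distrib_left)
  finally show "expec (iid A d p) (\<lambda>z. (mpoly A m (\<lambda>\<sigma>. (1 - \<delta>) ^ wt A \<sigma> * c \<sigma>) \<xi> z -
      mpoly A m (\<lambda>\<sigma>. if wt A \<sigma> \<le> k then (1 - \<delta>) ^ wt A \<sigma> * c \<sigma> else 0) \<xi> z)\<^sup>2) \<le> ((1 - \<delta>) ^ k)\<^sup>2" .
qed (use A p \<delta> in auto)

text \<open>The conditional mean given \<open>X\<close> is a polynomial on \<open>J\<close> whose
  coefficients are those of \<open>c\<close> supported in \<open>J\<close>. Its variance is the sum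
  of their squares without the constant one: at most m^|J| terms, each of weight at most |J| and
  hence at most \<gamma>^2.\<close>

lemma conditional_mean_error:
  assumes fin: "finite J" "finite B" and disj: "J \<inter> B = {}" and p: "finite (set_pmf p)"
  defines "A \<equiv> J \<union> B"
  assumes o: "\<And>i. i \<in> A \<Longrightarrow> ortho_system p m K (\<xi> i)"
    and \<mu>: "c (\<lambda>i\<in>A. 0) = \<mu>"
    and small: "\<And>\<sigma>. \<sigma> \<in> A \<rightarrow>\<^sub>E {..<m} \<Longrightarrow> 0 < wt A \<sigma> \<Longrightarrow> wt A \<sigma> \<le> card J \<Longrightarrow> \<bar>c \<sigma>\<bar> \<le> \<gamma>"
    and e: "real m ^ card J * \<gamma>\<^sup>2 \<le> e\<^sup>2" "0 \<le> e"
  shows "expec (iid J d p) (\<lambda>X. \<bar>expec (iid B d p) (\<lambda>Y. mpoly A m c \<xi> (glue J X Y)) - \<mu>\<bar>) \<le> e"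
proof (cases "0 < m \<or> A = {}")
  case False
  then obtain i where "i \<in> A" "m = 0" by auto
  with o[of i] show ?thesis by (simp add: ortho_system_def)
next
  case True
  have finA: "finite A" using fin by (simp add: A_def)
  define ext where "ext \<sigma> = (\<lambda>i. if i \<in> B then 0 else \<sigma> i)" for \<sigma> :: "nat \<Rightarrow> nat"
  define M where "M X = expec (iid B d p) (\<lambda>Y. mpoly A m c \<xi> (glue J X Y))" for X
  have M: "M X = mpoly J m (\<lambda>\<sigma>. c (ext \<sigma>)) \<xi> X" for X
    unfolding M_def A_def ext_def by (rule mpoly_average[OF fin(2,1) disj p]) (use o in \<open>auto simp: A_def\<close>)
  define z where "z = (\<lambda>i\<in>J. 0 :: nat)"
  have z: "z \<in> J \<rightarrow>\<^sub>E {..<m}" using True by (auto simp: z_def A_def)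
  have ext_z: "ext z = (\<lambda>i\<in>A. 0)" by (intro ext) (simp add: ext_def z_def A_def)
  have EM2: "expec (iid J d p) (\<lambda>X. (M X)\<^sup>2) = (\<Sum>\<sigma>\<in>J \<rightarrow>\<^sub>E {..<m}. (c (ext \<sigma>))\<^sup>2)"
    unfolding M by (rule mpoly_parseval[OF fin(1) p]) (use o in \<open>auto simp: A_def\<close>)
  have EM: "expec (iid J d p) M = \<mu>"
  proof -
    \<comment> \<open>With no coordinate frozen, \<open>mpoly_average\<close> leaves just the
      constant coefficient.\<close>
    have "expec (iid J d p) M = expec (iid A d p) (\<lambda>Y. mpoly ({} \<union> A) m c \<xi> (glue {} (\<lambda>_. d) Y))"
      unfolding M_def[abs_def] A_def by (subst expec_iid_glue[OF fin disj p]) (simp add: glue_def)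
    also have "\<dots> = mpoly {} m (\<lambda>\<sigma>. c (\<lambda>i. if i \<in> A then 0 else \<sigma> i)) \<xi> (\<lambda>_. d)"
      by (rule mpoly_average[OF finA _ _ p o]) auto
    also have "\<dots> = \<mu>" using \<mu> by (simp add: restrict_def)
    finally show ?thesis .
  qed
  have "expec (iid J d p) (\<lambda>X. (M X - \<mu>)\<^sup>2) = expec (iid J d p) (\<lambda>X. (M X)\<^sup>2 - 2 * \<mu> * M X + \<mu>\<^sup>2)"
    by (intro expec_cong) (simp add: power2_eq_square algebra_simps)
  also have "\<dots> = (\<Sum>\<sigma>\<in>J \<rightarrow>\<^sub>E {..<m}. (c (ext \<sigma>))\<^sup>2) - \<mu>\<^sup>2"
    using fin p by (simp add: expec_add expec_diff expec_cmult EM EM2 power2_eq_square[of \<mu>])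
  also have "\<dots> = (\<Sum>\<sigma>\<in>(J \<rightarrow>\<^sub>E {..<m}) - {z}. (c (ext \<sigma>))\<^sup>2)"
    using z fin by (subst sum.remove[of _ z]) (auto simp: ext_z \<mu> finite_PiE)
  also have "\<dots> \<le> (\<Sum>\<sigma>\<in>(J \<rightarrow>\<^sub>E {..<m}) - {z}. \<gamma>\<^sup>2)"
  proof (intro sum_mono)
    fix \<sigma> assume \<sigma>: "\<sigma> \<in> (J \<rightarrow>\<^sub>E {..<m}) - {z}"
    have "ext \<sigma> \<in> A \<rightarrow>\<^sub>E {..<m}"
      using \<sigma> True by (auto simp: ext_def A_def PiE_iff extensional_def)
    moreover have wt: "wt A (ext \<sigma>) = wt J \<sigma>"
      unfolding wt_def by (rule arg_cong[of _ _ card]) (use disj in \<open>auto simp: ext_def A_def\<close>)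
    moreover have "wt J \<sigma> \<le> card J" unfolding wt_def using fin by (intro card_mono) auto
    moreover have "0 < wt J \<sigma>"
    proof (rule ccontr)
      assume "\<not> 0 < wt J \<sigma>"
      then have "{i\<in>J. \<sigma> i \<noteq> 0} = {}" using fin by (simp add: wt_def)
      then have "\<sigma> i = z i" for i using \<sigma> by (cases "i \<in> J") (auto simp: z_def PiE_iff extensional_def)
      then show False using \<sigma> by auto
    qed
    ultimately have "\<bar>c (ext \<sigma>)\<bar> \<le> \<gamma>" using small[of "ext \<sigma>"] by simp
    then have "\<bar>c (ext \<sigma>)\<bar>\<^sup>2 \<le> \<gamma>\<^sup>2" by (intro power_mono) auto
    then show "(c (ext \<sigma>))\<^sup>2 \<le> \<gamma>\<^sup>2" by simp
  qed
  also have "\<dots> \<le> (\<Sum>\<sigma>\<in>J \<rightarrow>\<^sub>E {..<m}. \<gamma>\<^sup>2)"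
    using fin by (intro sum_mono2) (auto simp: finite_PiE)
  also have "\<dots> = real m ^ card J * \<gamma>\<^sup>2"
    using fin by (simp add: card_funcsetE)
  also note e(1)
  finally have "expec (iid J d p) (\<lambda>X. \<bar>M X - \<mu>\<bar>) \<le> e"
    using fin p e(2) by (intro expec_abs_le) auto
  then show ?thesis by (simp only: M_def)
qed

text \<open>The lower bound is linear in the deviations \<open>R j\<close>, so that only their means
  will matter. If some deviation exceeds its threshold \<mu>^2/8, the left-hand side is already
  nonpositive; otherwise every \<open>x j\<close> is at least \<mu>^2/8.\<close>

lemma prod_power_deviation_bound:
  fixes x \<mu> R :: "'l::finite \<Rightarrow> real"
  assumes \<mu>: "\<And>j. 0 < \<mu> j" and x: "\<And>j. 0 \<le> x j" "\<And>j. (\<mu> j)\<^sup>2 / 4 - R j \<le> x j" and R: "\<And>j. 0 \<le> R j"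
  shows "(\<Prod>j\<in>UNIV. ((\<mu> j)\<^sup>2 / 8) ^ b) * (1 - (\<Sum>j\<in>UNIV. 8 / (\<mu> j)\<^sup>2 * R j)) \<le> (\<Prod>j\<in>UNIV. x j ^ b)"
proof (cases "\<forall>j. R j \<le> (\<mu> j)\<^sup>2 / 8")
  case True
  have P0: "0 \<le> (\<Prod>j\<in>UNIV. ((\<mu> j)\<^sup>2 / 8) ^ b)" by (intro prod_nonneg) auto
  have "(\<Prod>j\<in>UNIV. ((\<mu> j)\<^sup>2 / 8) ^ b) * (1 - (\<Sum>j\<in>UNIV. 8 / (\<mu> j)\<^sup>2 * R j)) \<le> (\<Prod>j\<in>UNIV. ((\<mu> j)\<^sup>2 / 8) ^ b) * 1"
    using R by (intro mult_left_mono P0) (auto intro!: sum_nonneg)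
  also have "\<dots> \<le> (\<Prod>j\<in>UNIV. x j ^ b)"
  proof -
    have "(\<mu> j)\<^sup>2 / 8 \<le> x j" for j using True[rule_format, of j] x(2)[of j] by linarith
    then show ?thesis by (simp, intro prod_mono conjI power_mono) auto
  qed
  finally show ?thesis .
next
  case False
  then obtain k where k: "(\<mu> k)\<^sup>2 / 8 < R k" by (auto simp: not_le)
  have "1 \<le> 8 / (\<mu> k)\<^sup>2 * R k" using k \<mu>[of k] by (simp add: field_simps)
  also have "\<dots> \<le> (\<Sum>j\<in>UNIV. 8 / (\<mu> j)\<^sup>2 * R j)"
    using R by (intro member_le_sum[of k UNIV "\<lambda>j. 8 / (\<mu> j)\<^sup>2 * R j"]) auto
  finally have "(\<Prod>j\<in>UNIV. ((\<mu> j)\<^sup>2 / 8) ^ b) * (1 - (\<Sum>j\<in>UNIV. 8 / (\<mu> j)\<^sup>2 * R j)) \<le> 0"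
    by (intro mult_nonneg_nonpos prod_nonneg) auto
  also have "0 \<le> (\<Prod>j\<in>UNIV. x j ^ b)" using x(1) by (intro prod_nonneg) auto
  finally show ?thesis .
qed

lemma glue_in_support:
  assumes "finite J" "finite B" "X \<in> set_pmf (iid J d p)" "Y \<in> set_pmf (iid B d p)" "i \<in> J \<union> B"
  shows "glue J X Y i \<in> set_pmf p"
  using assms set_iidD[of X J d p i] set_iidD[of Y B d p i] by (auto simp: glue_def)

text \<open>\<open>g\<close> will be a smoothed function with values in [0,1] and \<open>h\<close>
  its truncation. The bound sin^2 g \<ge> g^2/4 and E g^2 \<ge> (E g)^2 give the main term, and the
  Lipschitz bound pays for passing from \<open>g\<close> to \<open>h\<close>.\<close>

lemma sin_square_mean_lower:
  fixes g h :: "'a \<Rightarrow> real"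
  assumes p: "finite (set_pmf p)" and g: "\<And>z. z \<in> set_pmf p \<Longrightarrow> 0 \<le> g z \<and> g z \<le> 1" and \<mu>: "0 < \<mu>" "\<mu> \<le> 1"
  shows "\<mu>\<^sup>2 / 4 - \<bar>expec p g - \<mu>\<bar> / 2 - expec p (\<lambda>z. \<bar>g z - h z\<bar>) \<le> expec p (\<lambda>z. (sin (h z))\<^sup>2)"
proof -
  define s where "s = expec p g - \<mu>"
  have "0 \<le> s + \<bar>s\<bar>" by simp
  then have "0 \<le> s\<^sup>2 + 2 * \<mu> * (s + \<bar>s\<bar>)" using \<mu> by simp
  then have "\<mu>\<^sup>2 - 2 * \<mu> * \<bar>s\<bar> \<le> (\<mu> + s)\<^sup>2" by (simp add: power2_eq_square algebra_simps)
  moreover have "2 * \<mu> * \<bar>s\<bar> \<le> 2 * \<bar>s\<bar>" using \<mu> mult_right_mono[of \<mu> 1 "\<bar>s\<bar>"] by simp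
  ultimately have "\<mu>\<^sup>2 - 2 * \<bar>s\<bar> \<le> (expec p g)\<^sup>2" by (simp add: s_def)
  also have "\<dots> \<le> expec p (\<lambda>z. (g z)\<^sup>2)" by (rule expec_square_le[OF p])
  finally have "\<mu>\<^sup>2 / 4 - \<bar>s\<bar> / 2 \<le> expec p (\<lambda>z. (g z)\<^sup>2 / 4)" by (simp add: expec_divide)
  also have "\<dots> \<le> expec p (\<lambda>z. (sin (h z))\<^sup>2 + \<bar>g z - h z\<bar>)"
  proof (rule expec_mono)
    fix z assume "z \<in> set_pmf p"
    then have "(g z)\<^sup>2 / 4 \<le> (sin (g z))\<^sup>2" using g by (intro sin_square_ge) auto
    with sin_square_lipschitz[of "g z" "h z"] show "(g z)\<^sup>2 / 4 \<le> (sin (h z))\<^sup>2 + \<bar>g z - h z\<bar>" by linarith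
  qed
  finally show ?thesis by (simp add: expec_add s_def)
qed

text \<open>For fixed \<open>X\<close> the coordinates in \<open>J\<close> are constants and those
  in \<open>B\<close> only read seeds, so each step sees nothing but its own seeds, as in
  \<open>reverse_hoelder_tensor\<close>. The power \<open>b\<close> on the right is dropped because
  squared sines are at most 1.\<close>

lemma hybrid_rounding_lower:
  fixes \<phi> :: "'l::finite \<Rightarrow> nat \<Rightarrow> 'w::finite \<Rightarrow> real" and \<eta> :: "'l \<Rightarrow> nat \<Rightarrow> 'r \<Rightarrow> real"
    and c :: "'l \<Rightarrow> (nat \<Rightarrow> nat) \<Rightarrow> real" and m :: "'l \<Rightarrow> nat"
  assumes p: "finite (set_pmf p)" and fin: "finite J" "finite B" and disj: "J \<inter> B = {}" and b: "0 < b"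
    and rev: "reverse_hoelder p (\<lambda>j z. snd z j) b"
  defines "A \<equiv> J \<union> B"
    and "\<alpha> \<equiv> \<lambda>j a z. \<phi> j a (fst z j)" and "\<beta> \<equiv> \<lambda>j a z. \<eta> j a (snd z j)"
  defines "h \<equiv> \<lambda>j X Y. (sin (mpoly A (m j) (c j) (hybrid \<alpha> \<beta> B j) (glue J X Y)))\<^sup>2"
  shows "(\<Prod>j\<in>UNIV. expec (iid B d p) (\<lambda>Y. h j X Y) ^ b) \<le> expec (iid B d p) (\<lambda>Y. \<Prod>j\<in>UNIV. h j X Y)"
proof -
  define u where "u j y = (sin (mpoly A (m j) (c j) (\<lambda>i a r. if i \<in> J then \<phi> j a (fst (X i) j) else \<eta> j a r) y))\<^sup>2" for j y
  have h: "h j X Y = u j (\<lambda>i. snd (Y i) j)" for j Y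
    unfolding h_def u_def mpoly_def
    by (intro arg_cong[of _ _ "\<lambda>x. (sin x)\<^sup>2"] sum.cong prod.cong arg_cong2[of _ _ _ _ "(*)"] refl)
       (use disj in \<open>auto simp: hybrid_def glue_def \<alpha>_def \<beta>_def A_def\<close>)
  have "(\<Prod>j\<in>UNIV. expec (iid B d p) (\<lambda>Y. h j X Y) ^ b) \<le> expec (iid B d p) (\<lambda>Y. \<Prod>j\<in>UNIV. h j X Y ^ b)"
    unfolding h by (rule reverse_hoelder_tensor[OF fin(2) p rev]) (simp add: u_def)
  also have "\<dots> \<le> expec (iid B d p) (\<lambda>Y. \<Prod>j\<in>UNIV. h j X Y)"
  proof (intro expec_mono prod_mono conjI)
    fix Y j
    show "0 \<le> h j X Y ^ b" by (simp add: h_def)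
    have "h j X Y ^ b \<le> h j X Y ^ 1"
      using b by (intro power_decreasing) (auto simp: h_def sin_square_le_one)
    then show "h j X Y ^ b \<le> h j X Y" by simp
  qed
  finally show ?thesis .
qed

lemma product_lower_bound:
  fixes P :: "('l::finite \<Rightarrow> 'w::finite) pmf" and \<phi> :: "'l \<Rightarrow> nat \<Rightarrow> 'w \<Rightarrow> real" and c :: "'l \<Rightarrow> (nat \<Rightarrow> nat) \<Rightarrow> real"
    and Q :: "('l \<Rightarrow> 'r) pmf" and \<rho> \<delta> e t \<gamma> :: real and \<eta> :: "'l \<Rightarrow> nat \<Rightarrow> 'r \<Rightarrow> real"
  assumes \<rho>: "max_corr P \<le> \<rho>" "0 < \<rho>" "\<rho> < 1"
    and finQ: "finite (set_pmf Q)" and b: "0 < b" and rev: "reverse_hoelder Q (\<lambda>j r. r j) b"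
  defines "p \<equiv> pair_pmf P Q" and "\<alpha> \<equiv> \<lambda>j a z. \<phi> j a (fst z j)" and "\<beta> \<equiv> \<lambda>j a z. \<eta> j a (snd z j)"
  assumes ms: "matching_systems p K m \<alpha> \<beta>" and C: "4 \<le> C" "3 * K \<le> C\<^sup>2"
    and A: "finite A" and c1: "\<And>j. (\<Sum>\<sigma>\<in>A \<rightarrow>\<^sub>E {..<m j}. (c j \<sigma>)\<^sup>2) \<le> 1"
  defines "F \<equiv> \<lambda>j. mpoly A (m j) (c j) (\<lambda>i a x. \<phi> j a (x j))"
  assumes range: "\<And>j X. (\<And>i. i \<in> A \<Longrightarrow> X i \<in> set_pmf P) \<Longrightarrow> 0 \<le> F j X \<and> F j X \<le> 1"
    and \<mu>: "\<And>j. 0 < \<mu> j" "\<And>j. \<mu> j \<le> 1" "\<And>j. c j (\<lambda>i\<in>A. 0) = \<mu> j"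
    and e: "0 < e" and \<delta>: "0 < \<delta>" "\<delta> < 1" "CARD('l) * (\<delta> / (1 - \<rho>)) \<le> e"
    and k: "CARD('l) * (1 - \<delta>) ^ k \<le> e" and t: "0 < t" "3 * real CARD('l) ^ 4 * C ^ k * k * t \<le> e"
    and r: "CARD('l) * real k \<le> t\<^sup>2 * r"
    and small: "\<And>j \<sigma>. \<sigma> \<in> A \<rightarrow>\<^sub>E {..<m j} \<Longrightarrow> 0 < wt A \<sigma> \<Longrightarrow> wt A \<sigma> \<le> r \<Longrightarrow> \<bar>c j \<sigma>\<bar> \<le> \<gamma>"
    and N: "\<And>j. m j \<le> N" "0 < N" "real N ^ r * \<gamma>\<^sup>2 \<le> e\<^sup>2"
  shows "(\<Prod>j\<in>UNIV. ((\<mu> j)\<^sup>2 / 8) ^ b) * (1 - 24 * e * (\<Sum>j\<in>UNIV. 1 / (\<mu> j)\<^sup>2)) - 3 * e \<le>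
    expec (iid A undefined P) (\<lambda>X. \<Prod>j\<in>UNIV. F j X)"
proof -
  have finP: "finite (set_pmf P)" by simp
  have finp: "finite (set_pmf p)" using finQ by (simp add: p_def)
  define d where "d = (undefined :: 'l \<Rightarrow> 'w, undefined :: 'l \<Rightarrow> 'r)"
  have map: "map_pmf fst p = P" by (simp add: p_def map_fst_pair_pmf)
  have fst_E: "expec p (\<lambda>z. f (fst z)) = expec P f" for f :: "_ \<Rightarrow> real"
    by (simp add: p_def expec_pair_pmf finP finQ)
  have snd_E: "expec p (\<lambda>z. f (snd z)) = expec Q f" for f :: "_ \<Rightarrow> real"
    by (simp add: p_def expec_pair_pmf finP finQ)
  have revp: "reverse_hoelder p (\<lambda>j z. snd z j) b"
    unfolding reverse_hoelder_def
  proof (intro allI impI)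
    fix v :: "'l \<Rightarrow> 'r \<Rightarrow> real" assume "\<forall>j r. 0 \<le> v j r"
    then show "(\<Prod>j\<in>UNIV. expec p (\<lambda>z. v j (snd z j)) ^ b) \<le> expec p (\<lambda>z. \<Prod>j\<in>UNIV. v j (snd z j) ^ b)"
      using rev unfolding reverse_hoelder_def
      unfolding snd_E[of "\<lambda>r. v _ (r _)"] snd_E[of "\<lambda>r. \<Prod>j\<in>UNIV. v j (r j) ^ b"] by blast
  qed
  have oP: "ortho_system P (m j) K (\<lambda>a x. \<phi> j a (x j))" for j
  proof -
    have "ortho_system p (m j) K (\<alpha> j)" using ms by (simp add: matching_systems_def)
    then show ?thesis
      unfolding ortho_system_def \<alpha>_def fst_E[of "\<lambda>x. \<phi> j _ (x j) * \<phi> j _ (x j)"]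
      unfolding map[symmetric] set_map_pmf by auto
  qed
  define cd where "cd j \<sigma> = (1 - \<delta>) ^ wt A \<sigma> * c j \<sigma>" for j \<sigma>
  define ck where "ck j \<sigma> = (if wt A \<sigma> \<le> k then cd j \<sigma> else 0)" for j \<sigma>
  have cd_le: "\<bar>cd j \<sigma>\<bar> \<le> \<bar>c j \<sigma>\<bar>" for j \<sigma>
  proof -
    have "(1 - \<delta>) ^ wt A \<sigma> \<le> 1" using \<delta> by (intro power_le_one) auto
    then have "(1 - \<delta>) ^ wt A \<sigma> * \<bar>c j \<sigma>\<bar> \<le> 1 * \<bar>c j \<sigma>\<bar>" by (intro mult_right_mono) auto
    then show ?thesis using \<delta> by (simp add: cd_def abs_mult)
  qed
  have ck1: "(\<Sum>\<sigma>\<in>A \<rightarrow>\<^sub>E {..<m j}. (ck j \<sigma>)\<^sup>2) \<le> 1" for j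
  proof -
    have "(ck j \<sigma>)\<^sup>2 \<le> (c j \<sigma>)\<^sup>2" for \<sigma>
      using cd_le[of j \<sigma>] by (simp add: ck_def abs_le_square_iff[symmetric])
    then show ?thesis using c1[of j] by (meson order_trans sum_mono)
  qed
  have ckdeg: "k < wt A \<sigma> \<Longrightarrow> ck j \<sigma> = 0" for j \<sigma> by (simp add: ck_def)
  \<comment> \<open>Influences are taken of the truncated polynomials, whose bounded degree bounds
    the sum of the influences.\<close>
  define J where "J = {i\<in>A. \<exists>j. t\<^sup>2 < influence A (m j) (ck j) i}"
  define B where "B = A - J"
  have fin: "finite J" "finite B" and disj: "J \<inter> B = {}" and JB: "J \<union> B = A"
    using A by (auto simp: J_def B_def)
  have infl0: "0 \<le> influence A (m j) (ck j) i" for i j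
    by (auto simp: influence_def intro!: sum_nonneg)
  have inflB: "influence A (m j) (ck j) i \<le> t\<^sup>2" if "i \<in> B" for i j
    using that by (auto simp: B_def J_def not_less)
  \<comment> \<open>Markov's inequality: the influences of all steps add up to at most CARD('l)
    times \<open>k\<close>, and every element of \<open>J\<close> takes more than t^2 of
    this.\<close>
  have cardJ: "card J \<le> r"
  proof -
    have "t\<^sup>2 * card J = (\<Sum>i\<in>J. t\<^sup>2)" by simp
    also have "\<dots> \<le> (\<Sum>i\<in>J. \<Sum>j\<in>UNIV. influence A (m j) (ck j) i)"
    proof (rule sum_mono)
      fix i assume "i \<in> J"
      then obtain j where "t\<^sup>2 < influence A (m j) (ck j) i" by (auto simp: J_def)
      also have "\<dots> \<le> (\<Sum>j\<in>UNIV. influence A (m j) (ck j) i)"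
        using infl0 by (intro member_le_sum[of j UNIV "\<lambda>j. influence A (m j) (ck j) i"]) auto
      finally show "t\<^sup>2 \<le> (\<Sum>j\<in>UNIV. influence A (m j) (ck j) i)" by simp
    qed
    also have "\<dots> = (\<Sum>j\<in>UNIV. \<Sum>i\<in>J. influence A (m j) (ck j) i)" by (rule sum.swap)
    also have "\<dots> \<le> (\<Sum>j\<in>(UNIV :: 'l set). real k)"
      by (intro sum_mono sum_influence_le[OF A ckdeg ck1]) (auto simp: J_def)
    also have "\<dots> \<le> t\<^sup>2 * r" using r by simp
    finally show ?thesis using t by simp
  qed
  define g where "g j = mpoly A (m j) (cd j) (hybrid \<alpha> \<beta> {} j)" for j
  define gk where "gk j = mpoly A (m j) (ck j) (hybrid \<alpha> \<beta> {} j)" for j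
  define hk where "hk j = mpoly A (m j) (ck j) (hybrid \<alpha> \<beta> B j)" for j
  have g_fst: "g j z = mpoly A (m j) (cd j) (\<lambda>i a x. \<phi> j a (x j)) (\<lambda>i. fst (z i))" for j z
    by (simp add: g_def mpoly_def hybrid_def \<alpha>_def)
  have g01: "0 \<le> g j z \<and> g j z \<le> 1" if "\<And>i. i \<in> A \<Longrightarrow> z i \<in> set_pmf p" for j z
    unfolding g_fst cd_def
  proof (rule noise_range[OF \<delta>(1,2) oP A])
    show "fst (z i) \<in> set_pmf P" if "i \<in> A" for i
      using \<open>i \<in> A \<Longrightarrow> z i \<in> set_pmf p\<close>[OF that] by (auto simp: p_def)
  qed (use range in \<open>auto simp: F_def\<close>)
  have trunc: "expec (iid A d p) (\<lambda>z. \<bar>g j z - gk j z\<bar>) \<le> (1 - \<delta>) ^ k" for j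
    unfolding g_def gk_def ck_def cd_def
    by (rule truncation_error[OF A finp hybrid_ortho[OF ms] \<delta>(1,2) c1])
  have inv: "expec (iid J d p) (\<lambda>X. \<bar>expec (iid B d p) (\<lambda>Y. \<Prod>j\<in>S. (sin (hk j (glue J X Y)))\<^sup>2) -
      expec (iid B d p) (\<lambda>Y. \<Prod>j\<in>S. (sin (gk j (glue J X Y)))\<^sup>2)\<bar>) \<le> e" for S
  proof -
    have "expec (iid J d p) (\<lambda>X. \<bar>expec (iid B d p) (\<lambda>Y. \<Prod>j\<in>S. (sin (hk j (glue J X Y)))\<^sup>2) -
      expec (iid B d p) (\<lambda>Y. \<Prod>j\<in>S. (sin (gk j (glue J X Y)))\<^sup>2)\<bar>) \<le> 3 * real CARD('l) ^ 4 * C ^ k * k * t"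
      unfolding hk_def gk_def JB[symmetric]
      by (rule invariance_conditional[OF ms finp C fin disj _ _ t(1)])
         (simp_all add: JB ckdeg ck1 inflB)
    then show ?thesis using t(2) by simp
  qed
  have split: "expec (iid A d p) T = expec (iid J d p) (\<lambda>X. expec (iid B d p) (\<lambda>Y. T (glue J X Y)))" for T :: "_ \<Rightarrow> real"
    using expec_iid_glue[OF fin disj finp, of d T] by (simp only: JB)
  define M where "M j X = expec (iid B d p) (\<lambda>Y. (sin (hk j (glue J X Y)))\<^sup>2)" for j X
  define V where "V j X = expec (iid B d p) (\<lambda>Y. (sin (gk j (glue J X Y)))\<^sup>2)" for j X
  define T where "T j X = expec (iid B d p) (\<lambda>Y. \<bar>g j (glue J X Y) - gk j (glue J X Y)\<bar>)" for j X
  define E where "E j X = \<bar>expec (iid B d p) (\<lambda>Y. g j (glue J X Y)) - \<mu> j\<bar>" for j X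
  define R where "R j X = \<bar>M j X - V j X\<bar> + T j X + E j X / 2" for j X
  have T0: "0 \<le> T j X" for j X unfolding T_def by (rule expec_nonneg) simp
  have R0: "0 \<le> R j X" for j X using T0[of j X] by (simp add: R_def E_def)
  have card1: "1 \<le> real CARD('l)" by (simp add: Suc_leI)
  have ER: "expec (iid J d p) (R j) \<le> 3 * e" for j
  proof -
    have "expec (iid J d p) (\<lambda>X. \<bar>M j X - V j X\<bar>) \<le> e"
      using inv[of "{j}"] by (simp add: M_def V_def)
    moreover have "expec (iid J d p) (T j) \<le> e"
    proof -
      have "expec (iid J d p) (T j) \<le> (1 - \<delta>) ^ k"
        using trunc[of j] unfolding T_def[abs_def] split .
      also have "\<dots> \<le> CARD('l) * (1 - \<delta>) ^ k"
        using card1 \<delta> mult_right_mono[OF card1, of "(1 - \<delta>) ^ k"] by simp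
      finally show ?thesis using k by simp
    qed
    \<comment> \<open>The untruncated coefficients \<open>cd\<close> are used here. Noise only
      shrinks coefficients and keeps the constant one, so both hypotheses on \<open>c\<close> carry
      over.\<close>
    moreover have "expec (iid J d p) (E j) \<le> e"
      unfolding E_def[abs_def] g_def JB[symmetric]
    proof (rule conditional_mean_error[OF fin disj finp hybrid_ortho[OF ms]])
      show "cd j (\<lambda>i\<in>J \<union> B. 0) = \<mu> j"
        by (simp add: JB cd_def \<mu>(3) wt_def)
      show "\<bar>cd j \<sigma>\<bar> \<le> \<gamma>" if "\<sigma> \<in> J \<union> B \<rightarrow>\<^sub>E {..<m j}" "0 < wt (J \<union> B) \<sigma>" "wt (J \<union> B) \<sigma> \<le> card J" for \<sigma>
        using that cardJ small[of \<sigma> j] cd_le[of j \<sigma>] unfolding JB by linarith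
      have "real (m j) ^ card J \<le> real N ^ card J" using N(1) by (intro power_mono) auto
      also have "\<dots> \<le> real N ^ r" using N(2) cardJ by (intro power_increasing) auto
      finally have "real (m j) ^ card J * \<gamma>\<^sup>2 \<le> real N ^ r * \<gamma>\<^sup>2" by (intro mult_right_mono) auto
      also note N(3)
      finally show "real (m j) ^ card J * \<gamma>\<^sup>2 \<le> e\<^sup>2" .
    qed (use e in simp)
    ultimately show ?thesis using e unfolding R_def[abs_def] by (simp add: expec_add expec_divide)
  qed
  have lower: "(\<mu> j)\<^sup>2 / 4 - R j X \<le> M j X" if X: "X \<in> set_pmf (iid J d p)" for j X
  proof -
    have "(\<mu> j)\<^sup>2 / 4 - E j X / 2 - T j X \<le> V j X"
      unfolding E_def T_def V_def
    proof (rule sin_square_mean_lower[OF _ g01 \<mu>(1,2)])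
      show "finite (set_pmf (iid B d p))" using fin finp by simp
      show "glue J X Y i \<in> set_pmf p" if "Y \<in> set_pmf (iid B d p)" "i \<in> A" for Y i
        using glue_in_support[OF fin X that(1)] that(2) JB by blast
    qed
    then show ?thesis unfolding R_def by linarith
  qed
  define P0 where "P0 = (\<Prod>j\<in>UNIV. ((\<mu> j)\<^sup>2 / 8) ^ b)"
  have P0: "0 \<le> P0" by (auto simp: P0_def intro!: prod_nonneg)
  have "P0 * (1 - 24 * e * (\<Sum>j\<in>UNIV. 1 / (\<mu> j)\<^sup>2)) = P0 * (1 - (\<Sum>j\<in>UNIV. 8 / (\<mu> j)\<^sup>2 * (3 * e)))"
    by (simp add: sum_distrib_left)
  also have "\<dots> \<le> P0 * (1 - (\<Sum>j\<in>UNIV. 8 / (\<mu> j)\<^sup>2 * expec (iid J d p) (R j)))"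
    by (intro mult_left_mono[OF _ P0] diff_left_mono sum_mono mult_left_mono ER) auto
  also have "\<dots> = expec (iid J d p) (\<lambda>X. P0 * (1 - (\<Sum>j\<in>UNIV. 8 / (\<mu> j)\<^sup>2 * R j X)))"
    using fin finp by (simp only: expec_cmult expec_diff expec_sum expec_const finite_iid)
  also have "\<dots> \<le> expec (iid J d p) (\<lambda>X. \<Prod>j\<in>UNIV. M j X ^ b)"
    unfolding P0_def
    by (intro expec_mono prod_power_deviation_bound \<mu>(1) lower R0) (auto simp: M_def intro!: expec_nonneg)
  also have "\<dots> \<le> expec (iid J d p) (\<lambda>X. expec (iid B d p) (\<lambda>Y. \<Prod>j\<in>UNIV. (sin (hk j (glue J X Y)))\<^sup>2))"
    unfolding M_def hk_def JB[symmetric] \<alpha>_def \<beta>_def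
    by (intro expec_mono hybrid_rounding_lower[OF finp fin disj b revp])
  also have "\<dots> \<le> expec (iid J d p) (\<lambda>X. expec (iid B d p) (\<lambda>Y. \<Prod>j\<in>UNIV. (sin (gk j (glue J X Y)))\<^sup>2) +
      \<bar>expec (iid B d p) (\<lambda>Y. \<Prod>j\<in>UNIV. (sin (hk j (glue J X Y)))\<^sup>2) -
       expec (iid B d p) (\<lambda>Y. \<Prod>j\<in>UNIV. (sin (gk j (glue J X Y)))\<^sup>2)\<bar>)"
    by (intro expec_mono) linarith
  also have "\<dots> \<le> expec (iid A d p) (\<lambda>z. \<Prod>j\<in>UNIV. (sin (gk j z))\<^sup>2) + e"
    unfolding expec_add split using inv[of UNIV] by simp
  also have "expec (iid A d p) (\<lambda>z. \<Prod>j\<in>UNIV. (sin (gk j z))\<^sup>2) \<le>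
      expec (iid A d p) (\<lambda>z. (\<Prod>j\<in>UNIV. g j z) + (\<Sum>j\<in>UNIV. \<bar>g j z - gk j z\<bar>))"
  proof (rule expec_mono)
    fix z assume z: "z \<in> set_pmf (iid A d p)"
    \<comment> \<open>Truncated values may leave [0,1], where sin^2 x \<le> x can fail. The
      Lipschitz bound therefore leads from \<open>gk\<close> back to \<open>g\<close> before that
      inequality is used.\<close>
    have "norm ((\<Prod>j\<in>UNIV. (sin (gk j z))\<^sup>2) - (\<Prod>j\<in>UNIV. (sin (g j z))\<^sup>2)) \<le>
        (\<Sum>j\<in>UNIV. norm ((sin (gk j z))\<^sup>2 - (sin (g j z))\<^sup>2))"
      by (rule norm_prod_diff) (auto simp: sin_square_le_one)
    also have "\<dots> \<le> (\<Sum>j\<in>UNIV. \<bar>g j z - gk j z\<bar>)"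
      using sin_square_lipschitz by (intro sum_mono) (simp add: abs_minus_commute)
    finally have "(\<Prod>j\<in>UNIV. (sin (gk j z))\<^sup>2) \<le> (\<Prod>j\<in>UNIV. (sin (g j z))\<^sup>2) + (\<Sum>j\<in>UNIV. \<bar>g j z - gk j z\<bar>)"
      by simp
    also have "(\<Prod>j\<in>UNIV. (sin (g j z))\<^sup>2) \<le> (\<Prod>j\<in>UNIV. g j z)"
      using g01[OF set_iidD[OF z A]] by (intro prod_mono conjI sin_square_le) auto
    finally show "(\<Prod>j\<in>UNIV. (sin (gk j z))\<^sup>2) \<le> (\<Prod>j\<in>UNIV. g j z) + (\<Sum>j\<in>UNIV. \<bar>g j z - gk j z\<bar>)" by simp
  qed
  also have "\<dots> = expec (iid A d p) (\<lambda>z. \<Prod>j\<in>UNIV. g j z) + (\<Sum>j\<in>UNIV. expec (iid A d p) (\<lambda>z. \<bar>g j z - gk j z\<bar>))"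
    by (simp only: expec_add expec_sum)
  also have "(\<Sum>j\<in>UNIV. expec (iid A d p) (\<lambda>z. \<bar>g j z - gk j z\<bar>)) \<le> (\<Sum>j\<in>(UNIV :: 'l set). (1 - \<delta>) ^ k)"
    by (intro sum_mono trunc)
  also have "\<dots> \<le> e" using k by simp
  also have "expec (iid A d p) (\<lambda>z. \<Prod>j\<in>UNIV. g j z) =
    expec (iid A undefined P) (\<lambda>X. \<Prod>j\<in>UNIV. mpoly A (m j) (cd j) (\<lambda>i a x. \<phi> j a (x j)) X)"
    using expec_iid_map[OF A finp, of fst d "\<lambda>X. \<Prod>j\<in>UNIV. mpoly A (m j) (cd j) (\<lambda>i a x. \<phi> j a (x j)) X"]
    by (simp add: map d_def g_fst)
  also have "\<dots> \<le> expec (iid A undefined P) (\<lambda>X. \<Prod>j\<in>UNIV. F j X) + e"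
    using noise_product_error[OF \<rho> \<delta>(1,2) oP A c1 range[unfolded F_def], of undefined] \<delta>(3)
    unfolding cd_def F_def by simp
  finally show ?thesis by (simp add: P0_def)
qed

section \<open>The given functions as polynomials, and the choice of constants\<close>

lemma fourier_basis_ortho_system:
  fixes P :: "('l::finite \<Rightarrow> 'w::finite) pmf"
  assumes b: "fourier_basis (marginal P j) m \<phi>"
  shows "ortho_system P m (basis_bound P) (\<lambda>a x. \<phi> a (x j))"
  unfolding ortho_system_def
proof (intro conjI ballI allI impI)
  show "0 < m" using b by (simp add: fourier_basis_def)
  show "expec P (\<lambda>x. \<phi> a (x j) * \<phi> c (x j)) = (if a = c then 1 else 0)" if "a < m" "c < m" for a c
    using fourier_basis_expec[OF b that] by (simp add: expec_marginal)
  fix z assume "z \<in> set_pmf P"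
  then have x: "z j \<in> set_pmf (marginal P j)" by (simp add: marginal_def)
  then show "\<phi> 0 (z j) = 1" using b by (simp add: fourier_basis_def)
  have "(\<Sum>a<m. (\<phi> a (z j))\<^sup>2) \<le> (\<Sum>x\<in>set_pmf (marginal P j). \<Sum>a<m. (\<phi> a x)\<^sup>2)"
    using x by (intro member_le_sum[of "z j"]) (auto intro!: sum_nonneg)
  also have "\<dots> \<le> basis_bound P" by (rule basis_bound_ge[OF b])
  finally show "(\<Sum>a<m. (\<phi> a (z j))\<^sup>2) \<le> basis_bound P" .
qed

lemma step_function_eq_mpoly:
  fixes P :: "('l::finite \<Rightarrow> 'w::finite) pmf"
  assumes b: "fourier_basis (marginal P j) m \<phi>" and X: "\<And>i. i < n \<Longrightarrow> X i \<in> set_pmf P"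
  shows "f (step_vec n j X) = mpoly {..<n} m (fourier_coeff P n j \<phi> f) (\<lambda>i a x. \<phi> a (x j)) X"
proof -
  have "step_vec n j X \<in> {..<n} \<rightarrow>\<^sub>E set_pmf (marginal P j)"
    using X by (auto simp: step_vec_def marginal_def)
  then have "f (step_vec n j X) =
    (\<Sum>\<sigma>\<in>multi_indices n m. fourier_coeff P n j \<phi> f \<sigma> * basis_prod n \<phi> \<sigma> (step_vec n j X))"
    by (rule fourier_expansion[OF b])
  then show ?thesis
    by (simp add: mpoly_def multi_indices_def basis_prod_def step_vec_def)
qed

lemma fourier_coeff_zero:
  fixes P :: "('l::finite \<Rightarrow> 'w::finite) pmf"
  assumes b: "fourier_basis (marginal P j) m \<phi>"
  shows "fourier_coeff P n j \<phi> f (\<lambda>i\<in>{..<n}. 0) = measure_pmf.expectation (iid_law P n) (\<lambda>X. f (step_vec n j X))"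
  unfolding fourier_coeff_def
proof (intro integral_cong_AE)
  have "basis_prod n \<phi> (\<lambda>i\<in>{..<n}. 0) (step_vec n j X) = 1" if "X \<in> set_pmf (iid_law P n)" for X
    unfolding basis_prod_def using b step_vec_support[OF that, of j]
    by (intro prod.neutral) (auto simp: fourier_basis_def PiE_iff)
  then show "AE X in measure_pmf (iid_law P n).
      f (step_vec n j X) * basis_prod n \<phi> (\<lambda>i\<in>{..<n}. 0) (step_vec n j X) = f (step_vec n j X)"
    by (simp add: AE_measure_pmf_iff)
qed simp_all

theorem theorem3p3:
  fixes P :: "('l::finite \<Rightarrow> 'w::finite) pmf"
    and \<rho> :: real
    and \<mu> :: "'l \<Rightarrow> real"
  assumes "CARD('l) \<ge> 2"
    and "max_corr P \<le> \<rho>" and "\<rho> < 1"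
    and "\<And>j. 0 < \<mu> j \<and> \<mu> j \<le> 1"
  shows "\<exists>(k::nat) (\<gamma>::real) (c::real). \<gamma> > 0 \<and> c > 0 \<and>
    (\<forall>(m :: 'l \<Rightarrow> nat) (\<phi> :: 'l \<Rightarrow> nat \<Rightarrow> 'w \<Rightarrow> real).
      (\<forall>j. fourier_basis (marginal P j) (m j) (\<phi> j)) \<longrightarrow>
      (\<forall>(n::nat) (f :: 'l \<Rightarrow> (nat \<Rightarrow> 'w) \<Rightarrow> real).
        (\<forall>j. \<forall>x \<in> {..<n} \<rightarrow>\<^sub>E UNIV. 0 \<le> f j x \<and> f j x \<le> 1) \<longrightarrow>
        (\<forall>j. measure_pmf.expectation (iid_law P n) (\<lambda>X. f j (step_vec n j X)) = \<mu> j) \<longrightarrow>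
        (\<forall>j. \<forall>\<sigma> \<in> multi_indices n (m j). 0 < index_weight n \<sigma> \<and> index_weight n \<sigma> \<le> k \<longrightarrow>
          \<bar>fourier_coeff P n j (\<phi> j) (f j) \<sigma>\<bar> \<le> \<gamma>) \<longrightarrow>
        measure_pmf.expectation (iid_law P n) (\<lambda>X. \<Prod>j\<in>UNIV. f j (step_vec n j X)) \<ge> c))"
proof -
  have finP: "finite (set_pmf P)" by simp
  \<comment> \<open>Kept away from 0, since \<open>correlation_decay\<close> divides by the square
    of the correlation bound.\<close>
  define \<rho>' where "\<rho>' = max \<rho> (1 / 2)"
  have \<rho>': "max_corr P \<le> \<rho>'" "0 < \<rho>'" "\<rho>' < 1" using assms(2,3) by (auto simp: \<rho>'_def)
  obtain Q :: "('l \<Rightarrow> bool \<times> 'l \<times> 'w) pmf" and w :: "'l \<Rightarrow> 'w \<Rightarrow> bool \<times> 'l \<times> 'w \<Rightarrow> real" and b :: nat and K :: real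
    where finQ: "finite (set_pmf Q)" and K: "0 \<le> K" and b: "0 < b" and rev: "reverse_hoelder Q (\<lambda>j r. r j) b"
    and ms: "\<forall>m \<phi>. (\<forall>j. fourier_basis (marginal P j) (m j) (\<phi> j)) \<longrightarrow>
      matching_systems (pair_pmf P Q) K m (\<lambda>j a z. \<phi> j a (fst z j)) (\<lambda>j a z. \<Sum>x\<in>UNIV. w j x (snd z j) * \<phi> j a x)"
    by (rule matching_systems_exist[OF \<rho>']) (rule that)
  define C where "C = 4 + 3 * K"
  have C: "4 \<le> C" "3 * K \<le> C\<^sup>2"
  proof -
    show 4: "4 \<le> C" using K by (simp add: C_def)
    have "3 * K \<le> C * 1" by (simp add: C_def)
    also have "\<dots> \<le> C * C" using 4 by (intro mult_left_mono) auto
    finally show "3 * K \<le> C\<^sup>2" by (simp add: power2_eq_square)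
  qed
  define L where "L = real CARD('l)"
  define N where "N = CARD('w)"
  have L: "1 \<le> L" by (simp add: L_def Suc_leI)
  have N: "0 < N" by (simp add: N_def)
  have \<mu>: "0 < \<mu> j" "\<mu> j \<le> 1" for j using assms(4) by auto
  define P0 where "P0 = (\<Prod>j\<in>UNIV. ((\<mu> j)\<^sup>2 / 8) ^ b)"
  have P0: "0 < P0" unfolding P0_def
  proof (intro prod_pos ballI zero_less_power)
    fix j show "0 < (\<mu> j)\<^sup>2 / 8" using \<mu>(1)[of j] by simp
  qed
  define S where "S = (\<Sum>j\<in>UNIV. 1 / (\<mu> j)\<^sup>2)"
  have S: "0 < S" unfolding S_def
  proof (intro sum_pos)
    fix j show "0 < 1 / (\<mu> j)\<^sup>2" using \<mu>(1)[of j] by simp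
  qed auto
  \<comment> \<open>The two bounds give 24 e S \<le> 1/2 and 3 e \<le> 3 P0/8, so that P0/2 - 3 P0/8
    = P0/8 remains.\<close>
  define e where "e = min (P0 / 8) (1 / (48 * S))"
  have e: "0 < e" "e \<le> P0 / 8" "e \<le> 1 / (48 * S)" using P0 S by (auto simp: e_def)
  have final: "P0 / 8 \<le> P0 * (1 - 24 * e * S) - 3 * e"
  proof -
    have "24 * e * S \<le> 1 / 2" using e(3) S by (simp add: field_simps)
    then have "P0 * (1 / 2) \<le> P0 * (1 - 24 * e * S)" using P0 by (intro mult_left_mono) auto
    with e(2) show ?thesis by linarith
  qed
  \<comment> \<open>The bound 1/2 keeps \<delta> below 1; the other one makes the noise errors of
    all steps together at most \<open>e\<close>.\<close>
  define \<delta> where "\<delta> = min (1 / 2) (e * (1 - \<rho>') / L)"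
  have \<delta>: "0 < \<delta>" "\<delta> < 1" using e \<rho>' L by (auto simp: \<delta>_def)
  have "\<delta> \<le> e * (1 - \<rho>') / L" by (simp add: \<delta>_def)
  then have \<delta>e: "L * (\<delta> / (1 - \<rho>')) \<le> e" using \<rho>' L by (simp add: field_simps)
  obtain k where "(1 - \<delta>) ^ k < e / L"
    using real_arch_pow_inv[of "e / L" "1 - \<delta>"] \<delta> e L by auto
  then have k: "L * (1 - \<delta>) ^ k \<le> e" using L by (simp add: field_simps)
  \<comment> \<open>\<open>k + 1\<close> in place of \<open>k\<close> keeps \<open>D\<close>
    positive.\<close>
  define D where "D = 3 * L ^ 4 * C ^ k * (k + 1)"
  have D: "0 < D" using L C by (simp add: D_def)
  define t where "t = e / D"
  have t: "0 < t" using e D by (simp add: t_def)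
  have te: "3 * L ^ 4 * C ^ k * k * t \<le> e"
  proof -
    have "3 * L ^ 4 * C ^ k * k * t \<le> D * t"
      unfolding D_def using L C t by (intro mult_right_mono mult_left_mono) auto
    also have "\<dots> = e" using D by (simp add: t_def)
    finally show ?thesis .
  qed
  \<comment> \<open>\<open>r\<close> will bound the number of coordinates of large
    influence.\<close>
  obtain r :: nat where "L * k / t\<^sup>2 \<le> r" using real_arch_simple by blast
  then have r: "L * k \<le> t\<^sup>2 * r" using t by (simp add: field_simps)
  define \<gamma> where "\<gamma> = e / real N ^ r"
  have \<gamma>: "0 < \<gamma>" using e N by (simp add: \<gamma>_def)
  have \<gamma>e: "real N ^ r * \<gamma>\<^sup>2 \<le> e\<^sup>2"
  proof -
    have N1: "1 \<le> real N ^ r" using N by (intro one_le_power) simp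
    have "real N ^ r * \<gamma>\<^sup>2 = e\<^sup>2 / real N ^ r" using N by (simp add: \<gamma>_def power2_eq_square)
    also have "\<dots> \<le> e\<^sup>2 / 1" using N1 N by (intro divide_left_mono) auto
    finally show ?thesis by simp
  qed
  show ?thesis
  \<comment> \<open>The weight threshold is \<open>r\<close>, since a mean conditional on at most
    \<open>r\<close> coordinates involves coefficients of weight up to \<open>r\<close>.\<close>
  proof (rule exI[of _ r], rule exI[of _ \<gamma>], rule exI[of _ "P0 / 8"], intro conjI allI impI)
    fix m :: "'l \<Rightarrow> nat" and \<phi> :: "'l \<Rightarrow> nat \<Rightarrow> 'w \<Rightarrow> real" and n :: nat and f :: "'l \<Rightarrow> (nat \<Rightarrow> 'w) \<Rightarrow> real"
    assume "\<forall>j. fourier_basis (marginal P j) (m j) (\<phi> j)"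
      and f01: "\<forall>j. \<forall>x\<in>{..<n} \<rightarrow>\<^sub>E UNIV. 0 \<le> f j x \<and> f j x \<le> 1"
      and mean: "\<forall>j. measure_pmf.expectation (iid_law P n) (\<lambda>X. f j (step_vec n j X)) = \<mu> j"
      and small: "\<forall>j. \<forall>\<sigma>\<in>multi_indices n (m j). 0 < index_weight n \<sigma> \<and> index_weight n \<sigma> \<le> r \<longrightarrow>
        \<bar>fourier_coeff P n j (\<phi> j) (f j) \<sigma>\<bar> \<le> \<gamma>"
    then have fb: "fourier_basis (marginal P j) (m j) (\<phi> j)" for j by blast
    define A where "A = {..<n}"
    have A: "finite A" by (simp add: A_def)
    define c where "c j = fourier_coeff P n j (\<phi> j) (f j)" for j
    define F where "F j = mpoly A (m j) (c j) (\<lambda>i a x. \<phi> j a (x j))" for j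
    have F: "F j X = f j (step_vec n j X)" if "\<And>i. i \<in> A \<Longrightarrow> X i \<in> set_pmf P" for j X
      unfolding F_def c_def A_def by (rule step_function_eq_mpoly[OF fb, symmetric]) (use that in \<open>simp add: A_def\<close>)
    have F01: "0 \<le> F j X \<and> F j X \<le> 1" if "\<And>i. i \<in> A \<Longrightarrow> X i \<in> set_pmf P" for j X
      using f01 F[of X j] that by (auto simp: step_vec_def)
    have c1: "(\<Sum>\<sigma>\<in>A \<rightarrow>\<^sub>E {..<m j}. (c j \<sigma>)\<^sup>2) \<le> 1" for j
    proof -
      have "(\<Sum>\<sigma>\<in>A \<rightarrow>\<^sub>E {..<m j}. (c j \<sigma>)\<^sup>2) = expec (iid A undefined P) (\<lambda>X. (F j X)\<^sup>2)"
        unfolding F_def by (rule mpoly_parseval[OF A finP, symmetric]) (rule fourier_basis_ortho_system[OF fb])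
      also have "\<dots> \<le> expec (iid A undefined P) (\<lambda>X. 1)"
      proof (rule expec_mono)
        fix X assume X: "X \<in> set_pmf (iid A undefined P)"
        have "0 \<le> F j X \<and> F j X \<le> 1" by (rule F01) (rule set_iidD[OF X A])
        then show "(F j X)\<^sup>2 \<le> 1" by (simp add: abs_square_le_1)
      qed
      finally show ?thesis using A finP by simp
    qed
    have "P0 / 8 \<le> P0 * (1 - 24 * e * S) - 3 * e" by (rule final)
    also have "\<dots> \<le> expec (iid A undefined P) (\<lambda>X. \<Prod>j\<in>UNIV. F j X)"
      unfolding P0_def S_def F_def
    proof (rule product_lower_bound[OF \<rho>' finQ b rev ms[rule_format, OF fb] C A c1 _ \<mu> _ e(1) \<delta> _ _ t _ _ _ _ N \<gamma>e])
      show "0 \<le> mpoly A (m j) (c j) (\<lambda>i a x. \<phi> j a (x j)) X \<and> mpoly A (m j) (c j) (\<lambda>i a x. \<phi> j a (x j)) X \<le> 1"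
        if "\<And>i. i \<in> A \<Longrightarrow> X i \<in> set_pmf P" for j X
        using F01[OF that] by (simp add: F_def)
      show "c j (\<lambda>i\<in>A. 0) = \<mu> j" for j
        using mean by (simp add: c_def A_def fourier_coeff_zero[OF fb])
      show "\<bar>c j \<sigma>\<bar> \<le> \<gamma>" if "\<sigma> \<in> A \<rightarrow>\<^sub>E {..<m j}" "0 < wt A \<sigma>" "wt A \<sigma> \<le> r" for j \<sigma>
        using small that by (simp add: c_def A_def multi_indices_def index_weight_def wt_def)
      show "m j \<le> N" for j unfolding N_def by (rule fourier_basis_size[OF fb])
    qed (use \<delta>e k te r in \<open>simp_all add: L_def\<close>)
    also have "\<dots> = expec (iid_law P n) (\<lambda>X. \<Prod>j\<in>UNIV. f j (step_vec n j X))"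
    proof -
      have "iid A undefined P = iid_law P n" by (simp add: iid_def iid_law_def A_def)
      moreover have "(\<Prod>j\<in>UNIV. F j X) = (\<Prod>j\<in>UNIV. f j (step_vec n j X))" if "X \<in> set_pmf (iid A undefined P)" for X
        by (intro prod.cong refl F) (rule set_iidD[OF that A])
      ultimately show ?thesis by (metis (no_types, lifting) expec_cong)
    qed
    also have "\<dots> = measure_pmf.expectation (iid_law P n) (\<lambda>X. \<Prod>j\<in>UNIV. f j (step_vec n j X))"
      by (rule expec_eq_expectation[OF finite_set_iid_law, symmetric])
    finally show "P0 / 8 \<le> measure_pmf.expectation (iid_law P n) (\<lambda>X. \<Prod>j\<in>UNIV. f j (step_vec n j X))" .
  qed (use \<gamma> P0 in simp_all)
qed

end
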